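(* In the setting described in the context, let $\mathcal{B}_1,\mathcal{B}_2$ be $v$-reduced sequences of bases of $M_\kappa$. Then there exist $v$-reduced sequences of bases $\mathcal{B}_1',\mathcal{B}_2'$ with $\mathcal{B}_i'\sim\mathcal{B}_i$ ($i=1,2$) such that either $\mathfrak{M}_{\mathcal{B}_1'}=\mathfrak{M}_{\mathcal{B}_2'}$, or $\mathfrak{M}_{\mathcal{B}_1'}\neq\mathfrak{M}_{\mathcal{B}_2'}$ and $\mathfrak{M}_{\mathcal{B}_1'}\triangle\mathfrak{M}_{\mathcal{B}_2'}$ has exactly one non-trivial component, which is a $4$-cycle.
   Context: Graphs may have loops and parallel edges. A biased graph $(G,\mathcal{C})$ is a graph with a set $\mathcal{C}$ of cycles (balanced; others unbalanced) such that if two cycles of a theta graph (three cycles $C_1,C_2,C_3$ with $C_i\triangle C_j=C_k$) lie in $\mathcal{C}$ so does the third; it is linear if every cycle that is a symmetric difference of cycles of $\mathcal{C}$ lies in $\mathcal{C}$. The frame matroid $M(\Omega)$ on $E(G)$ has bases the maximal edge sets $A$ such that each component of $G[A]$ has at most one cycle, which if present is unbalanced. Setting: $\Omega=(G,\mathcal{C})$ linear with $G$ connected, $\kappa\ge2$, and fixed compatible sequences of $\kappa$ bases of $M(\Omega)$ (equal multiset unions); $G_\kappa$ is obtained from $G$ by replacing each edge $e$ by $\omega(e)$ parallel copies (loops by loops), $\omega(e)$ being the number of those bases (in one sequence) containing $e$; $\mathcal{C}_\kappa$ is the set of cycles expressible as symmetric differences of cycles of $\mathcal{C}$ and 2-cycles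 formed by two copies of the same edge; $M_\kappa=M(G_\kappa,\mathcal{C}_\kappa)$. Sequences of bases of $M_\kappa$ considered here consist of $\kappa$ pairwise disjoint bases partitioning $E(M_\kappa)$. Fix a vertex $v$ of $G_\kappa$ with incident edges $e_1,\dots,e_m$, $m\le2\kappa$. A sequence of bases is $v$-reduced if every base meets $\{e_1,\dots,e_m\}$ in at most two edges. Its matching graph $\mathfrak{M}_{\mathcal{B}}$ has vertices $\mathsf{x}_1,\dots,\mathsf{x}_m$ and, for each base $B_i$ with $B_i\cap\{e_1,\dots,e_m\}=\{e_j,e_k\}$, an edge $\mathsf{x}_j\mathsf{x}_k$ (bases containing a single $e_j$ contribute no edge). $\mathfrak{M}_{\mathcal{B}}\triangle\mathfrak{M}_{\mathcal{B}'}$ is the graph on $\{\mathsf{x}_1,\dots,\mathsf{x}_m\}$ with edge set $E(\mathfrak{M}_{\mathcal{B}})\triangle E(\mathfrak{M}_{\mathcal{B}'})$; a non-trivial component is one with at least one edge. $\mathcal{B}\sim\mathcal{B}'$ means $\mathcal{B}'$ is obtained from $\mathcal{B}$ by a finite sequence of symmetric exchanges (replace $B_i,B_j$ by $B_i-e+f$, $B_j-f+e$, $e\in B_i$, $f\in B_j$, both bases). *)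

theory Defs
  imports "HOL-Library.Multiset"
begin

text \<open>Edges are names; \<open>ends\<close> gives the set of end vertices, a singleton exactly for a loop.\<close>

record ('v, 'e) mgraph =
  verts :: "'v set"
  edges :: "'e set"
  ends :: "'e \<Rightarrow> 'v set"

definition multigraph :: "('v, 'e) mgraph \<Rightarrow> bool" where
  "multigraph G \<longleftrightarrow> finite (verts G) \<and> finite (edges G) \<and>
     (\<forall>e\<in>edges G. ends G e \<subseteq> verts G \<and> card (ends G e) \<in> {1, 2})"

definition adj :: "('v, 'e) mgraph \<Rightarrow> ('v \<times> 'v) set" where
  "adj G = {(x, y). \<exists>e\<in>edges G. ends G e = {x, y}}"

definition connected_graph :: "('v, 'e) mgraph \<Rightarrow> bool" where
  "connected_graph G \<longleftrightarrow> verts G \<noteq> {} \<and> (\<forall>x\<in>verts G. \<forall>y\<in>verts G. (x, y) \<in> (adj G)\<^sup>*)"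

definition component_of :: "('v, 'e) mgraph \<Rightarrow> 'v \<Rightarrow> ('v, 'e) mgraph" where
  "component_of G x =
     (let W = {y \<in> verts G. (x, y) \<in> (adj G)\<^sup>*}
      in \<lparr>verts = W, edges = {e \<in> edges G. ends G e \<subseteq> W}, ends = ends G\<rparr>)"

definition components :: "('v, 'e) mgraph \<Rightarrow> ('v, 'e) mgraph set" where
  "components G = component_of G ` verts G"

text \<open>The subgraph \<open>G[A]\<close> formed by the edges in \<open>A\<close> and their ends.\<close>

definition edge_subgraph :: "('v, 'e) mgraph \<Rightarrow> 'e set \<Rightarrow> ('v, 'e) mgraph" where
  "edge_subgraph G A = \<lparr>verts = (\<Union>e\<in>A. ends G e), edges = A, ends = ends G\<rparr>"

definition incident_edges :: "('v, 'e) mgraph \<Rightarrow> 'v \<Rightarrow> 'e set" where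
  "incident_edges G x = {e \<in> edges G. x \<in> ends G e}"

text \<open>Loops count twice in the degree.\<close>

definition degree :: "('v, 'e) mgraph \<Rightarrow> 'v \<Rightarrow> nat" where
  "degree G x = card (incident_edges G x) + card {e \<in> edges G. ends G e = {x}}"

text \<open>A cycle is a finite connected 2-regular graph: a loop is a cycle of length 1, a pair of
  parallel non-loop edges a cycle of length 2. Cycles in a graph are identified with their
  edge sets.\<close>

definition cycle_graph :: "('v, 'e) mgraph \<Rightarrow> bool" where
  "cycle_graph G \<longleftrightarrow> finite (edges G) \<and> edges G \<noteq> {} \<and> connected_graph G \<and>
     (\<forall>x\<in>verts G. degree G x = 2)"

definition is_cycle :: "('v, 'e) mgraph \<Rightarrow> 'e set \<Rightarrow> bool" where
  "is_cycle G C \<longleftrightarrow> C \<subseteq> edges G \<and> cycle_graph (edge_subgraph G C)"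

definition sdiff :: "'a set \<Rightarrow> 'a set \<Rightarrow> 'a set" where
  "sdiff A B = (A - B) \<union> (B - A)"

definition Sdiff :: "'a set set \<Rightarrow> 'a set" where
  "Sdiff F = {x. odd (card {X \<in> F. x \<in> X})}"

text \<open>Two cycles that cross repeatedly can also satisfy this without their union being three internally
  disjoint paths; for linear biased graphs the closure condition holds for those as well.\<close>

definition theta :: "('v, 'e) mgraph \<Rightarrow> 'e set \<Rightarrow> 'e set \<Rightarrow> 'e set \<Rightarrow> bool" where
  "theta G C1 C2 C3 \<longleftrightarrow> is_cycle G C1 \<and> is_cycle G C2 \<and> is_cycle G C3 \<and>
     sdiff C1 C2 = C3 \<and> sdiff C2 C3 = C1 \<and> sdiff C1 C3 = C2"

definition biased_graph :: "('v, 'e) mgraph \<Rightarrow> 'e set set \<Rightarrow> bool" where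
  "biased_graph G \<C> \<longleftrightarrow> multigraph G \<and> (\<forall>C\<in>\<C>. is_cycle G C) \<and>
     (\<forall>C1 C2 C3. theta G C1 C2 C3 \<longrightarrow> C1 \<in> \<C> \<longrightarrow> C2 \<in> \<C> \<longrightarrow> C3 \<in> \<C>)"

definition linear_bias :: "('v, 'e) mgraph \<Rightarrow> 'e set set \<Rightarrow> bool" where
  "linear_bias G \<C> \<longleftrightarrow>
     (\<forall>F. finite F \<longrightarrow> F \<subseteq> \<C> \<longrightarrow> is_cycle G (Sdiff F) \<longrightarrow> Sdiff F \<in> \<C>)"

definition frame_indep :: "('v, 'e) mgraph \<Rightarrow> 'e set set \<Rightarrow> 'e set \<Rightarrow> bool" where
  "frame_indep G \<C> A \<longleftrightarrow> A \<subseteq> edges G \<and>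
     (\<forall>K\<in>components (edge_subgraph G A).
        (\<forall>C C'. is_cycle K C \<longrightarrow> is_cycle K C' \<longrightarrow> C = C') \<and>
        (\<forall>C. is_cycle K C \<longrightarrow> C \<notin> \<C>))"

definition frame_basis :: "('v, 'e) mgraph \<Rightarrow> 'e set set \<Rightarrow> 'e set \<Rightarrow> bool" where
  "frame_basis G \<C> B \<longleftrightarrow> frame_indep G \<C> B \<and>
     (\<forall>A. frame_indep G \<C> A \<longrightarrow> B \<subseteq> A \<longrightarrow> A = B)"

definition compatible :: "'e set list \<Rightarrow> 'e set list \<Rightarrow> bool" where
  "compatible Ds Ds' \<longleftrightarrow> (\<Sum>D\<leftarrow>Ds. mset_set D) = (\<Sum>D\<leftarrow>Ds'. mset_set D)"

definition omega :: "'e set list \<Rightarrow> 'e \<Rightarrow> nat" where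
  "omega Ds e = length (filter (\<lambda>D. e \<in> D) Ds)"

text \<open>The pair \<open>(e, i)\<close> is the \<open>i\<close>-th copy of \<open>e\<close>.\<close>

definition replicate_graph :: "('v, 'e) mgraph \<Rightarrow> ('e \<Rightarrow> nat) \<Rightarrow> ('v, 'e \<times> nat) mgraph" where
  "replicate_graph G w =
     \<lparr>verts = verts G, edges = {(e, i). e \<in> edges G \<and> i < w e}, ends = (\<lambda>(e, i). ends G e)\<rparr>"

text \<open>A cycle of \<open>\<C>\<close> occurs in the replicated graph through any choice of one copy of each of its
  edges. Copies of a loop are parallel loops and form no 2-cycle.\<close>

definition replicate_bias ::
  "('v, 'e) mgraph \<Rightarrow> 'e set set \<Rightarrow> ('e \<Rightarrow> nat) \<Rightarrow> ('e \<times> nat) set set" where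
  "replicate_bias G \<C> w =
     (let H = replicate_graph G w;
          lifts = {X. X \<subseteq> edges H \<and> inj_on fst X \<and> fst ` X \<in> \<C>};
          digons = {{(e, i), (e, j)} | e i j. i \<noteq> j \<and> is_cycle H {(e, i), (e, j)}}
      in {C. is_cycle H C \<and> (\<exists>F. finite F \<and> F \<subseteq> lifts \<union> digons \<and> C = Sdiff F)})"

definition base_seq :: "('v, 'e) mgraph \<Rightarrow> 'e set set \<Rightarrow> nat \<Rightarrow> 'e set list \<Rightarrow> bool" where
  "base_seq G \<C> k Bs \<longleftrightarrow> length Bs = k \<and> (\<forall>B\<in>set Bs. frame_basis G \<C> B) \<and>
     (\<forall>i<k. \<forall>j<k. i \<noteq> j \<longrightarrow> Bs ! i \<inter> Bs ! j = {}) \<and> \<Union>(set Bs) = edges G"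

definition sym_exchange ::
  "('v, 'e) mgraph \<Rightarrow> 'e set set \<Rightarrow> 'e set list \<Rightarrow> 'e set list \<Rightarrow> bool" where
  "sym_exchange G \<C> Bs Bs' \<longleftrightarrow>
     (\<exists>i j e f. i < length Bs \<and> j < length Bs \<and> i \<noteq> j \<and> e \<in> Bs ! i \<and> f \<in> Bs ! j \<and>
        frame_basis G \<C> (insert f (Bs ! i - {e})) \<and>
        frame_basis G \<C> (insert e (Bs ! j - {f})) \<and>
        Bs' = Bs[i := insert f (Bs ! i - {e}), j := insert e (Bs ! j - {f})])"

definition exchange_equiv ::
  "('v, 'e) mgraph \<Rightarrow> 'e set set \<Rightarrow> 'e set list \<Rightarrow> 'e set list \<Rightarrow> bool" where
  "exchange_equiv G \<C> = (sym_exchange G \<C>)\<^sup>*\<^sup>*"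

definition v_reduced :: "('v, 'e) mgraph \<Rightarrow> 'v \<Rightarrow> 'e set list \<Rightarrow> bool" where
  "v_reduced G v Bs \<longleftrightarrow> (\<forall>B\<in>set Bs. card (B \<inter> incident_edges G v) \<le> 2)"

text \<open>The edges \<open>e\<^sub>1, \<dots>, e\<^sub>m\<close> at \<open>v\<close> themselves serve as the vertices \<open>x\<^sub>1, \<dots>, x\<^sub>m\<close>, and an edge
  \<open>x\<^sub>jx\<^sub>k\<close> is the pair of its ends. For disjoint bases distinct bases give distinct pairs, so no
  parallel edges are lost.\<close>

definition matching_graph :: "('v, 'e) mgraph \<Rightarrow> 'v \<Rightarrow> 'e set list \<Rightarrow> ('e, 'e set) mgraph" where
  "matching_graph G v Bs =
     \<lparr>verts = incident_edges G v,
      edges = {B \<inter> incident_edges G v | B. B \<in> set Bs \<and> card (B \<inter> incident_edges G v) = 2},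
      ends = (\<lambda>X. X)\<rparr>"

text \<open>Only meaningful for graphs that agree in \<open>verts\<close> and \<open>ends\<close>.\<close>

definition graph_sdiff :: "('v, 'e) mgraph \<Rightarrow> ('v, 'e) mgraph \<Rightarrow> ('v, 'e) mgraph" where
  "graph_sdiff H K = \<lparr>verts = verts H, edges = sdiff (edges H) (edges K), ends = ends H\<rparr>"

definition nontrivial_components :: "('v, 'e) mgraph \<Rightarrow> ('v, 'e) mgraph set" where
  "nontrivial_components H = {K \<in> components H. edges K \<noteq> {}}"

end

theory Submission
  imports Defs
begin

text \<open>The balanced cycles of \<open>G\<^sub>\<kappa>\<close> are the cycles lying in a space \<open>\<D>\<close> of edge sets closed under
  symmetric difference, and this alone makes the frame independent sets a matroid. Of the star \<open>D\<close> of
  \<open>v\<close> only the following matters: its complement is a flat of the matroid.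

  Let \<open>B\<^sub>i\<close>, \<open>B\<^sub>j\<close> meet \<open>D\<close> in the pairs \<open>ab\<close>, \<open>cd\<close>, and put \<open>F\<^sub>i = B\<^sub>i - D\<close>. Contracting \<open>F\<^sub>i\<close> gives a rank 2
  matroid without loops on \<open>D\<close>, that is, a partition of \<open>D\<close> into parallel classes. If no exchange turns
  \<open>ab|cd\<close> into \<open>ac|bd\<close> or \<open>ad|bc\<close>, these partitions restrict to \<open>ac|bd\<close> for one of the two bases and
  to \<open>ad|bc\<close> for the other, and three exchanges swap the pairs \<open>ab\<close> and \<open>cd\<close> between the two
  bases. Permuting three pairs \<open>ab\<close>, \<open>ef\<close>, \<open>cd\<close> over three bases would, if both \<open>(ab, ef)\<close> and
  \<open>(ef, cd)\<close> were stuck, give three bases whose partitions of \<open>cdef\<close> are pairwise different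
  although only two are possible. So of two pairs of matching edges sharing an edge one can be switched.
  The rest concerns matchings: starting from a pair of reachable matchings with as many
  common edges, and then as many common uncovered points, as possible, every component of
  the symmetric difference other than a single 4-cycle would allow a further common edge.\<close>

section \<open>Matroids and exchanges between two bases\<close>

text \<open>The switching property compares two moves that share a matching edge, so it needs three
  edges of one matching and says nothing about two edges alone. An edge common to both matchings
  could serve as the third, but switching it away would lose it. This is where the exceptional
  4-cycle comes from.

  Every basis meets a nonempty star, hence all reachable matchings have the same number of edges.
  Therefore points covered by only one of two matchings always occur on both sides, and can be
  played off against each other.

  Two stuck pairs cannot be swapped inside the star: a star edge has to be traded for an edge away
  from \<open>v\<close>, and on the way one basis contains three star edges. So only the ends of a
  chain of exchanges are required to be reduced.

  Closure of \<open>\<D>\<close> under symmetric difference is what turns the augmentation axiom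
  into a count: if all fundamental cycles over a tree are balanced, they can be added up, and every
  cycle they generate is balanced as well.\<close>

locale matroid =
  fixes E :: "'a set" and indep :: "'a set \<Rightarrow> bool"
  assumes finite_carrier: "finite E"
    and indep_subset_carrier: "indep X \<Longrightarrow> X \<subseteq> E"
    and indep_subset: "indep X \<Longrightarrow> Y \<subseteq> X \<Longrightarrow> indep Y"
    and augment: "indep X \<Longrightarrow> indep Y \<Longrightarrow> card X < card Y \<Longrightarrow> \<exists>y\<in>Y - X. indep (insert y X)"
begin

definition basis :: "'a set \<Rightarrow> bool" where
  "basis B \<longleftrightarrow> indep B \<and> (\<forall>A. indep A \<longrightarrow> B \<subseteq> A \<longrightarrow> A = B)"

lemma indep_finite: "indep X \<Longrightarrow> finite X"
  using finite_carrier indep_subset_carrier finite_subset by blast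

lemma basis_indep: "basis B \<Longrightarrow> indep B" and basis_finite: "basis B \<Longrightarrow> finite B"
  using indep_finite unfolding basis_def by auto

lemma indep_card_le: assumes "basis B" "indep X" shows "card X \<le> card B"
proof (rule ccontr)
  assume "\<not> card X \<le> card B"
  then obtain y where "y \<in> X - B" "indep (insert y B)"
    using augment[OF basis_indep[OF assms(1)] assms(2)] by auto
  then show False using assms(1) unfolding basis_def by blast
qed

lemma basisI: assumes "basis B" "indep X" "card B \<le> card X" shows "basis X"
  unfolding basis_def
proof (intro conjI allI impI)
  fix A assume A: "indep A" "X \<subseteq> A"
  then have "card A \<le> card X" using indep_card_le[OF assms(1)] assms(3) le_trans by blast
  then show "A = X" using A indep_finite[OF A(1)] by (metis card_seteq)
qed (rule assms(2))

lemma extend: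
  assumes "indep X" "indep Y" "card X \<le> card Y"
  shows "\<exists>Z. X \<subseteq> Z \<and> Z \<subseteq> X \<union> Y \<and> indep Z \<and> card Z = card Y"
  using assms
proof (induction "card Y - card X" arbitrary: X)
  case 0
  then show ?case by auto
next
  case (Suc n)
  have "card X < card Y" using Suc(2) by linarith
  then obtain y where y: "y \<in> Y - X" "indep (insert y X)" using augment[OF Suc(3,4)] by auto
  have "card (insert y X) = Suc (card X)" using y indep_finite[OF Suc(3)] by auto
  then have n: "n = card Y - card (insert y X)" "card (insert y X) \<le> card Y"
    using Suc(2) \<open>card X < card Y\<close> by linarith+
  have "\<exists>Z. insert y X \<subseteq> Z \<and> Z \<subseteq> insert y X \<union> Y \<and> indep Z \<and> card Z = card Y"
    by (rule Suc(1)[OF n(1) y(2) Suc(4) n(2)])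
  then show ?case using y by blast
qed

text \<open>\<open>insert a Y\<close> is the fundamental circuit of \<open>a\<close> over
  \<open>B2\<close>. If no member of \<open>Y\<close> could replace \<open>a\<close> in
  \<open>B1\<close>, all of \<open>Y\<close> would lie in the span of \<open>B1 - {a}\<close>, and
  \<open>a\<close> with it.\<close>

lemma symmetric_exchange:
  assumes B1: "basis B1" and B2: "basis B2" and a: "a \<in> B1" "a \<notin> B2"
  obtains f where "f \<in> B2" "f \<notin> B1" "basis (insert f (B1 - {a}))" "basis (insert a (B2 - {f}))"
proof -
  define Y where "Y = {f \<in> B2. indep (insert a (B2 - {f}))}"
  let ?X = "B1 - {a}"
  have fin: "finite B1" "finite B2" using B1 B2 basis_finite by auto
  have card1: "card ?X < card B1" using a fin by (meson card_Diff1_less)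
  have Y2: "Y \<subseteq> B2" by (auto simp: Y_def)
  have indY: "indep Y" using indep_subset[OF basis_indep[OF B2] Y2] .
  have depY: "\<not> indep (insert a Y)"
  proof
    assume ind: "indep (insert a Y)"
    obtain Z where Z: "insert a Y \<subseteq> Z" "Z \<subseteq> insert a Y \<union> B2" "indep Z" "card Z = card B2"
      using extend[OF ind basis_indep[OF B2] indep_card_le[OF B2 ind]] by auto
    have "\<not> B2 \<subseteq> Z"
    proof
      assume "B2 \<subseteq> Z"
      then have "card (insert a B2) \<le> card Z"
        using Z by (intro card_mono) (auto intro: indep_finite)
      then show False using Z(4) a fin by simp
    qed
    then obtain f where f: "f \<in> B2" "f \<notin> Z" by auto
    have "insert a (B2 - {f}) = Z"
    proof (rule card_subset_eq[symmetric])
      show "finite (insert a (B2 - {f}))" using fin by simp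
      show "Z \<subseteq> insert a (B2 - {f})" using Z(2) f Y2 by auto
      have "card B2 > 0" using f fin card_gt_0_iff by blast
      then show "card Z = card (insert a (B2 - {f}))" using Z(4) a f fin by simp
    qed
    then have "f \<in> Y" using f Z by (auto simp: Y_def)
    then show False using f Z by auto
  qed
  have "\<exists>f\<in>Y. f \<notin> ?X \<and> indep (insert f ?X)"
  proof (rule ccontr)
    assume none: "\<not> ?thesis"
    have Xi: "indep ?X" using indep_subset[OF basis_indep[OF B1]] by auto
    have small: "card Y \<le> card ?X"
    proof (rule ccontr)
      assume "\<not> ?thesis"
      then obtain y where "y \<in> Y - ?X" "indep (insert y ?X)" using augment[OF Xi indY] by auto
      then show False using none by auto
    qed
    \<comment> \<open>\<open>Z\<close> replaces \<open>?X\<close> by an independent set of the same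
      size and span that contains \<open>Y\<close>. Some \<open>y\<close> of \<open>B1\<close>
      extends it: \<open>y = a\<close> would make \<open>insert a Y\<close> independent, any other
      \<open>y\<close> gives an independent subset of \<open>?X \<union> Y\<close> larger than
      \<open>?X\<close>.\<close>
    obtain Z where Z: "Y \<subseteq> Z" "Z \<subseteq> Y \<union> ?X" "indep Z" "card Z = card ?X"
      using extend[OF indY Xi small] by auto
    obtain y where y: "y \<in> B1 - Z" "indep (insert y Z)"
      using augment[OF Z(3) basis_indep[OF B1]] Z(4) card1 by auto
    show False
    proof (cases "y = a")
      case True
      then have "indep (insert a Y)" using indep_subset[OF y(2)] Z(1) by blast
      then show False using depY by simp
    next
      case False
      then have "insert y Z \<subseteq> ?X \<union> Y" using y Z by auto
      moreover have "card ?X < card (insert y Z)" using Z y indep_finite by auto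
      ultimately obtain w where "w \<in> insert y Z - ?X" "indep (insert w ?X)"
        using augment[OF Xi y(2)] by auto
      then show False using none \<open>insert y Z \<subseteq> ?X \<union> Y\<close> by auto
    qed
  qed
  then obtain f where f: "f \<in> Y" "f \<notin> ?X" "indep (insert f ?X)" by auto
  have fa: "f \<noteq> a" using f Y2 a by auto
  have "card (insert f ?X) = card B1" "card (insert a (B2 - {f})) = card B2"
    using f fa a fin Y2 card_Suc_Diff1[of B1 a] card_Suc_Diff1[of B2 f] by auto
  then have "basis (insert f ?X)" "basis (insert a (B2 - {f}))"
    using f basisI[OF B1 f(3)] basisI[OF B2] by (auto simp: Y_def)
  then show thesis using that[of f] f fa Y2 by auto
qed

text \<open>The two bases involved are tracked as an ordered pair, apart from the sequence they
  belong to; \<open>exchange_step_lift\<close> puts them back.\<close>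

definition exchange_step :: "'a set \<times> 'a set \<Rightarrow> 'a set \<times> 'a set \<Rightarrow> bool" where
  "exchange_step p q \<longleftrightarrow> (\<exists>e\<in>fst p. \<exists>f\<in>snd p. q = (insert f (fst p - {e}), insert e (snd p - {f})) \<and>
     basis (fst q) \<and> basis (snd q))"

lemma exchange_stepI:
  assumes "e \<in> X" "f \<in> Y" "X' = insert f (X - {e})" "Y' = insert e (Y - {f})" "basis X'" "basis Y'"
  shows "exchange_step (X, Y) (X', Y')"
  unfolding exchange_step_def using assms by auto

end

text \<open>The condition says that the complement of \<open>D\<close> is a flat.\<close>

locale matroid_star = matroid E indep for E :: "'a set" and indep +
  fixes D :: "'a set"
  assumes star_extend: "indep X \<Longrightarrow> X \<inter> D = {} \<Longrightarrow> x \<in> D \<Longrightarrow> indep (insert x X)"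
begin

lemma basis_meets_star: assumes "basis B" "D \<noteq> {}" shows "B \<inter> D \<noteq> {}"
proof
  assume n: "B \<inter> D = {}"
  obtain x where x: "x \<in> D" using assms(2) by auto
  then have "insert x B = B"
    using assms(1) star_extend[OF basis_indep[OF assms(1)] n x] unfolding basis_def by blast
  then show False using n x by auto
qed

text \<open>For \<open>F\<close> two short of a basis and disjoint from \<open>D\<close>, this says
  that \<open>x\<close> and \<open>y\<close> lie in different parallel classes after contracting
  \<open>F\<close>.\<close>

definition sep :: "'a set \<Rightarrow> 'a \<Rightarrow> 'a \<Rightarrow> bool" where
  "sep F x y \<longleftrightarrow> basis (insert x (insert y F))"

lemma sep_commute: "sep F x y = sep F y x"
  by (simp add: sep_def insert_commute)

text \<open>Transitivity of being parallel, in contrapositive form. Contracting \<open>F\<close>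
  leaves no loop in \<open>D\<close>, so \<open>insert y F\<close> is independent and can be
  augmented from the basis containing \<open>x\<close> and \<open>z\<close>.\<close>

lemma sep_cotrans:
  assumes F: "F \<inter> D = {}" and D: "x \<in> D" "y \<in> D" "z \<in> D" and xz: "x \<noteq> z" and s: "sep F x z"
  shows "sep F x y \<or> sep F y z"
proof (cases "y = x \<or> y = z")
  case True
  then show ?thesis using s by auto
next
  case False
  have bas: "basis (insert x (insert z F))" using s by (simp add: sep_def)
  have indF: "indep F" using indep_subset[OF basis_indep[OF bas]] by auto
  have fin: "finite F" by (rule indep_finite[OF indF])
  have out: "x \<notin> F" "y \<notin> F" "z \<notin> F" using F D by auto
  have ind: "indep (insert y F)" using star_extend[OF indF F D(2)] .
  have "card (insert y F) < card (insert x (insert z F))" using fin out xz by simp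
  then obtain w where w: "w \<in> insert x (insert z F) - insert y F" "indep (insert w (insert y F))"
    using augment[OF ind basis_indep[OF bas]] by auto
  have "card (insert x (insert z F)) \<le> card (insert w (insert y F))" using fin out xz w by auto
  then have "sep F w y" unfolding sep_def by (rule basisI[OF bas w(2)])
  then show ?thesis using w sep_commute by auto
qed

text \<open>By \<open>sep_cotrans\<close>, \<open>F\<close> separates each of \<open>c\<close>,
  \<open>d\<close> from \<open>a\<close> or \<open>b\<close>, and \<open>H\<close> separates each of
  \<open>a\<close>, \<open>b\<close> from \<open>c\<close> or \<open>d\<close>. With the four single
  exchanges excluded, only the two mirror-image patterns in \<open>F4\<close> remain. In both, each
  pair is also split by the set belonging to the other one.\<close>

lemma stuck_pairing:
  assumes F: "F \<inter> D = {}" "H \<inter> D = {}" and D: "{a, b, c, d} \<subseteq> D" and ne: "a \<noteq> b" "c \<noteq> d"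
    and s: "sep F a b" "sep H c d"
    and stuck: "\<not> (sep F b c \<and> sep H d a)" "\<not> (sep F b d \<and> sep H c a)"
      "\<not> (sep F a c \<and> sep H d b)" "\<not> (sep F a d \<and> sep H c b)"
  shows "sep F c d" "sep H a b" "sep F a c \<noteq> sep H a c"
proof -
  have t: "sep F a c \<or> sep F c b" "sep F a d \<or> sep F d b" "sep H c a \<or> sep H a d" "sep H c b \<or> sep H b d"
    using sep_cotrans[OF F(1)] sep_cotrans[OF F(2)] s D ne by auto
  have F4: "(sep F a c \<and> sep F b d \<and> \<not> sep F a d \<and> \<not> sep F b c \<and> sep H b c \<and> sep H a d \<and> \<not> sep H a c \<and> \<not> sep H b d)
    \<or> (\<not> sep F a c \<and> \<not> sep F b d \<and> sep F a d \<and> sep F b c \<and> \<not> sep H b c \<and> \<not> sep H a d \<and> sep H a c \<and> sep H b d)"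
    using t stuck sep_commute[of F] sep_commute[of H] by metis
  then show "sep F a c \<noteq> sep H a c" by blast
  \<comment> \<open>\<open>sep_cotrans\<close> needs distinct outer points; a coincidence across the
    two pairs would contradict \<open>F4\<close> together with \<open>s\<close>.\<close>
  have nad: "a \<noteq> d \<or> \<not> sep F a d" "a \<noteq> c \<or> \<not> sep F a c" "b \<noteq> c \<or> \<not> sep H b c" "b \<noteq> d \<or> \<not> sep H b d"
    using s ne F4 by (metis sep_commute)+
  from F4 show "sep F c d"
    using sep_cotrans[OF F(1), of a c d] sep_cotrans[OF F(1), of a d c] D nad sep_commute by auto
  from F4 show "sep H a b"
    using sep_cotrans[OF F(2), of b a c] sep_cotrans[OF F(2), of b a d] D nad sep_commute[of H] by auto
qed

text \<open>Trading \<open>a\<close> for \<open>c\<close> or \<open>d\<close> is blocked, so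
  \<open>a\<close> leaves in exchange for some \<open>e\<close> in \<open>H\<close>. While
  \<open>e\<close> is parked in the first basis, \<open>insert e F\<close> is only one short of a
  basis and any of the four star edges completes it. This freedom lets \<open>b\<close> trade places
  with \<open>c\<close> or \<open>d\<close>; the third exchange returns \<open>e\<close>.\<close>

lemma swap_pairs:
  assumes F: "F \<inter> D = {}" "H \<inter> D = {}" "F \<inter> H = {}"
    and D: "{a, b, c, d} \<subseteq> D" and dist: "distinct [a, b, c, d]"
    and s: "sep F a b" "sep H c d" "sep F c d" "sep H a b"
    and stuck: "\<not> (sep F b c \<and> sep H d a)" "\<not> (sep F b d \<and> sep H c a)"
  shows "exchange_step\<^sup>*\<^sup>* (insert a (insert b F), insert c (insert d H)) (insert c (insert d F), insert a (insert b H))"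
proof -
  let ?B1 = "insert a (insert b F)" and ?B2 = "insert c (insert d H)"
  have bas: "basis ?B1" "basis ?B2" "basis (insert c (insert d F))" "basis (insert a (insert b H))"
    using s by (simp_all add: sep_def)
  have out: "x \<notin> F" "x \<notin> H" if "x \<in> {a, b, c, d}" for x using that D F by auto
  obtain e where e: "e \<in> ?B2" "e \<notin> ?B1" "basis (insert e (?B1 - {a}))" "basis (insert a (?B2 - {e}))"
    using symmetric_exchange[OF bas(1,2), of a] dist out by auto
  have rem: "?B1 - {a} = insert b F" "?B2 - {c} = insert d H" "?B2 - {d} = insert c H"
    using dist out by auto
  have "e \<noteq> c"
  proof
    assume "e = c"
    then have "sep F c b" "sep H a d" using e rem by (simp_all add: sep_def)
    then show False using stuck(1) by (simp add: sep_commute)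
  qed
  moreover have "e \<noteq> d"
  proof
    assume "e = d"
    then have "sep F d b" "sep H a c" using e rem by (simp_all add: sep_def)
    then show False using stuck(2) by (simp add: sep_commute)
  qed
  ultimately have ecd: "e \<noteq> c" "e \<noteq> d" by auto
  have eH: "e \<in> H" using e ecd by auto
  have eF: "e \<notin> F" "e \<notin> D" using eH F by auto
  let ?S = "insert e F" and ?R = "H - {e}"
  have st1: "?B1 - {a} = insert b F" "?B2 - {e} = insert c (insert d ?R)"
    using dist out ecd by auto
  have B1': "basis (insert b ?S)" using e(3) st1 by (simp add: insert_commute)
  have B2': "basis (insert a (insert c (insert d ?R)))" using e(4) st1 by simp
  have fin: "finite F" "finite H" using basis_finite[OF bas(1)] basis_finite[OF bas(2)] by auto
  have step1: "exchange_step (?B1, ?B2) (insert b ?S, insert a (insert c (insert d ?R)))"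
    by (rule exchange_stepI[of a _ e]) (use e st1 B1' B2' in \<open>simp_all add: insert_commute[of e b]\<close>)
  have S: "basis (insert x ?S)" if x: "x \<in> {a, b, c, d}" for x
  proof (rule basisI[OF B1'])
    show "indep (insert x ?S)"
      using star_extend[of ?S x] indep_subset[OF basis_indep[OF B1']] x D F eF by auto
    have "e \<notin> {a, b, c, d}" using eF D by auto
    then have "card (insert x ?S) = Suc (Suc (card F))" "card (insert b ?S) = Suc (Suc (card F))"
      using out[OF x] out[of b] x fin eF(1) by auto
    then show "card (insert b ?S) \<le> card (insert x ?S)" by simp
  qed
  have Rab: "indep (insert a (insert b ?R))"
    by (rule indep_subset[OF basis_indep[OF bas(4)]]) auto
  have outR: "x \<notin> ?R" if "x \<in> {a, b, c, d}" for x using out[OF that] by auto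
  have finR: "finite ?R" using fin by auto
  have "card (insert a (insert b ?R)) < card (insert a (insert c (insert d ?R)))"
    using outR finR dist by simp
  then obtain w where w: "w \<in> {c, d}" "indep (insert w (insert a (insert b ?R)))"
    using augment[OF Rab basis_indep[OF B2']] by auto
  obtain w' where w': "w = c \<and> w' = d \<or> w = d \<and> w' = c" using w(1) by auto
  have ww: "w \<in> {a, b, c, d}" "w' \<in> {a, b, c, d}" "w \<notin> {a, b}" "w' \<notin> {a, b}" "w \<noteq> w'"
    using w' dist by auto
  have "card (insert a (insert c (insert d ?R))) = Suc (Suc (Suc (card ?R)))"
    using outR finR dist by simp
  moreover have "card (insert w (insert a (insert b ?R))) = Suc (Suc (Suc (card ?R)))"
    using outR[OF ww(1)] outR[of a] outR[of b] ww(3) finR dist by simp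
  ultimately have R2: "basis (insert w (insert a (insert b ?R)))"
    by (intro basisI[OF B2' w(2)]) simp
  have cdR: "insert c (insert d X) = insert w (insert w' X)" for X
    using w' by (elim disjE) (simp_all add: insert_commute[of c d])
  have step2: "exchange_step (insert b ?S, insert a (insert c (insert d ?R)))
      (insert w' ?S, insert w (insert a (insert b ?R)))"
  proof -
    have "insert b ?S - {b} = ?S" using out[of b] eF D by auto
    moreover have "insert a (insert c (insert d ?R)) - {w'} = insert a (insert w ?R)"
      unfolding cdR using ww outR[OF ww(2)] by auto
    ultimately show ?thesis
      by (intro exchange_stepI[of b _ w']) (use S[of w'] ww R2 cdR in \<open>simp_all add: insert_commute\<close>)
  qed
  have step3: "exchange_step (insert w' ?S, insert w (insert a (insert b ?R)))
      (insert c (insert d F), insert a (insert b H))"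
  proof -
    have "insert w (insert w' ?S - {e}) = insert c (insert d F)"
      unfolding cdR using eF ww D by auto
    moreover have "insert e (insert w (insert a (insert b ?R)) - {w}) = insert a (insert b H)"
      using eH outR[OF ww(1)] ww by auto
    ultimately show ?thesis by (intro exchange_stepI[of e _ w]) (use bas in simp_all)
  qed
  show ?thesis using step1 step2 step3 by (meson converse_rtranclp_into_rtranclp r_into_rtranclp)
qed

end

section \<open>The frame matroid of a linear biased graph\<close>

definition span_verts :: "('v, 'e) mgraph \<Rightarrow> 'e set \<Rightarrow> 'v set" where
  "span_verts G A = (\<Union>e\<in>A. ends G e)"

text \<open>Reflexive on all vertices, including those that \<open>A\<close> does not touch; these
  form singleton components.\<close>

definition conn :: "('v, 'e) mgraph \<Rightarrow> 'e set \<Rightarrow> ('v \<times> 'v) set" where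
  "conn G A = (adj (edge_subgraph G A))\<^sup>*"

text \<open>Loops are left out: they add 2 to the degree and do not affect its parity.\<close>

definition links_at :: "('v, 'e) mgraph \<Rightarrow> 'e set \<Rightarrow> 'v \<Rightarrow> 'e set" where
  "links_at G A x = {e \<in> A. x \<in> ends G e \<and> ends G e \<noteq> {x}}"

text \<open>The members of the cycle space of the graph over the two-element field.\<close>

definition even_set :: "('v, 'e) mgraph \<Rightarrow> 'e set \<Rightarrow> bool" where
  "even_set G A \<longleftrightarrow> A \<subseteq> edges G \<and> (\<forall>x. even (card (links_at G A x)))"

definition within :: "('v, 'e) mgraph \<Rightarrow> 'e set \<Rightarrow> 'v set \<Rightarrow> 'e set" where
  "within G A W = {e \<in> A. ends G e \<subseteq> W}"

definition acyclic_set :: "('v, 'e) mgraph \<Rightarrow> 'e set \<Rightarrow> bool" where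
  "acyclic_set G A \<longleftrightarrow> (\<forall>C. C \<subseteq> A \<longrightarrow> \<not> is_cycle G C)"

definition cyclic_at :: "('v, 'e) mgraph \<Rightarrow> 'e set \<Rightarrow> 'v \<Rightarrow> bool" where
  "cyclic_at G A x \<longleftrightarrow> (\<exists>C\<subseteq>A. is_cycle G C \<and> (\<exists>z\<in>span_verts G C. (x, z) \<in> conn G A))"

text \<open>Edge sets of simple paths with a fixed start. Requiring a fresh end vertex at each step
  is what fixes the degrees along the path.\<close>

inductive is_path :: "('v, 'e) mgraph \<Rightarrow> 'v \<Rightarrow> 'e set \<Rightarrow> 'v \<Rightarrow> bool" for G x where
  path_nil: "is_path G x {} x"
| path_snoc: "is_path G x P y \<Longrightarrow> e \<in> edges G \<Longrightarrow> ends G e = {y, z} \<Longrightarrow> z \<notin> insert x (span_verts G P) \<Longrightarrow>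
    is_path G x (insert e P) z"

lemma sdiff_card: assumes "finite A" "finite B" shows "card (sdiff A B) + 2 * card (A \<inter> B) = card A + card B"
proof -
  have "card A = card (A - B) + card (A \<inter> B)" "card B = card (B - A) + card (A \<inter> B)"
    using card_Int_Diff[OF assms(1), of B] card_Int_Diff[OF assms(2), of A] by (simp_all add: Int_commute)
  moreover have "card (sdiff A B) = card (A - B) + card (B - A)"
    unfolding sdiff_def using assms by (intro card_Un_disjoint) auto
  ultimately show ?thesis by simp
qed

lemma finite_within: "finite A \<Longrightarrow> finite (within G A W)"
  by (simp add: within_def)

lemma rtrancl_crossing:
  assumes "(x, z) \<in> r\<^sup>*" "x \<in> S" "z \<notin> S"
  obtains p q where "(p, q) \<in> r" "p \<in> S" "q \<notin> S"
  using assms by (induction rule: rtrancl_induct) auto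

section \<open>Connectivity within an edge set\<close>

lemma adj_edge_subgraph: "(x, y) \<in> adj (edge_subgraph G A) \<longleftrightarrow> (\<exists>e\<in>A. ends G e = {x, y})"
  by (simp add: adj_def edge_subgraph_def)

lemma conn_refl [simp]: "(x, x) \<in> conn G A"
  by (simp add: conn_def)

lemma conn_sym: "(x, y) \<in> conn G A \<Longrightarrow> (y, x) \<in> conn G A"
  unfolding conn_def
proof (rule symD[OF sym_rtrancl])
  show "sym (adj (edge_subgraph G A))"
    by (rule symI) (auto simp: adj_edge_subgraph insert_commute)
qed

lemma conn_trans: "(x, y) \<in> conn G A \<Longrightarrow> (y, z) \<in> conn G A \<Longrightarrow> (x, z) \<in> conn G A"
  unfolding conn_def by (rule rtrancl_trans)

lemma conn_mono: assumes "A \<subseteq> B" shows "conn G A \<subseteq> conn G B"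
  unfolding conn_def
proof (rule rtrancl_mono, rule subrelI)
  show "(x, y) \<in> adj (edge_subgraph G B)" if "(x, y) \<in> adj (edge_subgraph G A)" for x y
    using that assms unfolding adj_edge_subgraph by blast
qed

lemma conn_edge: "e \<in> A \<Longrightarrow> ends G e = {x, y} \<Longrightarrow> (x, y) \<in> conn G A"
  unfolding conn_def by (rule r_into_rtrancl) (auto simp: adj_edge_subgraph)

text \<open>A walk can be shortened to use \<open>e\<close> at most once, in one of two
  directions.\<close>

lemma conn_insert:
  assumes e: "ends G e = {x, y}" and pq: "(p, q) \<in> conn G (insert e A)"
  shows "(p, q) \<in> conn G A \<or> (p, x) \<in> conn G A \<and> (y, q) \<in> conn G A \<or> (p, y) \<in> conn G A \<and> (x, q) \<in> conn G A"
  using pq unfolding conn_def[of G "insert e A"]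
proof (induction rule: rtrancl_induct)
  case base
  then show ?case by simp
next
  case (step q r)
  from step(2) have "(q, r) \<in> conn G A \<or> {q, r} = {x, y}"
    using e conn_edge[of _ A G q r] unfolding adj_edge_subgraph by auto
  then show ?case
  proof
    assume "(q, r) \<in> conn G A"
    then show ?thesis using step(3) by (meson conn_trans)
  next
    assume "{q, r} = {x, y}"
    then have "q = x \<and> r = y \<or> q = y \<and> r = x" by (auto simp: doubleton_eq_iff)
    then show ?thesis using step(3) conn_refl by (metis conn_sym)
  qed
qed

lemma conn_insert_connected:
  assumes e: "ends G e = {x, y}" and xy: "(x, y) \<in> conn G A"
  shows "conn G (insert e A) = conn G A"
proof
  show "conn G A \<subseteq> conn G (insert e A)" by (rule conn_mono) auto
  show "conn G (insert e A) \<subseteq> conn G A"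
  proof (rule subrelI)
    fix p q assume "(p, q) \<in> conn G (insert e A)"
    from conn_insert[OF e this] show "(p, q) \<in> conn G A"
      using xy conn_sym[OF xy] by (meson conn_trans)
  qed
qed

section \<open>Cycles and even edge sets\<close>

lemma cycleD:
  assumes "is_cycle G C"
  shows "C \<subseteq> edges G" "finite C" "C \<noteq> {}" "\<And>x y. x \<in> span_verts G C \<Longrightarrow> y \<in> span_verts G C \<Longrightarrow> (x, y) \<in> conn G C"
    "\<And>x. x \<in> span_verts G C \<Longrightarrow> card {e \<in> C. x \<in> ends G e} + card {e \<in> C. ends G e = {x}} = 2"
    "span_verts G C \<noteq> {}"
  using assms
  by (auto simp: is_cycle_def cycle_graph_def edge_subgraph_def connected_graph_def span_verts_def
      conn_def degree_def incident_edges_def)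

lemma cycleI:
  assumes "C \<subseteq> edges G" "finite C" "C \<noteq> {}" "span_verts G C \<noteq> {}"
    "\<And>z. z \<in> span_verts G C \<Longrightarrow> (x, z) \<in> conn G C"
    "\<And>x. x \<in> span_verts G C \<Longrightarrow> card {e \<in> C. x \<in> ends G e} + card {e \<in> C. ends G e = {x}} = 2"
  shows "is_cycle G C"
proof -
  have "(y, z) \<in> conn G C" if "y \<in> span_verts G C" "z \<in> span_verts G C" for y z
    using assms(5)[OF that(1)] assms(5)[OF that(2)] by (meson conn_sym conn_trans)
  then show ?thesis using assms(1-4,6)
    by (simp add: is_cycle_def cycle_graph_def edge_subgraph_def connected_graph_def span_verts_def
        conn_def degree_def incident_edges_def)
qed

lemma card_incident:
  assumes "finite A"
  shows "card {e \<in> A. x \<in> ends G e} = card (links_at G A x) + card {e \<in> A. ends G e = {x}}"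
proof -
  have "{e \<in> A. x \<in> ends G e} = links_at G A x \<union> {e \<in> A. ends G e = {x}}" by (auto simp: links_at_def)
  then show ?thesis using assms
    by (simp add: card_Un_disjoint links_at_def disjoint_iff)
qed

lemma cycle_even: assumes "is_cycle G C" shows "even_set G C"
  unfolding even_set_def
proof (intro conjI allI)
  note c = cycleD[OF assms]
  show "C \<subseteq> edges G" by (rule c(1))
  fix x
  show "even (card (links_at G C x))"
  proof (cases "x \<in> span_verts G C")
    case True
    have "card (links_at G C x) + 2 * card {e \<in> C. ends G e = {x}} = 2"
      using c(5)[OF True] card_incident[OF c(2), of x G] by simp
    then show ?thesis by presburger
  next
    case False
    then have "links_at G C x = {}" by (auto simp: links_at_def span_verts_def)
    then show ?thesis by simp
  qed
qed

lemma even_sdiff: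
  assumes "finite (edges G)" "even_set G A" "even_set G B" shows "even_set G (sdiff A B)"
  unfolding even_set_def
proof (intro conjI allI)
  show "sdiff A B \<subseteq> edges G" using assms by (auto simp: even_set_def sdiff_def)
  fix x
  have "finite A" "finite B" using assms finite_subset by (auto simp: even_set_def)
  then have fin: "finite (links_at G A x)" "finite (links_at G B x)" by (auto simp: links_at_def)
  have "links_at G (sdiff A B) x = sdiff (links_at G A x) (links_at G B x)"
    by (auto simp: links_at_def sdiff_def)
  moreover have "even (card (links_at G A x))" "even (card (links_at G B x))"
    using assms by (auto simp: even_set_def)
  ultimately show "even (card (links_at G (sdiff A B) x))"
    using sdiff_card[OF fin] by presburger
qed

text \<open>Handshake argument: otherwise the component of \<open>x\<close> in \<open>A - {e}\<close> would be left by the single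
  edge \<open>e\<close> of \<open>A\<close>, so its sum of degrees would be odd.\<close>

lemma even_set_conn:
  assumes mg: "multigraph G" and ev: "even_set G A" and e: "e \<in> A" "ends G e = {x, y}" "x \<noteq> y"
  shows "(x, y) \<in> conn G (A - {e})"
proof (rule ccontr)
  assume n: "(x, y) \<notin> conn G (A - {e})"
  have fin: "finite (verts G)" "finite A"
    using mg ev finite_subset by (auto simp: multigraph_def even_set_def)
  define K where "K = {z \<in> verts G. (x, z) \<in> conn G (A - {e})}"
  have finK: "finite K" using fin by (simp add: K_def)
  have endsV: "ends G f \<subseteq> verts G" if "f \<in> A" for f
    using mg ev that by (auto simp: multigraph_def even_set_def)
  have xK: "x \<in> K" and yK: "y \<notin> K" using n endsV[OF e(1)] e by (auto simp: K_def)
  \<comment> \<open>The number of ends of \<open>f\<close> in \<open>K\<close>, a loop counting 0.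
    It is even for every edge other than \<open>e\<close>, since such an edge does not leave
    \<open>K\<close>.\<close>
  define c where "c = (\<lambda>f. card {z \<in> K. z \<in> ends G f \<and> ends G f \<noteq> {z}})"
  have "(\<Sum>z\<in>K. card (links_at G A z)) = (\<Sum>z\<in>K. card {f \<in> A. z \<in> ends G f \<and> ends G f \<noteq> {z}})"
    by (simp add: links_at_def)
  also have "\<dots> = (\<Sum>f\<in>A. c f)"
    by (rule sum_multicount_gen) (use finK fin in \<open>simp_all add: c_def\<close>)
  finally have sum: "(\<Sum>z\<in>K. card (links_at G A z)) = (\<Sum>f\<in>A. c f)" .
  have even_c: "even (c f)" if f: "f \<in> A - {e}" for f
  proof -
    have "card (ends G f) \<in> {1, 2}" using mg ev f by (auto simp: multigraph_def even_set_def)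
    then consider p where "ends G f = {p}" | p q where "ends G f = {p, q}" "p \<noteq> q"
      by (auto simp: card_1_singleton_iff card_2_iff)
    then show ?thesis
    proof cases
      case 1
      then have "{z \<in> K. z \<in> ends G f \<and> ends G f \<noteq> {z}} = {}" by auto
      then have "c f = 0" unfolding c_def by (simp only: card.empty)
      then show ?thesis by simp
    next
      case 2
      have pq: "(p, q) \<in> conn G (A - {e})" "(q, p) \<in> conn G (A - {e})"
        using conn_edge[OF f 2(1)] conn_sym by auto
      have "p \<in> K \<longleftrightarrow> q \<in> K"
        using endsV[of f] f 2 conn_trans[OF _ pq(1)] conn_trans[OF _ pq(2)] by (auto simp: K_def)
      then have "{z \<in> K. z \<in> ends G f \<and> ends G f \<noteq> {z}} = (if p \<in> K then {p, q} else {})" using 2 by auto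
      then have "c f = card (if p \<in> K then {p, q} else {})" by (simp only: c_def)
      then show ?thesis using 2 by simp
    qed
  qed
  have "{z \<in> K. z \<in> ends G e \<and> ends G e \<noteq> {z}} = {x}" using xK yK e by auto
  then have "c e = 1" unfolding c_def by (simp only: card_1_singleton_iff) simp
  moreover have "(\<Sum>f\<in>A. c f) = c e + (\<Sum>f\<in>A - {e}. c f)" using fin e by (simp add: sum.remove)
  moreover have "even (\<Sum>f\<in>A - {e}. c f)" using even_c by (rule dvd_sum)
  moreover have "even (\<Sum>z\<in>K. card (links_at G A z))" using ev by (intro dvd_sum) (simp add: even_set_def)
  ultimately show False using sum by simp
qed

section \<open>Paths and the cycles they close\<close>

lemma span_verts_insert: "span_verts G (insert e P) = ends G e \<union> span_verts G P"
  by (simp add: span_verts_def)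

lemma is_path_basic:
  assumes "is_path G x P y"
  shows "finite P \<and> P \<subseteq> edges G \<and> y \<in> insert x (span_verts G P) \<and> (x = y \<longleftrightarrow> P = {}) \<and>
    (\<forall>z\<in>span_verts G P. (x, z) \<in> conn G P) \<and> (\<forall>z. {e \<in> P. ends G e = {z}} = {}) \<and>
    (P \<noteq> {} \<longrightarrow> x \<in> span_verts G P)"
  using assms
proof induction
  case path_nil
  then show ?case by (simp add: span_verts_def)
next
  case (path_snoc P y e z)
  have "(x, y) \<in> conn G P" using path_snoc by auto
  then have "(x, y) \<in> conn G (insert e P)" using conn_mono[of P "insert e P"] by blast
  moreover from this have "(x, z) \<in> conn G (insert e P)"
    using conn_edge[of e "insert e P" G y z] path_snoc by (auto intro: conn_trans)
  moreover have "(x, w) \<in> conn G (insert e P)" if "w \<in> span_verts G P" for w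
    using path_snoc that conn_mono[of P "insert e P"] by blast
  moreover have "y \<noteq> z" using path_snoc by auto
  ultimately show ?case using path_snoc
    by (auto simp: span_verts_insert doubleton_eq_iff)
qed

lemma is_path_degree:
  assumes "is_path G x P y" and "z \<in> insert x (span_verts G P)"
  shows "card (links_at G P z) = (if x = y then 0 else if z = x \<or> z = y then 1 else 2)"
  using assms
proof (induction arbitrary: z)
  case path_nil
  then show ?case by (simp add: links_at_def)
next
  case (path_snoc P y e w)
  note b = is_path_basic[OF path_snoc(1)]
  have wy: "w \<noteq> y" "w \<noteq> x" using path_snoc b by auto
  have eP: "e \<notin> P" using path_snoc(3,4) by (auto simp: span_verts_def)
  have fin: "finite (links_at G P z)" "e \<notin> links_at G P z" using b eP by (auto simp: links_at_def)
  have L: "links_at G (insert e P) z = (if z \<in> {y, w} then insert e (links_at G P z) else links_at G P z)"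
    using path_snoc(3) wy by (auto simp: links_at_def doubleton_eq_iff)
  show ?case
  proof (cases "z = w")
    case True
    then have "links_at G P z = {}" using path_snoc(4) by (auto simp: links_at_def span_verts_def)
    then show ?thesis using L True wy by simp
  next
    case False
    then have z: "z \<in> insert x (span_verts G P)"
      using path_snoc(3,6) b by (auto simp: span_verts_insert)
    show ?thesis
    proof (cases "x = y")
      case True
      then have "P = {}" using b by blast
      then have "z = x" using z by (simp add: span_verts_def)
      then show ?thesis using path_snoc(5)[OF z] L fin wy False True by simp
    next
      case xy: False
      have "card (links_at G (insert e P) z) = (if z = y then 1 else 0) + card (links_at G P z)"
        unfolding L using fin False by (cases "z = y") auto
      then show ?thesis using path_snoc(5)[OF z] wy False xy by simp
    qed
  qed
qed

text \<open>An initial segment of the path. \<open>conn_is_path\<close> falls back on it whenever a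
  walk returns to a vertex already visited.\<close>

lemma is_subpath:
  assumes "is_path G x P y" and "z \<in> insert x (span_verts G P)"
  shows "\<exists>Q\<subseteq>P. is_path G x Q z"
  using assms
proof (induction arbitrary: z)
  case path_nil
  then show ?case by (auto simp: span_verts_def intro: is_path.path_nil)
next
  case (path_snoc P y e w)
  show ?case
  proof (cases "z = w")
    case True
    then show ?thesis
      using is_path.path_snoc[OF path_snoc(1-4)] by (intro exI[of _ "insert e P"]) auto
  next
    case False
    then have "z \<in> insert x (span_verts G P)"
      using path_snoc(3,6) is_path_basic[OF path_snoc(1)] by (auto simp: span_verts_insert)
    then obtain Q where "Q \<subseteq> P" "is_path G x Q z" using path_snoc(5) by auto
    then show ?thesis by (intro exI[of _ Q]) auto
  qed
qed

lemma conn_is_path: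
  assumes "A \<subseteq> edges G" "(x, y) \<in> conn G A"
  shows "\<exists>P\<subseteq>A. is_path G x P y"
  using assms(2) unfolding conn_def
proof (induction rule: rtrancl_induct)
  case base
  then show ?case by (intro exI[of _ "{}"]) (simp add: is_path.path_nil)
next
  case (step y z)
  obtain P where P: "P \<subseteq> A" "is_path G x P y" using step by auto
  obtain e where e: "e \<in> A" "ends G e = {y, z}" using step(2) by (auto simp: adj_edge_subgraph)
  show ?case
  proof (cases "z \<in> insert x (span_verts G P)")
    case True
    then obtain Q where "Q \<subseteq> P" "is_path G x Q z" using is_subpath[OF P(2)] by auto
    then show ?thesis using P(1) by (intro exI[of _ Q]) auto
  next
    case False
    then have "is_path G x (insert e P) z"
      using is_path.path_snoc[OF P(2) _ e(2)] e(1) assms(1) by auto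
    then show ?thesis using P e by (intro exI[of _ "insert e P"]) auto
  qed
qed

lemma path_cycle:
  assumes P: "is_path G x P y" "x \<noteq> y" and e: "e \<in> edges G" "e \<notin> P" "ends G e = {x, y}"
  shows "is_cycle G (insert e P)"
proof -
  note b = is_path_basic[OF P(1)]
  have xy: "x \<in> span_verts G P" "y \<in> span_verts G P" using b P by auto
  have sv: "span_verts G (insert e P) = span_verts G P" using xy e by (auto simp: span_verts_insert)
  show ?thesis
  proof (rule cycleI)
    show "insert e P \<subseteq> edges G" "finite (insert e P)" "insert e P \<noteq> {}" using b e by auto
    show "span_verts G (insert e P) \<noteq> {}" using sv xy by auto
    show "(x, z) \<in> conn G (insert e P)" if "z \<in> span_verts G (insert e P)" for z
      using that sv b conn_mono[of P "insert e P"] by blast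
    fix z assume z: "z \<in> span_verts G (insert e P)"
    have fin: "finite (links_at G P z)" "e \<notin> links_at G P z" using b e by (auto simp: links_at_def)
    have "links_at G (insert e P) z = (if z \<in> {x, y} then insert e (links_at G P z) else links_at G P z)"
      using e P by (auto simp: links_at_def doubleton_eq_iff)
    then have "card (links_at G (insert e P) z) = 2"
      using is_path_degree[OF P(1), of z] z sv P fin by auto
    moreover have "{f \<in> insert e P. ends G f = {z}} = {}" using b e P by auto
    ultimately show "card {f \<in> insert e P. z \<in> ends G f} + card {f \<in> insert e P. ends G f = {z}} = 2"
      using card_incident[of "insert e P" z G] b by (simp only: card.empty) simp
  qed
qed

lemma loop_cycle: assumes "e \<in> edges G" "ends G e = {x}" shows "is_cycle G {e}"
proof (rule cycleI)
  show "{e} \<subseteq> edges G" "finite {e}" "{e} \<noteq> {}" "span_verts G {e} \<noteq> {}"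
    using assms by (auto simp: span_verts_def)
  show "(x, z) \<in> conn G {e}" if "z \<in> span_verts G {e}" for z
    using that assms by (simp add: span_verts_def)
  show "card {f \<in> {e}. z \<in> ends G f} + card {f \<in> {e}. ends G f = {z}} = 2" if "z \<in> span_verts G {e}" for z
  proof -
    have "{f \<in> {e}. z \<in> ends G f} = {e}" "{f \<in> {e}. ends G f = {z}} = {e}"
      using that assms by (auto simp: span_verts_def)
    then show ?thesis by simp
  qed
qed

lemma ends_cases:
  assumes "multigraph G" "e \<in> edges G" obtains x y where "ends G e = {x, y}"
proof -
  have "card (ends G e) \<in> {1, 2}" using assms by (auto simp: multigraph_def)
  then show thesis using that by (auto simp: card_1_singleton_iff card_2_iff)
qed

lemma conn_cycle:
  assumes "A \<subseteq> edges G" "e \<in> edges G" "e \<notin> A" "ends G e = {x, y}" "(x, y) \<in> conn G A"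
  shows "\<exists>C\<subseteq>insert e A. e \<in> C \<and> is_cycle G C"
proof (cases "x = y")
  case True
  then show ?thesis using loop_cycle[of e G x] assms by auto
next
  case False
  obtain P where "P \<subseteq> A" "is_path G x P y" using conn_is_path[OF assms(1,5)] by auto
  moreover from this have "is_cycle G (insert e P)"
    using path_cycle[OF _ False assms(2) _ assms(4)] assms(3) by auto
  ultimately show ?thesis by (intro exI[of _ "insert e P"]) auto
qed

text \<open>No edge of an even set is a bridge in it, so every edge closes a cycle with a path in
  the rest.\<close>

lemma even_set_cycle:
  assumes mg: "multigraph G" and "even_set G A" "A \<noteq> {}"
  shows "\<exists>C\<subseteq>A. is_cycle G C"
proof -
  obtain e where e: "e \<in> A" using assms by auto
  have A: "A \<subseteq> edges G" using assms by (simp add: even_set_def)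
  obtain x y where xy: "ends G e = {x, y}" using ends_cases[OF mg, of e] e A by auto
  have "(x, y) \<in> conn G (A - {e})"
    using even_set_conn[OF mg assms(2) e xy] by (cases "x = y") auto
  then have "\<exists>C\<subseteq>insert e (A - {e}). e \<in> C \<and> is_cycle G C"
    using conn_cycle[of "A - {e}" G e x y] A e xy by auto
  then show ?thesis using e by (metis insert_Diff)
qed

lemma cycle_conn_remove:
  assumes mg: "multigraph G" and C: "is_cycle G C" "C \<subseteq> A" "e \<in> C"
  shows "conn G (A - {e}) = conn G A"
proof -
  obtain x y where xy: "ends G e = {x, y}" using ends_cases[OF mg, of e] cycleD(1)[OF C(1)] C by auto
  have "(x, y) \<in> conn G (C - {e})"
    using even_set_conn[OF mg cycle_even[OF C(1)] C(3) xy] by (cases "x = y") auto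
  then have "(x, y) \<in> conn G (A - {e})" using conn_mono[of "C - {e}" "A - {e}"] C by blast
  moreover have "insert e (A - {e}) = A" using C by auto
  ultimately show ?thesis using conn_insert_connected[OF xy, of "A - {e}"] by simp
qed

section \<open>Edge counts of forests and of connected sets\<close>

lemma acyclic_card_less:
  assumes mg: "multigraph G" and A: "A \<subseteq> edges G" "acyclic_set G A"
    and W: "finite W" "W \<noteq> {}" "span_verts G A \<subseteq> W"
  shows "card A < card W"
  using A W
proof (induction "card A" arbitrary: A W rule: less_induct)
  case less
  have finA: "finite A" using less(2) mg finite_subset by (auto simp: multigraph_def)
  show ?case
  proof (cases "A = {}")
    case True
    then show ?thesis using less by (simp add: card_gt_0_iff)
  next
    case False
    then obtain e where e: "e \<in> A" by auto
    obtain x y where xy: "ends G e = {x, y}" using ends_cases[OF mg, of e] e less(2) by auto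
    let ?A = "A - {e}"
    have n: "(x, y) \<notin> conn G ?A"
    proof
      assume "(x, y) \<in> conn G ?A"
      then obtain C where "C \<subseteq> insert e ?A" "is_cycle G C" using conn_cycle[of ?A G e x y] e xy less(2) by auto
      moreover have "insert e ?A = A" using e by auto
      ultimately show False using less(3) unfolding acyclic_set_def by metis
    qed
    \<comment> \<open>Deleting \<open>e\<close> from the forest separates its ends, so
      \<open>W\<close> falls into two nonempty parts that no remaining edge joins. The strict bounds
      for both parts leave room for \<open>e\<close>.\<close>
    define K where "K = {z \<in> W. (x, z) \<in> conn G ?A}"
    have xyW: "x \<in> W" "y \<in> W" using less(6) e xy by (auto simp: span_verts_def)
    then have K: "x \<in> K" "y \<in> W - K" "K \<subseteq> W" using n by (auto simp: K_def)
    have split: "ends G f \<subseteq> K \<or> ends G f \<subseteq> W - K" if f: "f \<in> ?A" for f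
    proof -
      obtain p q where pq: "ends G f = {p, q}" using ends_cases[OF mg, of f] f less(2) by auto
      have "(p, q) \<in> conn G ?A" "(q, p) \<in> conn G ?A" using conn_edge[OF f pq] conn_sym by auto
      then have "(x, p) \<in> conn G ?A \<longleftrightarrow> (x, q) \<in> conn G ?A" by (meson conn_trans)
      moreover have "p \<in> W" "q \<in> W" using less(6) f pq by (auto simp: span_verts_def)
      ultimately show ?thesis by (auto simp: K_def pq)
    qed
    have sub: "card (within G ?A X) < card X" if X: "X \<subseteq> W" "X \<noteq> {}" for X
    proof (rule less(1))
      have "within G ?A X \<subseteq> ?A" by (auto simp: within_def)
      moreover have "card ?A < card A" using e finA by (intro card_Diff1_less)
      ultimately show "card (within G ?A X) < card A"
        by (meson card_mono finA finite_Diff le_less_trans)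
      show "within G ?A X \<subseteq> edges G" using less(2) by (auto simp: within_def)
      show "acyclic_set G (within G ?A X)" using less(3) by (auto simp: acyclic_set_def within_def)
      show "finite X" using X less(4) finite_subset by auto
      show "span_verts G (within G ?A X) \<subseteq> X" by (auto simp: within_def span_verts_def)
    qed (rule X(2))
    have "?A \<subseteq> within G ?A K \<union> within G ?A (W - K)" using split by (auto simp: within_def)
    then have "card ?A \<le> card (within G ?A K \<union> within G ?A (W - K))"
      using finA by (intro card_mono) (simp_all add: finite_within)
    then have "card ?A \<le> card (within G ?A K) + card (within G ?A (W - K))"
      using card_Un_le le_trans by blast
    moreover have "card (within G ?A K) < card K" "card (within G ?A (W - K)) < card (W - K)"
      using sub[of K] sub[of "W - K"] K by auto
    moreover have "card W = card K + card (W - K)"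
      using K(3) less(4) card_Un_disjoint[of K "W - K"] finite_subset[of K W] by (simp add: Un_absorb1)
    moreover have "card A = Suc (card ?A)" using e finA by (metis card_Suc_Diff1)
    ultimately show ?thesis by linarith
  qed
qed

text \<open>A largest set \<open>S\<close> containing \<open>x\<close> and satisfying the bound must
  be all of \<open>W\<close>: otherwise some edge leaves \<open>S\<close>, and adding its outer end
  brings one vertex and at least one edge.\<close>

lemma connected_card_le:
  assumes A: "finite A" and W: "finite W" "x \<in> W" "\<And>z. z \<in> W \<Longrightarrow> (x, z) \<in> conn G A"
    and closed: "\<And>e p q. e \<in> A \<Longrightarrow> ends G e = {p, q} \<Longrightarrow> p \<in> W \<Longrightarrow> q \<in> W"
  shows "card W \<le> Suc (card (within G A W))"
proof -
  let ?P = "\<lambda>S. S \<subseteq> W \<and> x \<in> S \<and> card S \<le> Suc (card (within G A S))"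
  have "?P {x}" using W by auto
  moreover have "\<forall>S. ?P S \<longrightarrow> card S < Suc (card W)" using W by (auto simp: less_Suc_eq_le intro: card_mono)
  ultimately obtain S where S: "?P S" "\<And>T. ?P T \<Longrightarrow> card T \<le> card S"
    using Lattices_Big.ex_has_greatest_nat[of ?P "{x}" card "Suc (card W)"] by auto
  have "S = W"
  proof (rule ccontr)
    assume "S \<noteq> W"
    then obtain z where z: "z \<in> W" "z \<notin> S" using S by auto
    have "(x, z) \<in> (adj (edge_subgraph G A))\<^sup>*" using W(3)[OF z(1)] by (simp add: conn_def)
    then obtain p q where pq: "(p, q) \<in> adj (edge_subgraph G A)" "p \<in> S" "q \<notin> S"
      using rtrancl_crossing[of x z _ S] S(1) z by metis
    then obtain e where e: "e \<in> A" "ends G e = {p, q}" by (auto simp: adj_edge_subgraph)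
    have qW: "q \<in> W" using closed[OF e] pq S(1) by auto
    have "insert e (within G A S) \<subseteq> within G A (insert q S)" "e \<notin> within G A S"
      using e pq by (auto simp: within_def)
    moreover have finw: "finite (within G A X)" for X using A by (simp add: within_def)
    ultimately have "Suc (card (within G A S)) \<le> card (within G A (insert q S))"
      by (metis card_insert_disjoint card_mono)
    moreover have finS: "finite S" using S W finite_subset by auto
    ultimately have "?P (insert q S)" using S(1) qW pq by auto
    from S(2)[OF this] show False using finS pq by simp
  qed
  then show ?thesis using S by simp
qed

text \<open>Deleting one edge of \<open>C\<close> disconnects nothing, so the bound for connected
  sets already holds without that edge.\<close>

lemma cyclic_connected_card_le:
  assumes mg: "multigraph G" and A: "A \<subseteq> edges G" and W: "finite W" "x \<in> W" "\<And>z. z \<in> W \<Longrightarrow> (x, z) \<in> conn G A"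
    and closed: "\<And>e p q. e \<in> A \<Longrightarrow> ends G e = {p, q} \<Longrightarrow> p \<in> W \<Longrightarrow> q \<in> W"
    and C: "is_cycle G C" "C \<subseteq> A" "span_verts G C \<subseteq> W"
  shows "card W \<le> card (within G A W)"
proof -
  have finA: "finite A" using A mg finite_subset by (auto simp: multigraph_def)
  obtain e where e: "e \<in> C" using cycleD(3)[OF C(1)] by auto
  have eq: "conn G (A - {e}) = conn G A" by (rule cycle_conn_remove[OF mg C(1,2) e])
  have "card W \<le> Suc (card (within G (A - {e}) W))"
  proof (rule connected_card_le[of _ _ x])
    show "finite (A - {e})" using finA by simp
    show "(x, z) \<in> conn G (A - {e})" if "z \<in> W" for z using W(3)[OF that] eq by simp
    show "q \<in> W" if "f \<in> A - {e}" "ends G f = {p, q}" "p \<in> W" for f p q using closed that by auto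
  qed (rule W)+
  moreover have "e \<in> within G A W" using e C by (auto simp: within_def span_verts_def)
  moreover have "within G (A - {e}) W = within G A W - {e}" by (auto simp: within_def)
  moreover have "finite (within G A W)" using finA by (simp add: within_def)
  ultimately show ?thesis by (metis card_Suc_Diff1)
qed

section \<open>Frame independence over a space of edge sets\<close>

locale linear_bias_space =
  fixes G :: "('v, 'e) mgraph" and \<D> :: "'e set set"
  assumes multigraph: "multigraph G"
    and empty_mem: "{} \<in> \<D>"
    and sdiff_mem: "X \<in> \<D> \<Longrightarrow> Y \<in> \<D> \<Longrightarrow> sdiff X Y \<in> \<D>"
begin

abbreviation bias :: "'e set set" where "bias \<equiv> {C. is_cycle G C \<and> C \<in> \<D>}"

lemma finite_edges: "finite (edges G)" and finite_verts: "finite (verts G)"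
  using multigraph by (auto simp: multigraph_def)

lemma ends_verts: "e \<in> edges G \<Longrightarrow> ends G e \<subseteq> verts G"
  using multigraph by (auto simp: multigraph_def)

text \<open>Frame independence without component subgraphs: two cycles share a component exactly if
  some vertex of one is connected in \<open>A\<close> to some vertex of the other.\<close>

definition ind :: "'e set \<Rightarrow> bool" where
  "ind A \<longleftrightarrow> A \<subseteq> edges G \<and> (\<forall>C\<subseteq>A. is_cycle G C \<longrightarrow> C \<notin> \<D>) \<and>
     (\<forall>C\<subseteq>A. \<forall>C'\<subseteq>A. is_cycle G C \<longrightarrow> is_cycle G C' \<longrightarrow>
       (\<exists>x\<in>span_verts G C. \<exists>y\<in>span_verts G C'. (x, y) \<in> conn G A) \<longrightarrow> C = C')"

lemma frame_indep_iff_ind: "frame_indep G bias = ind"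
proof
  fix A
  let ?W = "\<lambda>x. {y \<in> span_verts G A. (x, y) \<in> conn G A}"
  have comps: "components (edge_subgraph G A) =
      (\<lambda>x. \<lparr>verts = ?W x, edges = {e \<in> A. ends G e \<subseteq> ?W x}, ends = ends G\<rparr>) ` span_verts G A"
    unfolding components_def component_of_def conn_def by (simp add: edge_subgraph_def span_verts_def Let_def)
  have cyc: "is_cycle \<lparr>verts = V, edges = {e \<in> A. ends G e \<subseteq> V}, ends = ends G\<rparr> C \<longleftrightarrow>
      is_cycle G C \<and> C \<subseteq> A \<and> span_verts G C \<subseteq> V" if "A \<subseteq> edges G" for V C
    using that unfolding is_cycle_def by (auto simp: edge_subgraph_def span_verts_def)
  have mono: "span_verts G C \<subseteq> span_verts G A" if "C \<subseteq> A" for C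
    using that by (auto simp: span_verts_def)
  have inW: "span_verts G C \<subseteq> ?W x" if C: "is_cycle G C" "C \<subseteq> A" and x: "\<exists>z\<in>span_verts G C. (x, z) \<in> conn G A" for C x
  proof
    fix y assume y: "y \<in> span_verts G C"
    obtain z where z: "z \<in> span_verts G C" "(x, z) \<in> conn G A" using x by auto
    have "(z, y) \<in> conn G A" using cycleD(4)[OF C(1) z(1) y] conn_mono[OF C(2)] by blast
    then show "y \<in> ?W x" using conn_trans[OF z(2)] mono[OF C(2)] y by auto
  qed
  show "frame_indep G bias A = ind A"
  proof (cases "A \<subseteq> edges G")
    case False
    then show ?thesis by (simp add: frame_indep_def ind_def)
  next
    case True
    note cyc' = cyc[OF True]
    show ?thesis
    proof
      assume F: "frame_indep G bias A"
      have F1: "C = C'" if "x \<in> span_verts G A" "is_cycle G C \<and> C \<subseteq> A \<and> span_verts G C \<subseteq> ?W x"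
        "is_cycle G C' \<and> C' \<subseteq> A \<and> span_verts G C' \<subseteq> ?W x" for x C C'
        using F that unfolding frame_indep_def comps by (simp add: cyc')
      have F2: "C \<notin> \<D>" if "x \<in> span_verts G A" "is_cycle G C \<and> C \<subseteq> A \<and> span_verts G C \<subseteq> ?W x" for x C
        using F that unfolding frame_indep_def comps by (simp add: cyc')
      show "ind A"
        unfolding ind_def
      proof (intro conjI allI impI)
        fix C assume C: "C \<subseteq> A" "is_cycle G C"
        obtain x where x: "x \<in> span_verts G C" using cycleD(6)[OF C(2)] by auto
        have sub: "span_verts G C \<subseteq> ?W x" by (intro inW[OF C(2,1)] bexI[OF _ x] conn_refl)
        have xA: "x \<in> span_verts G A" using mono[OF C(1)] x by auto
        show "C \<notin> \<D>" using F2[OF xA] C sub by simp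
        fix C' assume C': "C' \<subseteq> A" "is_cycle G C'" "\<exists>x\<in>span_verts G C. \<exists>y\<in>span_verts G C'. (x, y) \<in> conn G A"
        then obtain p q where pq: "p \<in> span_verts G C" "q \<in> span_verts G C'" "(p, q) \<in> conn G A" by auto
        have "(x, p) \<in> conn G A" using cycleD(4)[OF C(2) x pq(1)] conn_mono[OF C(1)] by blast
        then have "(x, q) \<in> conn G A" using pq(3) conn_trans by metis
        then have "span_verts G C' \<subseteq> ?W x" by (intro inW[OF C'(2,1)] bexI[OF _ pq(2)])
        then show "C = C'" using F1[OF xA] C C' sub by simp
      qed (rule True)
    next
      assume I: "ind A"
      show "frame_indep G bias A"
        unfolding frame_indep_def
      proof (intro conjI ballI allI impI)
        fix K C assume K: "K \<in> components (edge_subgraph G A)" and C: "is_cycle K C"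
        obtain x where x: "K = \<lparr>verts = ?W x, edges = {e \<in> A. ends G e \<subseteq> ?W x}, ends = ends G\<rparr>"
          using K unfolding comps by auto
        have C1: "is_cycle G C" "C \<subseteq> A" "span_verts G C \<subseteq> ?W x" using C unfolding x cyc' by auto
        show "C \<notin> bias" using I C1 by (auto simp: ind_def)
        fix C' assume C': "is_cycle K C'"
        have C2: "is_cycle G C'" "C' \<subseteq> A" "span_verts G C' \<subseteq> ?W x" using C' unfolding x cyc' by auto
        obtain p q where "p \<in> span_verts G C" "q \<in> span_verts G C'"
          using cycleD(6)[OF C1(1)] cycleD(6)[OF C2(1)] by auto
        moreover from this have "(x, p) \<in> conn G A" "(x, q) \<in> conn G A" using C1 C2 by auto
        then have "(p, q) \<in> conn G A" using conn_sym conn_trans by metis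
        ultimately show "C = C'" using I C1 C2 unfolding ind_def by metis
      qed (rule True)
    qed
  qed
qed

lemma ind_subset: assumes "ind A" "B \<subseteq> A" shows "ind B"
  using assms conn_mono[OF assms(2), of G] unfolding ind_def by (meson subset_trans subsetD)

lemma cyclic_atI:
  "is_cycle G C \<Longrightarrow> C \<subseteq> A \<Longrightarrow> z \<in> span_verts G C \<Longrightarrow> (x, z) \<in> conn G A \<Longrightarrow> cyclic_at G A x"
  by (auto simp: cyclic_at_def)

lemma cycle_through_edge:
  assumes "is_cycle G C" "e \<in> C" "ends G e = {x, y}"
  shows "(x, y) \<in> conn G (C - {e})"
  using even_set_conn[OF multigraph cycle_even[OF assms(1)] assms(2,3)] by (cases "x = y") auto

lemma two_cycles:
  assumes "is_cycle G C" "is_cycle G C'" "C \<noteq> C'"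
  obtains C'' where "is_cycle G C''" "C'' \<subseteq> sdiff C C'"
proof -
  have "even_set G (sdiff C C')" using even_sdiff[OF finite_edges] cycle_even assms by blast
  moreover have "sdiff C C' \<noteq> {}" using assms(3) by (auto simp: sdiff_def)
  ultimately show thesis using even_set_cycle[OF multigraph] that by blast
qed

text \<open>These are the two possible obstructions: \<open>e\<close> closes a balanced cycle in a
  tree component, or it attaches to components that contain cycles at both ends. If \<open>e\<close>
  instead closes an unbalanced cycle in a tree component, that cycle is unique; if it joins two
  components of which at most one has a cycle, no cycle arises.\<close>

lemma not_addable:
  assumes A: "ind A" and e: "e \<in> edges G" "e \<notin> A" "ends G e = {x, y}" and n: "\<not> ind (insert e A)"
  shows "(x, y) \<in> conn G A \<and> \<not> cyclic_at G A x \<and> (\<exists>C\<subseteq>insert e A. e \<in> C \<and> is_cycle G C \<and> C \<in> \<D>) \<or>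
    cyclic_at G A x \<and> cyclic_at G A y"
proof (rule ccontr)
  assume neg: "\<not> ?thesis"
  have AE: "A \<subseteq> edges G" using A by (simp add: ind_def)
  have A1: "C \<notin> \<D>" if "C \<subseteq> A" "is_cycle G C" for C using A that by (simp add: ind_def)
  have A2: "C = C'" if "C \<subseteq> A" "is_cycle G C" "C' \<subseteq> A" "is_cycle G C'" "p \<in> span_verts G C" "q \<in> span_verts G C'"
    "(p, q) \<in> conn G A" for C C' p q using A that unfolding ind_def by metis
  have without: "C \<subseteq> A" if "C \<subseteq> insert e A" "e \<notin> C" for C using that by auto
  have "ind (insert e A)"
  proof (cases "(x, y) \<in> conn G A")
    case True
    have cy: "\<not> cyclic_at G A x"
    proof
      assume cx: "cyclic_at G A x"
      then have "cyclic_at G A y"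
        unfolding cyclic_at_def using conn_trans[OF conn_sym[OF True]] by blast
      then show False using cx neg by auto
    qed
    have conn: "conn G (insert e A) = conn G A" by (rule conn_insert_connected[OF e(3) True])
    have xC: "x \<in> span_verts G C" if "e \<in> C" for C using that e by (auto simp: span_verts_def)
    have nD: "C \<notin> \<D>" if "C \<subseteq> insert e A" "is_cycle G C" for C
      using neg True cy that A1 without[of C] by metis
    have far: False if C: "C \<subseteq> A" "is_cycle G C" and C': "C' \<subseteq> insert e A" "is_cycle G C'" "e \<in> C'"
      and pq: "p \<in> span_verts G C" "q \<in> span_verts G C'" "(p, q) \<in> conn G A" for C C' p q
    proof -
      have "(x, q) \<in> conn G A" using cycleD(4)[OF C'(2) xC[OF C'(3)] pq(2)] conn_mono[OF C'(1)] conn by blast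
      then have "(x, p) \<in> conn G A" using conn_sym[OF pq(3)] conn_trans by metis
      then show False using cy cyclic_atI[OF C(2,1) pq(1)] by blast
    qed
    have uniq: "C = C'" if C: "C \<subseteq> insert e A" "is_cycle G C" and C': "C' \<subseteq> insert e A" "is_cycle G C'"
      and pq: "p \<in> span_verts G C" "q \<in> span_verts G C'" "(p, q) \<in> conn G A" for C C' p q
    proof (cases "e \<in> C")
      case eC: True
      show ?thesis
      proof (cases "e \<in> C'")
        case eC': True
        show ?thesis
        proof (rule ccontr)
          assume "C \<noteq> C'"
          \<comment> \<open>Both cycles use \<open>e\<close>, so their symmetric difference avoids
            it and contains a cycle of \<open>A\<close>, which lies in the component of
            \<open>x\<close>.\<close>
          then obtain C'' where C'': "is_cycle G C''" "C'' \<subseteq> sdiff C C'" using two_cycles C C' by metis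
          then have sub: "C'' \<subseteq> A" "C'' \<subseteq> C \<union> C'" using C C' eC eC' by (auto simp: sdiff_def)
          obtain z where z: "z \<in> span_verts G C''" using cycleD(6)[OF C''(1)] by auto
          then have "z \<in> span_verts G C \<or> z \<in> span_verts G C'" using sub(2) by (auto simp: span_verts_def)
          then have "(x, z) \<in> conn G (insert e A)"
            using cycleD(4)[OF C(2) xC[OF eC], of z] cycleD(4)[OF C'(2) xC[OF eC'], of z]
              conn_mono[OF C(1)] conn_mono[OF C'(1)] by blast
          then show False using cyclic_atI[OF C''(1) sub(1) z] cy conn by simp
        qed
      next
        case False
        then show ?thesis using far[OF without[OF C'(1)] C'(2) C eC pq(2,1)] conn_sym[OF pq(3)] by auto
      qed
    next
      case eC: False
      show ?thesis
      proof (cases "e \<in> C'")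
        case True
        then show ?thesis using far[OF without[OF C(1) eC] C(2) C' _ pq] by auto
      next
        case False
        show ?thesis by (rule A2[OF without[OF C(1) eC] C(2) without[OF C'(1) False] C'(2) pq])
      qed
    qed
    show ?thesis unfolding ind_def conn
    proof (intro conjI allI impI)
      show "insert e A \<subseteq> edges G" using AE e by auto
      show "C \<notin> \<D>" if "C \<subseteq> insert e A" "is_cycle G C" for C using nD that by blast
      show "C = C'" if C: "C \<subseteq> insert e A" "C' \<subseteq> insert e A" "is_cycle G C" "is_cycle G C'"
        and ex: "\<exists>x\<in>span_verts G C. \<exists>y\<in>span_verts G C'. (x, y) \<in> conn G A" for C C'
        using uniq[OF C(1,3) C(2,4)] ex by auto
    qed
  next
    case False
    have noe: "C \<subseteq> A" if C: "C \<subseteq> insert e A" "is_cycle G C" for C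
    proof (rule without[OF C(1)])
      show "e \<notin> C"
      proof
        assume "e \<in> C"
        from cycle_through_edge[OF C(2) this e(3)] show False
          using conn_mono[of "C - {e}" A G] C(1) False by blast
      qed
    qed
    have uniq: "C = C'" if C: "C \<subseteq> A" "is_cycle G C" and C': "C' \<subseteq> A" "is_cycle G C'"
      and pq: "p \<in> span_verts G C" "q \<in> span_verts G C'" "(p, q) \<in> conn G (insert e A)" for C C' p q
    proof -
      \<comment> \<open>If \<open>p\<close> and \<open>q\<close> are connected only through
        \<open>e\<close>, the two cycles hang on different ends of \<open>e\<close>, which is the
        second alternative of \<open>neg\<close>.\<close>
      have "cyclic_at G A x \<and> cyclic_at G A y"
        if "(p, x) \<in> conn G A \<and> (y, q) \<in> conn G A \<or> (p, y) \<in> conn G A \<and> (x, q) \<in> conn G A"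
        using that cyclic_atI[OF C(2,1) pq(1)] cyclic_atI[OF C'(2,1) pq(2)] conn_sym by metis
      then have "(p, q) \<in> conn G A" using conn_insert[OF e(3) pq(3)] neg by blast
      then show ?thesis using A2[OF C C' pq(1,2)] by simp
    qed
    show ?thesis unfolding ind_def
    proof (intro conjI allI impI)
      show "insert e A \<subseteq> edges G" using AE e by auto
      show "C \<notin> \<D>" if "C \<subseteq> insert e A" "is_cycle G C" for C using A1 noe that by blast
      show "C = C'" if C: "C \<subseteq> insert e A" "C' \<subseteq> insert e A" "is_cycle G C" "is_cycle G C'"
        and ex: "\<exists>x\<in>span_verts G C. \<exists>y\<in>span_verts G C'. (x, y) \<in> conn G (insert e A)" for C C'
        using uniq[OF noe[OF C(1,3)] C(3) noe[OF C(2,4)] C(4)] ex by auto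
    qed
  qed
  then show False using n by simp
qed

text \<open>An unbalanced unicyclic component loses its only cycle together with any edge of that cycle.\<close>

lemma ind_component_card:
  assumes A: "ind A" and K: "finite K" "x \<in> K" "\<And>z. z \<in> K \<Longrightarrow> (x, z) \<in> conn G A"
  shows "card (within G A K) \<le> card K"
proof (cases "acyclic_set G (within G A K)")
  case True
  have "within G A K \<subseteq> edges G" using A by (auto simp: ind_def within_def)
  moreover have "span_verts G (within G A K) \<subseteq> K" by (auto simp: within_def span_verts_def)
  ultimately show ?thesis using acyclic_card_less[OF multigraph _ True K(1)] K(2) by fastforce
next
  case False
  let ?B = "within G A K"
  have BA: "?B \<subseteq> A" by (auto simp: within_def)
  obtain C where C: "C \<subseteq> ?B" "is_cycle G C" using False by (auto simp: acyclic_set_def)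
  obtain e where e: "e \<in> C" using cycleD(3)[OF C(2)] by auto
  have "acyclic_set G (?B - {e})"
    unfolding acyclic_set_def
  proof (intro allI impI notI)
    fix C' assume C': "C' \<subseteq> ?B - {e}" "is_cycle G C'"
    obtain p q where pq: "p \<in> span_verts G C" "q \<in> span_verts G C'"
      using cycleD(6)[OF C(2)] cycleD(6)[OF C'(2)] by auto
    have "p \<in> K" "q \<in> K" using pq C C' by (auto simp: within_def span_verts_def)
    then have "(p, q) \<in> conn G A" using K(3) conn_sym conn_trans by metis
    moreover have "C \<subseteq> A" "C' \<subseteq> A" using C C' BA by auto
    ultimately have "C = C'" using A C C' pq unfolding ind_def by metis
    then show False using e C' by auto
  qed
  moreover have "?B - {e} \<subseteq> edges G" using A by (auto simp: ind_def within_def)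
  moreover have "span_verts G (?B - {e}) \<subseteq> K" by (auto simp: within_def span_verts_def)
  ultimately have "card (?B - {e}) < card K" using acyclic_card_less[OF multigraph _ _ K(1)] K(2) by auto
  moreover have "e \<in> ?B" using e C by auto
  moreover have "finite A" using A finite_edges finite_subset by (auto simp: ind_def)
  then have "finite ?B" by (rule finite_within)
  ultimately show ?thesis by (simp add: card_Diff_singleton)
qed

section \<open>Summing edge counts over components\<close>

definition component :: "'e set \<Rightarrow> 'v \<Rightarrow> 'v set" where
  "component A x = {y \<in> verts G. (x, y) \<in> conn G A}"

lemma component_eq: "(x, y) \<in> conn G A \<Longrightarrow> component A x = component A y"
  unfolding component_def using conn_sym conn_trans by fast

lemma conn_component: "z \<in> component A x \<Longrightarrow> (x, z) \<in> conn G A"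
  by (simp add: component_def)

lemma component_disjoint: assumes "component A x \<inter> component A y \<noteq> {}" shows "component A x = component A y"
proof -
  obtain z where "(x, z) \<in> conn G A" "(y, z) \<in> conn G A" using assms by (auto simp: component_def)
  then show ?thesis using component_eq by metis
qed

lemma finite_component: "finite (component A x)"
  using finite_verts by (simp add: component_def)

lemma component_closed: "e \<in> A \<Longrightarrow> A \<subseteq> edges G \<Longrightarrow> ends G e = {p, q} \<Longrightarrow> p \<in> component A x \<Longrightarrow> q \<in> component A x"
  using conn_edge[of e A G p q] ends_verts[of e] by (auto simp: component_def intro: conn_trans)

lemma sum_components:
  assumes S: "S \<subseteq> verts G" and U: "(\<Union>x\<in>S. component A x) = U"
  shows "(\<Sum>K\<in>component A ` S. card K) = card U"
proof -
  have "(\<Sum>K\<in>component A ` S. card K) = card (\<Union>(component A ` S))"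
  proof (rule card_Union_disjoint[symmetric])
    show "pairwise disjnt (component A ` S)"
      using component_disjoint by (auto simp: pairwise_def disjnt_def)
  qed (auto simp: finite_component)
  then show ?thesis using U by simp
qed

lemma sum_within_components:
  assumes A: "finite X" and S: "S \<subseteq> verts G"
    and ends: "\<And>e. e \<in> X \<Longrightarrow> ends G e \<noteq> {}"
  shows "(\<Sum>K\<in>component A ` S. card (within G X K)) = card (\<Union>K\<in>component A ` S. within G X K)"
proof (rule card_UN_disjoint[symmetric])
  show "finite (component A ` S)" using S finite_verts finite_subset by auto
  show "\<forall>K\<in>component A ` S. finite (within G X K)" using A by (simp add: within_def)
  show "\<forall>K\<in>component A ` S. \<forall>K'\<in>component A ` S. K \<noteq> K' \<longrightarrow> within G X K \<inter> within G X K' = {}"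
  proof (intro ballI impI)
    fix K K' assume K: "K \<in> component A ` S" "K' \<in> component A ` S" "K \<noteq> K'"
    then have "K \<inter> K' = {}" using component_disjoint by auto
    then show "within G X K \<inter> within G X K' = {}" using ends by (fastforce simp: within_def)
  qed
qed

lemma ends_nonempty: "e \<in> edges G \<Longrightarrow> ends G e \<noteq> {}"
  using ends_cases[OF multigraph] by (metis insert_not_empty)

text \<open>Passing to \<open>within G A W\<close> first keeps every component inside
  \<open>W\<close>, so that the bound for a single component can be summed.\<close>

lemma ind_card_le:
  assumes A: "ind A" and W: "W \<subseteq> verts G"
  shows "card (within G A W) \<le> card W"
proof -
  define B where "B = within G A W"
  have B: "ind B" "B \<subseteq> edges G"
    using ind_subset[OF A, of B] A by (auto simp: B_def within_def ind_def)
  have finB: "finite B" using B finite_edges finite_subset by auto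
  have compW: "component B x \<subseteq> W" if x: "x \<in> W" for x
  proof
    fix y assume "y \<in> component B x"
    then have xy: "(x, y) \<in> (adj (edge_subgraph G B))\<^sup>*" by (simp add: component_def conn_def)
    show "y \<in> W"
    proof (rule ccontr)
      assume y: "y \<notin> W"
      obtain p q where "(p, q) \<in> adj (edge_subgraph G B)" "p \<in> W" "q \<notin> W"
        by (rule rtrancl_crossing[OF xy x y])
      then show False by (auto simp: adj_edge_subgraph B_def within_def)
    qed
  qed
  have self: "x \<in> component B x" if "x \<in> W" for x using that W by (auto simp: component_def)
  have U: "(\<Union>x\<in>W. component B x) = W" using compW self by blast
  have "B \<subseteq> (\<Union>K\<in>component B ` W. within G B K)"
  proof
    fix e assume e: "e \<in> B"
    obtain p q where pq: "ends G e = {p, q}" using ends_cases[OF multigraph, of e] e B by auto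
    have pW: "p \<in> W" using e pq by (auto simp: B_def within_def)
    then have "q \<in> component B p" using component_closed[OF e B(2) pq] self by auto
    then have "e \<in> within G B (component B p)" using self[OF pW] e pq by (auto simp: within_def)
    then show "e \<in> (\<Union>K\<in>component B ` W. within G B K)" using pW by blast
  qed
  moreover have "(\<Union>K\<in>component B ` W. within G B K) \<subseteq> B" by (auto simp: within_def)
  ultimately have "card B = (\<Sum>K\<in>component B ` W. card (within G B K))"
    using sum_within_components[OF finB W, of B] ends_nonempty B(2) by (metis subset_antisym subsetD)
  also have "\<dots> \<le> (\<Sum>K\<in>component B ` W. card K)"
  proof (rule sum_mono)
    fix K assume "K \<in> component B ` W"
    then obtain x where x: "x \<in> W" "K = component B x" by auto
    show "card (within G B K) \<le> card K"
      unfolding x(2) by (rule ind_component_card[OF B(1) finite_component self[OF x(1)]]) (simp add: component_def)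
  qed
  also have "\<dots> = card W" by (rule sum_components[OF W U])
  finally show ?thesis by (simp add: B_def)
qed

text \<open>Modulo \<open>\<D>\<close>, every edge of \<open>X\<close> can be pushed into the forest \<open>within G A K\<close> along its balanced
  fundamental cycle; hence every cycle in \<open>X\<close> lies in \<open>\<D>\<close>.\<close>

lemma acyclic_component:
  assumes A: "ind A" and B: "ind B" and tree: "\<not> cyclic_at G A x"
    and fund: "\<And>e. e \<in> within G B (component A x) - A \<Longrightarrow> \<exists>C\<subseteq>insert e A. e \<in> C \<and> is_cycle G C \<and> C \<in> \<D>"
  shows "acyclic_set G (within G B (component A x))"
proof -
  let ?K = "component A x"
  have AE: "A \<subseteq> edges G" and BE: "B \<subseteq> edges G" using A B by (auto simp: ind_def)
  have forest: "Z = {}" if Z: "even_set G Z" "Z \<subseteq> within G A ?K" for Z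
  proof (rule ccontr)
    assume "Z \<noteq> {}"
    then obtain C where C: "C \<subseteq> Z" "is_cycle G C" using even_set_cycle[OF multigraph Z(1)] by auto
    obtain z where z: "z \<in> span_verts G C" using cycleD(6)[OF C(2)] by auto
    have "z \<in> ?K" using z C(1) Z(2) by (auto simp: span_verts_def within_def)
    then have "cyclic_at G A x"
      using cyclic_atI[OF C(2) _ z] C(1) Z(2) by (auto simp: component_def within_def)
    then show False using tree by simp
  qed
  have push: "\<exists>Z\<in>\<D>. even_set G Z \<and> sdiff X Z \<subseteq> within G A ?K" if "finite X" "X \<subseteq> within G B ?K" for X
    using that
  proof (induction X rule: finite_induct)
    case empty
    have "even_set G {}" by (simp add: even_set_def links_at_def)
    moreover have "sdiff {} {} \<subseteq> within G A ?K" by (simp add: sdiff_def)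
    ultimately show ?case using empty_mem by blast
  next
    case (insert e X)
    obtain Z where Z: "Z \<in> \<D>" "even_set G Z" "sdiff X Z \<subseteq> within G A ?K" using insert by auto
    have eK: "e \<in> B" "ends G e \<subseteq> ?K" using insert(4) by (auto simp: within_def)
    show ?case
    proof (cases "e \<in> A")
      case True
      then have "e \<in> within G A ?K" using eK by (simp add: within_def)
      then have "sdiff (insert e X) Z \<subseteq> within G A ?K" using Z(3) by (auto simp: sdiff_def)
      then show ?thesis using Z by blast
    next
      case False
      then obtain C where C: "C \<subseteq> insert e A" "e \<in> C" "is_cycle G C" "C \<in> \<D>"
        using fund[of e] insert(4) by auto
      obtain p q where pq: "ends G e = {p, q}" using ends_cases[OF multigraph, of e] eK(1) BE by auto
      have px: "(x, p) \<in> conn G A" "(x, q) \<in> conn G A" using eK(2) pq by (auto simp: component_def)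
      then have "(p, q) \<in> conn G A" using conn_sym conn_trans by metis
      then have conn: "conn G (insert e A) = conn G A" using conn_insert_connected[OF pq] by simp
      have "C - {e} \<subseteq> within G A ?K"
      proof
        fix f assume f: "f \<in> C - {e}"
        have "ends G f \<subseteq> ?K"
        proof
          fix z assume z: "z \<in> ends G f"
          have "p \<in> span_verts G C" "z \<in> span_verts G C" using C(2) pq f z by (auto simp: span_verts_def)
          then have "(p, z) \<in> conn G A" using cycleD(4)[OF C(3)] conn_mono[OF C(1), of G] conn by blast
          moreover have "z \<in> verts G" using cycleD(1)[OF C(3)] f z ends_verts by blast
          ultimately show "z \<in> ?K" using px(1) conn_trans by (auto simp: component_def)
        qed
        then show "f \<in> within G A ?K" using f C(1) by (auto simp: within_def)
      qed
      \<comment> \<open>Adding \<open>C\<close> to \<open>Z\<close> cancels \<open>e\<close> and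
        otherwise changes only edges of the tree.\<close>
      then have "sdiff (insert e X) (sdiff Z C) \<subseteq> within G A ?K"
        using Z(3) insert(2) C(2) False by (auto simp: sdiff_def within_def)
      moreover have "even_set G (sdiff Z C)" using even_sdiff[OF finite_edges Z(2) cycle_even[OF C(3)]] .
      moreover have "sdiff Z C \<in> \<D>" using sdiff_mem Z(1) C(4) .
      ultimately show ?thesis by blast
    qed
  qed
  show ?thesis
    unfolding acyclic_set_def
  proof (intro allI impI notI)
    fix C assume C: "C \<subseteq> within G B ?K" "is_cycle G C"
    obtain Z where Z: "Z \<in> \<D>" "even_set G Z" "sdiff C Z \<subseteq> within G A ?K"
      using push[OF cycleD(2)[OF C(2)] C(1)] by auto
    have "sdiff C Z = {}"
      by (rule forest[OF even_sdiff[OF finite_edges cycle_even[OF C(2)] Z(2)] Z(3)])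
    then have "C = Z" by (auto simp: sdiff_def)
    moreover have "C \<subseteq> B" using C(1) by (auto simp: within_def)
    ultimately show False using B C(2) Z(1) by (auto simp: ind_def)
  qed
qed

text \<open>If nothing could be added, \<open>not_addable\<close> would place every edge of
  \<open>B\<close> inside a tree component of \<open>A\<close> or inside the union \<open>U\<close>
  of its cyclic components. On a tree component \<open>B\<close> is a forest, so it has no more
  edges there than the spanning tree formed by \<open>A\<close>. On \<open>U\<close>,
  \<open>B\<close> has at most \<open>card U\<close> edges and \<open>A\<close> at least that many.
  Summing gives \<open>card B \<le> card A\<close>.\<close>

lemma augment_ind:
  assumes A: "ind A" and B: "ind B" and less: "card A < card B"
  shows "\<exists>e\<in>B - A. ind (insert e A)"
proof (rule ccontr)
  assume none: "\<not> ?thesis"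
  have AE: "A \<subseteq> edges G" and BE: "B \<subseteq> edges G" using A B by (auto simp: ind_def)
  have fin: "finite A" "finite B" using AE BE finite_edges finite_subset by auto
  define T where "T = {x \<in> verts G. \<not> cyclic_at G A x}"
  define U where "U = {x \<in> verts G. cyclic_at G A x}"
  have TU: "T \<subseteq> verts G" "U \<subseteq> verts G" by (auto simp: T_def U_def)
  have cyc_conn: "cyclic_at G A x \<longleftrightarrow> cyclic_at G A y" if "(x, y) \<in> conn G A" for x y
    unfolding cyclic_at_def using conn_trans[OF that] conn_trans[OF conn_sym[OF that]] by blast
  have self: "x \<in> component A x" if "x \<in> verts G" for x using that by (simp add: component_def)
  have UU: "(\<Union>x\<in>U. component A x) = U"
    using self cyc_conn by (auto simp: U_def component_def)
  have edge: "(\<exists>x\<in>T. e \<in> within G B (component A x)) \<or> e \<in> within G B U" if e: "e \<in> B" for e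
  proof -
    obtain p q where pq: "ends G e = {p, q}" using ends_cases[OF multigraph, of e] e BE by auto
    have V: "p \<in> verts G" "q \<in> verts G" using ends_verts[of e] pq e BE by auto
    have "(p, q) \<in> conn G A \<or> cyclic_at G A p \<and> cyclic_at G A q"
      using not_addable[OF A _ _ pq] none e BE conn_edge[OF _ pq, of A] by blast
    then show ?thesis
    proof
      assume c: "(p, q) \<in> conn G A"
      show ?thesis
      proof (cases "cyclic_at G A p")
        case True
        then show ?thesis using cyc_conn[OF c] V pq e by (auto simp: U_def within_def)
      next
        case False
        then have "p \<in> T" using V by (simp add: T_def)
        moreover have "e \<in> within G B (component A p)" using c V pq e by (auto simp: within_def component_def)
        ultimately show ?thesis by blast
      qed
    next
      assume "cyclic_at G A p \<and> cyclic_at G A q"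
      then show ?thesis using V pq e by (auto simp: U_def within_def)
    qed
  qed
  have tree: "card (within G B (component A x)) \<le> card (within G A (component A x))" if x: "x \<in> T" for x
  proof -
    have xV: "x \<in> verts G" "\<not> cyclic_at G A x" using x by (auto simp: T_def)
    have "acyclic_set G (within G B (component A x))"
    proof (rule acyclic_component[OF A B xV(2)])
      fix e assume e: "e \<in> within G B (component A x) - A"
      then have eB: "e \<in> B" "e \<notin> A" "ends G e \<subseteq> component A x" by (auto simp: within_def)
      obtain p q where pq: "ends G e = {p, q}" by (rule ends_cases[OF multigraph subsetD[OF BE eB(1)]])
      have "(x, p) \<in> conn G A" using eB pq by (auto simp: component_def)
      then have "\<not> cyclic_at G A p" using cyc_conn xV by blast
      then show "\<exists>C\<subseteq>insert e A. e \<in> C \<and> is_cycle G C \<and> C \<in> \<D>"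
        using not_addable[OF A _ eB(2) pq] none eB BE by blast
    qed
    moreover have "within G B (component A x) \<subseteq> edges G" using BE by (auto simp: within_def)
    moreover have "span_verts G (within G B (component A x)) \<subseteq> component A x"
      by (auto simp: within_def span_verts_def)
    ultimately have "card (within G B (component A x)) < card (component A x)"
      using acyclic_card_less[OF multigraph _ _ finite_component] self[OF xV(1)] by blast
    moreover have "card (component A x) \<le> Suc (card (within G A (component A x)))"
      by (rule connected_card_le[OF fin(1) finite_component self[OF xV(1)] conn_component component_closed[OF _ AE]])
    ultimately show ?thesis by linarith
  qed
  have cyc: "card (component A x) \<le> card (within G A (component A x))" if x: "x \<in> U" for x
  proof -
    have xV: "x \<in> verts G" "cyclic_at G A x" using x by (auto simp: U_def)
    obtain C z where C: "C \<subseteq> A" "is_cycle G C" "z \<in> span_verts G C" "(x, z) \<in> conn G A"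
      using xV(2) by (auto simp: cyclic_at_def)
    have sub: "span_verts G C \<subseteq> component A x"
    proof
      fix w assume w: "w \<in> span_verts G C"
      have "(z, w) \<in> conn G A" using cycleD(4)[OF C(2,3) w] conn_mono[OF C(1), of G] by blast
      moreover have "w \<in> verts G" using w cycleD(1)[OF C(2)] ends_verts by (auto simp: span_verts_def)
      ultimately show "w \<in> component A x" using C(4) conn_trans by (auto simp: component_def)
    qed
    show ?thesis
      by (rule cyclic_connected_card_le[OF multigraph AE finite_component self[OF xV(1)] conn_component
            component_closed[OF _ AE] C(2,1) sub])
  qed
  have ne: "ends G e \<noteq> {}" if "e \<in> A \<or> e \<in> B" for e using that AE BE ends_nonempty by auto
  have "B \<subseteq> (\<Union>K\<in>component A ` T. within G B K) \<union> within G B U" using edge by blast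
  then have "card B \<le> card ((\<Union>K\<in>component A ` T. within G B K) \<union> within G B U)"
    using TU fin(2) finite_verts finite_subset
    by (intro card_mono) (auto simp: finite_within intro!: finite_UN_I)
  also have "\<dots> \<le> card (\<Union>K\<in>component A ` T. within G B K) + card (within G B U)"
    by (rule card_Un_le)
  also have "card (\<Union>K\<in>component A ` T. within G B K) = (\<Sum>K\<in>component A ` T. card (within G B K))"
    by (rule sum_within_components[OF fin(2) TU(1), symmetric]) (use ne in auto)
  also have "\<dots> \<le> (\<Sum>K\<in>component A ` T. card (within G A K))"
    by (rule sum_mono) (use tree in auto)
  also have "card (within G B U) \<le> card U" by (rule ind_card_le[OF B TU(2)])
  also have "card U = (\<Sum>K\<in>component A ` U. card K)" by (rule sum_components[OF TU(2) UU, symmetric])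
  also have "\<dots> \<le> (\<Sum>K\<in>component A ` U. card (within G A K))"
    by (rule sum_mono) (use cyc in auto)
  finally have "card B \<le> (\<Sum>K\<in>component A ` T. card (within G A K)) + (\<Sum>K\<in>component A ` U. card (within G A K))"
    by simp
  also have "\<dots> = (\<Sum>K\<in>component A ` (T \<union> U). card (within G A K))"
    unfolding image_Un
  proof (rule sum.union_disjoint[symmetric])
    show "finite (component A ` T)" "finite (component A ` U)"
      using TU[THEN finite_subset, OF finite_verts] by auto
    show "component A ` T \<inter> component A ` U = {}"
    proof (rule ccontr)
      assume "component A ` T \<inter> component A ` U \<noteq> {}"
      then obtain x y where xy: "x \<in> T" "y \<in> U" "component A x = component A y" by auto
      then have "y \<in> component A x" using self TU by auto
      then show False using xy cyc_conn by (auto simp: component_def T_def U_def)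
    qed
  qed
  also have "\<dots> = card (\<Union>K\<in>component A ` (T \<union> U). within G A K)"
    by (rule sum_within_components[OF fin(1)]) (use TU ne in auto)
  also have "\<dots> \<le> card A" by (rule card_mono[OF fin(1)]) (auto simp: within_def)
  finally show False using less by simp
qed

lemma matroid_ind: "matroid (edges G) ind"
proof
  show "finite (edges G)" by (rule finite_edges)
  show "X \<subseteq> edges G" if "ind X" for X using that by (simp add: ind_def)
qed (fact ind_subset augment_ind)+

text \<open>\<open>X\<close> leaves \<open>v\<close> isolated, so \<open>v\<close> has no cycle in
  its component and only the first obstruction of \<open>not_addable\<close> can occur. It would
  make \<open>e\<close> a balanced loop, against \<open>ind {e}\<close>.\<close>

lemma ind_insert_incident:
  assumes X: "ind X" "X \<inter> incident_edges G v = {}" and e: "e \<in> incident_edges G v" "ind {e}"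
  shows "ind (insert e X)"
proof (rule ccontr)
  assume n: "\<not> ind (insert e X)"
  have XE: "X \<subseteq> edges G" using X by (simp add: ind_def)
  have eE: "e \<in> edges G" "v \<in> ends G e" "e \<notin> X" using e X by (auto simp: incident_edges_def)
  obtain y where y: "ends G e = {v, y}"
    using ends_cases[OF multigraph eE(1)] eE(2) by (metis insertE insert_commute singletonD)
  have iso: "v \<notin> ends G f" if "f \<in> X" for f using that X(2) XE by (auto simp: incident_edges_def)
  have alone: "w = v" if "(v, w) \<in> conn G X" for w
    using that unfolding conn_def
    by (induction rule: rtrancl_induct) (use iso in \<open>auto simp: adj_edge_subgraph\<close>)
  have "\<not> cyclic_at G X v"
  proof
    assume "cyclic_at G X v"
    then obtain C z where "C \<subseteq> X" "z \<in> span_verts G C" "(v, z) \<in> conn G X" by (auto simp: cyclic_at_def)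
    then show False using alone iso by (auto simp: span_verts_def)
  qed
  then obtain C where C: "(v, y) \<in> conn G X" "C \<subseteq> insert e X" "e \<in> C" "is_cycle G C" "C \<in> \<D>"
    using not_addable[OF X(1) eE(1,3) y n] by auto
  have "y = v" using alone[OF C(1)] .
  then have loop: "ends G e = {v}" using y by simp
  have conn: "conn G (insert e X) = conn G X" using conn_insert_connected[OF y C(1)] .
  have "C = {e}"
  proof (rule ccontr)
    assume "C \<noteq> {e}"
    then obtain f where f: "f \<in> C" "f \<noteq> e" using C(3) by auto
    then have fX: "f \<in> X" using C(2) by auto
    obtain z where z: "z \<in> ends G f" using ends_nonempty[of f] fX XE by auto
    have "v \<in> span_verts G C" "z \<in> span_verts G C" using C(3) f z loop by (auto simp: span_verts_def)
    then have "(v, z) \<in> conn G X" using cycleD(4)[OF C(4)] conn_mono[OF C(2), of G] conn by blast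
    then show False using alone z iso[OF fX] by blast
  qed
  then show False using e(2) C(4,5) by (auto simp: ind_def)
qed

end

section \<open>Families of matchings closed under switching\<close>

definition pair_matching :: "'a set set \<Rightarrow> bool" where
  "pair_matching E \<longleftrightarrow> (\<forall>X\<in>E. card X = 2) \<and> (\<forall>X\<in>E. \<forall>Y\<in>E. X \<noteq> Y \<longrightarrow> X \<inter> Y = {})"

definition rematch :: "'a set set \<Rightarrow> 'a \<Rightarrow> 'a \<Rightarrow> 'a \<Rightarrow> 'a \<Rightarrow> 'a set set" where
  "rematch E a b c d = (E - {{a, b}, {c, d}}) \<union> {{a, c}, {b, d}}"

text \<open>The two alternatives are the two other perfect matchings of the four points.\<close>

definition movable :: "'a set set set \<Rightarrow> 'a set set \<Rightarrow> 'a \<Rightarrow> 'a \<Rightarrow> 'a \<Rightarrow> 'a \<Rightarrow> bool" where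
  "movable R E a b c d \<longleftrightarrow> rematch E a b c d \<in> R \<or> rematch E a b d c \<in> R"

lemma rematch_superset:
  "S \<subseteq> E \<Longrightarrow> {a, b} \<notin> S \<Longrightarrow> {c, d} \<notin> S \<Longrightarrow> S \<subseteq> rematch E a b c d"
  unfolding rematch_def by blast

lemma movable_swap: "movable R E c d a b = movable R E a b c d"
proof -
  have "{{c, d}, {a, b}} = {{a, b}, {c, d}}" "{{c, a}, {d, b}} = {{a, c}, {b, d}}"
    "{{c, d}, {b, a}} = {{a, b}, {d, c}}" "{{c, b}, {d, a}} = {{a, d}, {b, c}}" by blast+
  then show ?thesis unfolding movable_def rematch_def by simp
qed

lemma movable_flip: "movable R E b a c d = movable R E a b c d" "movable R E a b d c = movable R E a b c d"
  unfolding movable_def rematch_def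
  by (simp_all add: insert_commute[of b a] insert_commute[of d c] insert_commute[of "{b, c}" "{a, d}"]
      insert_commute[of "{b, d}" "{a, c}"] disj_commute)

section \<open>Elementary facts on sets of disjoint pairs\<close>

lemma pair_matching_eq:
  "pair_matching E \<Longrightarrow> X \<in> E \<Longrightarrow> Y \<in> E \<Longrightarrow> x \<in> X \<Longrightarrow> x \<in> Y \<Longrightarrow> X = Y"
  unfolding pair_matching_def by (meson disjoint_iff)

lemma pair_matching_neq: "pair_matching E \<Longrightarrow> {a, b} \<in> E \<Longrightarrow> a \<noteq> b"
  unfolding pair_matching_def by fastforce

lemma pair_matching_disjoint:
  assumes "pair_matching E" "{x, y} \<in> E" "{z, w} \<in> E" "x \<notin> {z, w}" shows "y \<notin> {z, w}"
  using pair_matching_eq[OF assms(1,2,3), of y] assms(4) by auto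

lemma pair_matching_other:
  assumes "pair_matching E" "{x, y} \<in> E" "z \<noteq> x" "z \<noteq> y"
  shows "{x, z} \<notin> E" "{z, x} \<notin> E" "{y, z} \<notin> E" "{z, y} \<notin> E"
proof -
  have "z \<notin> X" if "X \<in> E" "x \<in> X \<or> y \<in> X" for X
    using pair_matching_eq[OF assms(1) that(1) assms(2)] that assms by auto
  then show "{x, z} \<notin> E" "{z, x} \<notin> E" "{y, z} \<notin> E" "{z, y} \<notin> E" by blast+
qed

lemma pair_matching_partner:
  assumes "pair_matching E" "x \<in> \<Union>E" obtains y where "{x, y} \<in> E" "x \<noteq> y"
proof -
  obtain X where X: "X \<in> E" "x \<in> X" using assms by auto
  then have "card X = 2" using assms unfolding pair_matching_def by auto
  then obtain p q where "X = {p, q}" "p \<noteq> q" by (auto simp: card_2_iff)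
  then show ?thesis using X that by (auto simp: insert_commute)
qed

lemma card_Union_pair_matching:
  assumes "pair_matching E" "finite E" shows "card (\<Union>E) = 2 * card E"
proof -
  have "card (\<Union>E) = (\<Sum>X\<in>E. card X)"
    using assms unfolding pair_matching_def
    by (intro card_Union_disjoint) (auto simp: pairwise_def disjnt_def intro: card_ge_0_finite)
  also have "\<dots> = (\<Sum>X\<in>E. 2)" using assms unfolding pair_matching_def by (intro sum.cong) auto
  finally show ?thesis by simp
qed

text \<open>\<open>R\<close> abstracts the edge sets of the matching graphs reachable from one
  sequence. \<open>shift\<close> reflects an exchange with a basis containing a single star edge,
  \<open>switch\<close> the interplay of three bases with two star edges each.\<close>

locale matching_family =
  fixes D :: "'a set" and n :: nat and R :: "'a set set set"
  assumes finite_ground: "finite D"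
    and nonempty: "R \<noteq> {}"
    and matching: "E \<in> R \<Longrightarrow> pair_matching E"
    and ground: "E \<in> R \<Longrightarrow> \<Union>E \<subseteq> D"
    and card_eq: "E \<in> R \<Longrightarrow> card E = n"
    and shift: "E \<in> R \<Longrightarrow> {a, b} \<in> E \<Longrightarrow> c \<in> D - \<Union>E \<Longrightarrow>
        insert {a, c} (E - {{a, b}}) \<in> R \<or> insert {b, c} (E - {{a, b}}) \<in> R"
    and switch: "E \<in> R \<Longrightarrow> {a, b} \<in> E \<Longrightarrow> {c, d} \<in> E \<Longrightarrow> {e, f} \<in> E \<Longrightarrow>
        distinct [a, b, c, d, e, f] \<Longrightarrow> movable R E a b e f \<or> movable R E e f c d"
begin

lemma finite_member: "E \<in> R \<Longrightarrow> finite E"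
  using ground finite_ground by (metis finite_UnionD finite_subset)

end

text \<open>Only pairs that retain all common edges compete in \<open>maximal\<close>. Every
  contradiction below exhibits such a pair with one more common edge, and the situation is symmetric
  in the two families.\<close>

locale matching_family_pair =
  M1: matching_family D n R1 + M2: matching_family D n R2
  for D :: "'a set" and n R1 R2 +
  fixes E1 E2 :: "'a set set"
  assumes E1: "E1 \<in> R1" and E2: "E2 \<in> R2"
    and maximal: "X \<in> R1 \<Longrightarrow> Y \<in> R2 \<Longrightarrow> E1 \<inter> E2 \<subseteq> X \<Longrightarrow> E1 \<inter> E2 \<subseteq> Y \<Longrightarrow> X \<inter> Y \<subseteq> E1 \<inter> E2"
begin

lemma swapped: "matching_family_pair D n R2 R1 E2 E1"
proof unfold_locales
  show "E2 \<in> R2" "E1 \<in> R1" by (fact E2 E1)+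
  show "X \<inter> Y \<subseteq> E2 \<inter> E1" if "X \<in> R2" "Y \<in> R1" "E2 \<inter> E1 \<subseteq> X" "E2 \<inter> E1 \<subseteq> Y" for X Y
    using maximal[of Y X] that by (simp add: Int_commute)
qed

lemma no_progress:
  assumes "X \<in> R1" "Y \<in> R2" "E1 \<inter> E2 \<subseteq> X" "E1 \<inter> E2 \<subseteq> Y" "p \<in> X" "p \<in> Y" "p \<notin> E1 \<or> p \<notin> E2"
  shows False
  using maximal[of X Y] assms by blast

text \<open>The edges form an alternating path \<open>abcdef\<close>. Switching \<open>bc\<close>,
  \<open>de\<close> in \<open>E2\<close> must not create \<open>cd\<close>, so it creates
  \<open>bd\<close> and \<open>ce\<close>. Around \<open>cd\<close>, \<open>E1\<close> can be
  switched with \<open>ab\<close> or \<open>ef\<close>, which creates \<open>bd\<close>,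
  \<open>bc\<close>, \<open>ce\<close> or \<open>de\<close>; each of these lies in \<open>E2\<close>
  or in its switched version.\<close>

lemma path_six:
  assumes d: "distinct [a, b, c, d, e, f]"
    and in1: "{a, b} \<in> E1" "{c, d} \<in> E1" "{e, f} \<in> E1"
    and in2: "{b, c} \<in> E2" "{d, e} \<in> E2"
    and out: "{a, b} \<notin> E2" "{c, d} \<notin> E2" "{e, f} \<notin> E2" "{b, c} \<notin> E1" "{d, e} \<notin> E1"
    and mov: "movable R2 E2 b c d e"
  shows False
proof -
  have out_rev: "{b, a} \<notin> E2" "{d, c} \<notin> E2" "{f, e} \<notin> E2" "{c, b} \<notin> E1" "{e, d} \<notin> E1"
    using out by (simp_all add: insert_commute)
  let ?X = "rematch E2 b c d e" and ?Y = "rematch E2 b c e d"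
  have notY: "?Y \<notin> R2"
  proof
    assume "?Y \<in> R2"
    then show False
      using no_progress[OF E1, of ?Y "{c, d}"] in1 out(2,4,5)
        rematch_superset[of "E1 \<inter> E2" E2 b c e d]
      by (auto simp: rematch_def insert_commute)
  qed
  then have X: "?X \<in> R2" using mov unfolding movable_def by auto
  have keepX: "E1 \<inter> E2 \<subseteq> ?X" using out out_rev by (intro rematch_superset) auto
  have bd: "{b, d} \<notin> E1" and ce: "{c, e} \<notin> E1"
    using pair_matching_other[OF M1.matching[OF E1] in1(2), of b] pair_matching_other[OF M1.matching[OF E1] in1(2), of e] d by auto
  have "movable R1 E1 a b c d \<or> movable R1 E1 c d e f"
    using M1.switch[OF E1 in1(1) in1(3) in1(2)] d by auto
  then consider "rematch E1 a b c d \<in> R1" | "rematch E1 a b d c \<in> R1"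
    | "rematch E1 c d e f \<in> R1" | "rematch E1 c d f e \<in> R1" unfolding movable_def by auto
  then show False
  proof cases
    case 1
    show ?thesis
      by (rule no_progress[OF 1 X _ keepX, of "{b, d}"]) (use out bd out_rev in \<open>(intro rematch_superset)?, auto simp: rematch_def doubleton_eq_iff\<close>)
  next
    case 2
    show ?thesis
      by (rule no_progress[OF 2 E2, of "{b, c}"]) (use out in2 out_rev in \<open>(intro rematch_superset)?, auto simp: rematch_def doubleton_eq_iff\<close>)
  next
    case 3
    show ?thesis
      by (rule no_progress[OF 3 X _ keepX, of "{c, e}"]) (use out ce out_rev in \<open>(intro rematch_superset)?, auto simp: rematch_def doubleton_eq_iff\<close>)
  next
    case 4
    show ?thesis
      by (rule no_progress[OF 4 E2, of "{d, e}"]) (use out in2 out_rev in \<open>(intro rematch_superset)?, auto simp: rematch_def doubleton_eq_iff\<close>)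
  qed
qed

text \<open>Equal coverage makes the alternating path continue on both sides. In \<open>E2\<close>,
  the edge \<open>de\<close> can be switched with \<open>bc\<close> or with the next edge
  \<open>fg\<close>, and \<open>path_six\<close> applies to \<open>abcdef\<close> or to
  \<open>cdefgh\<close>. In a 6-cycle \<open>g\<close> and \<open>h\<close> coincide with
  \<open>a\<close> and \<open>b\<close>, so the eight points are not assumed distinct.\<close>

lemma no_long_cycle:
  assumes d: "distinct [b, c, d, e]" and in1: "{c, d} \<in> E1" and in2: "{b, c} \<in> E2" "{d, e} \<in> E2"
    and out: "{c, d} \<notin> E2"
    and cover: "\<Union>E1 = \<Union>E2"
  shows "{b, e} \<in> E1"
proof (rule ccontr)
  assume be: "{b, e} \<notin> E1"
  have cov2: "x \<in> \<Union>E2" if "{x, y} \<in> E2 \<or> {y, x} \<in> E2 \<or> {x, y} \<in> E1 \<or> {y, x} \<in> E1" for x y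
    using that cover by auto
  obtain a where a: "{b, a} \<in> E1" "b \<noteq> a"
    using pair_matching_partner[OF M1.matching[OF E1], of b] cov2[of b c] in2 cover by auto
  obtain f where f: "{e, f} \<in> E1" "e \<noteq> f"
    using pair_matching_partner[OF M1.matching[OF E1], of e] cov2[of e d] in2 cover by auto
  note u1 = pair_matching_disjoint[OF M1.matching[OF E1]] and u2 = pair_matching_disjoint[OF M2.matching[OF E2]]
  have bc: "{b, c} \<notin> E1" and de: "{d, e} \<notin> E1"
    using u1[OF _ in1, of e d] u1[OF _ in1, of b c] d by (auto simp: insert_commute)
  have bf: "b \<noteq> f" using be f by (auto simp: insert_commute)
  have ad: "a \<notin> {c, d}" "f \<notin> {c, d}" using u1[OF a(1) in1] u1[OF f(1) in1] d by auto
  have af: "a \<notin> {e, f}" using u1[OF a(1) f(1)] bf d by auto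
  have abcdef: "distinct [a, b, c, d, e, f]" using d a(2) f(2) bf ad af by auto
  obtain g where g: "{f, g} \<in> E2" "f \<noteq> g"
    using pair_matching_partner[OF M2.matching[OF E2], of f] cov2[of f e] f by auto
  have ab2: "{a, b} \<notin> E2" and ef2: "{e, f} \<notin> E2"
    using u2[OF _ in2(1), of a b] u2[OF _ in2(2), of f e] abcdef by (auto simp: insert_commute)
  have gnot: "g \<notin> {b, c, d, e, f}"
    using u2[OF g(1) in2(1)] u2[OF g(1) in2(2)] abcdef g(2) by auto
  obtain h where h: "{g, h} \<in> E1" "g \<noteq> h"
    using pair_matching_partner[OF M1.matching[OF E1], of g] cov2[of g f] g cover by (auto simp: insert_commute)
  have "h \<notin> {c, d}" "h \<notin> {e, f}" using u1[OF h(1) in1] u1[OF h(1) f(1)] gnot by auto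
  then have cdefgh: "distinct [c, d, e, f, g, h]" using abcdef gnot h(2) by auto
  have "{f, g} \<notin> E1" using u1[OF _ f(1), of g f] gnot by (auto simp: insert_commute)
  moreover have "{g, h} \<notin> E2" using u2[OF _ g(1), of h g] cdefgh by (auto simp: insert_commute)
  ultimately have fg1: "{f, g} \<notin> E1" and gh2: "{g, h} \<notin> E2" by auto
  have "movable R2 E2 b c d e \<or> movable R2 E2 d e f g"
    using M2.switch[OF E2 in2(1) _ in2(2), of f g] g abcdef gnot by auto
  then show False
  proof
    assume "movable R2 E2 b c d e"
    then show False using path_six[OF abcdef] a f in1 in2 out bc de ab2 ef2 by (auto simp: insert_commute)
  next
    assume "movable R2 E2 d e f g"
    then show False using path_six[OF cdefgh] f in1 in2 out de ef2 g h fg1 gh2 by (auto simp: insert_commute)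
  qed
qed

text \<open>If the \<open>E2\<close> side could move, it would yield \<open>bd\<close> and
  \<open>ac\<close>, since \<open>ab\<close> must not become common. On the \<open>E1\<close> side
  \<open>ab\<close> cannot move with \<open>cd\<close>, so it moves with \<open>ef\<close>. A second
  switch there, around \<open>cd\<close>, creates \<open>ac\<close>, \<open>ad\<close>,
  \<open>bc\<close> or \<open>bd\<close>, and each of these is available in \<open>E2\<close> or in
  its switched version.\<close>

lemma square_stuck_movable:
  assumes d: "distinct [a, b, c, d, e, f]"
    and in1: "{a, b} \<in> E1" "{c, d} \<in> E1" "{e, f} \<in> E1"
    and in2: "{b, c} \<in> E2" "{d, a} \<in> E2"
    and out: "{a, b} \<notin> E2" "{c, d} \<notin> E2" "{e, f} \<notin> E2" "{b, c} \<notin> E1" "{d, a} \<notin> E1"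
    and stuck: "\<not> movable R1 E1 a b c d"
  shows "\<not> movable R2 E2 b c d a"
proof
  have out_rev: "{b, a} \<notin> E2" "{d, c} \<notin> E2" "{f, e} \<notin> E2" "{c, b} \<notin> E1" "{a, d} \<notin> E1"
    using out by (simp_all add: insert_commute)
  assume mov: "movable R2 E2 b c d a"
  let ?Y = "rematch E2 b c d a"
  have "rematch E2 b c a d \<notin> R2"
  proof
    assume "rematch E2 b c a d \<in> R2"
    from no_progress[OF E1 this, of "{a, b}"] in1 out
    show False by (auto simp: rematch_def insert_commute)
  qed
  then have Y: "?Y \<in> R2" using mov unfolding movable_def by auto
  have keepY: "E1 \<inter> E2 \<subseteq> ?Y" using out out_rev by (intro rematch_superset) auto
  have ac: "{a, c} \<notin> E1" and bd: "{b, d} \<notin> E1"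
    using pair_matching_other[OF M1.matching[OF E1] in1(1), of c] pair_matching_other[OF M1.matching[OF E1] in1(1), of d] d by auto
  have aux: False if X: "rematch E1 a b e f \<in> R1"
    and d: "distinct [a, b, c, d, e, f]" and ef: "{e, f} \<in> E1" "{e, f} \<notin> E2" for e f
  proof -
    let ?X = "rematch E1 a b e f"
    have "{c, d} \<in> ?X" using in1 d by (auto simp: rematch_def doubleton_eq_iff)
    moreover have "{a, e} \<in> ?X" "{b, f} \<in> ?X" by (auto simp: rematch_def)
    moreover have keep: "E1 \<inter> E2 \<subseteq> ?X" using out out_rev ef by (intro rematch_superset) auto
    ultimately have "movable R1 ?X a e c d \<or> movable R1 ?X c d b f"
      using M1.switch[OF X, of a e b f c d] d by auto
    then consider "rematch ?X a e c d \<in> R1" | "rematch ?X a e d c \<in> R1"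
      | "rematch ?X c d b f \<in> R1" | "rematch ?X c d f b \<in> R1" unfolding movable_def by auto
    moreover have ae: "{a, e} \<notin> E1" and bf: "{b, f} \<notin> E1" "{f, b} \<notin> E1"
      using pair_matching_other[OF M1.matching[OF E1] in1(1), of e] pair_matching_other[OF M1.matching[OF E1] in1(1), of f] d by auto
    ultimately show False
    proof cases
      case 1
      show ?thesis
        by (rule no_progress[OF 1 Y _ keepY, of "{a, c}"])
          (use ef keep out ac ae out_rev in \<open>(intro rematch_superset)?, auto simp: rematch_def doubleton_eq_iff\<close>)
    next
      case 2
      show ?thesis
        by (rule no_progress[OF 2 E2, of "{d, a}"])
          (use ef keep out ae in2 out_rev in \<open>(intro rematch_superset)?, auto simp: rematch_def doubleton_eq_iff\<close>)
    next
      case 3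
      show ?thesis
        by (rule no_progress[OF 3 E2, of "{b, c}"])
          (use ef keep out bf in2 out_rev in \<open>(intro rematch_superset)?, auto simp: rematch_def doubleton_eq_iff\<close>)
    next
      case 4
      show ?thesis
        by (rule no_progress[OF 4 Y _ keepY, of "{b, d}"])
          (use ef keep out bd bf out_rev in \<open>(intro rematch_superset)?, auto simp: rematch_def doubleton_eq_iff\<close>)
    qed
  qed
  have "movable R1 E1 c d a b \<or> movable R1 E1 a b e f"
    using M1.switch[OF E1, of c d e f a b] in1 d by auto
  moreover have "\<not> movable R1 E1 c d a b"
    using stuck by (simp add: movable_swap)
  ultimately have "rematch E1 a b e f \<in> R1 \<or> rematch E1 a b f e \<in> R1" unfolding movable_def by auto
  then show False
  proof
    assume "rematch E1 a b e f \<in> R1"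
    then show False using aux[of e f] d in1 out by auto
  next
    assume "rematch E1 a b f e \<in> R1"
    moreover have "distinct [a, b, c, d, f, e]" using d by auto
    moreover have "{f, e} \<in> E1" "{f, e} \<notin> E2" using in1 out by (simp_all add: insert_commute)
    ultimately show False by (rule aux)
  qed
qed

text \<open>If both sides could move, either one alone recreates an edge of the other matching or
  both obtain \<open>ac\<close>. So one side is stuck, and \<open>square_stuck_movable\<close>, used
  from both sides, makes the other side stuck too. The edge \<open>fg\<close> is the third edge
  needed when the roles are exchanged.\<close>

lemma square_not_movable:
  assumes d: "distinct [a, b, c, d, e, f]"
    and in1: "{a, b} \<in> E1" "{c, d} \<in> E1" "{e, f} \<in> E1"
    and in2: "{b, c} \<in> E2" "{d, a} \<in> E2"
    and out: "{a, b} \<notin> E2" "{c, d} \<notin> E2" "{e, f} \<notin> E2" "{b, c} \<notin> E1" "{d, a} \<notin> E1"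
    and fg: "{f, g} \<in> E2" "{f, g} \<notin> E1" "g \<notin> {a, b, c, d, f}"
  shows "\<not> movable R1 E1 a b c d" and "\<not> movable R2 E2 b c d a"
proof -
  have out_rev: "{b, a} \<notin> E2" "{d, c} \<notin> E2" "{f, e} \<notin> E2" "{c, b} \<notin> E1" "{a, d} \<notin> E1"
    using out by (simp_all add: insert_commute)
  interpret S: matching_family_pair D n R2 R1 E2 E1 by (rule swapped)
  have ac: "{a, c} \<notin> E1" and bd: "{b, d} \<notin> E1"
    using pair_matching_other[OF M1.matching[OF E1] in1(1), of c] pair_matching_other[OF M1.matching[OF E1] in1(1), of d] d by auto
  have "\<not> (movable R1 E1 a b c d \<and> movable R2 E2 b c d a)"
  proof
    assume "movable R1 E1 a b c d \<and> movable R2 E2 b c d a"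
    then consider "rematch E1 a b d c \<in> R1" | "rematch E2 b c a d \<in> R2"
      | "rematch E1 a b c d \<in> R1" "rematch E2 b c d a \<in> R2" unfolding movable_def by auto
    then show False
    proof cases
      case 1
      show ?thesis
        by (rule no_progress[OF 1 E2, of "{b, c}"])
          (use out in2 out_rev in \<open>(intro rematch_superset)?, auto simp: rematch_def doubleton_eq_iff\<close>)
    next
      case 2
      show ?thesis
        by (rule no_progress[OF E1 2, of "{a, b}"])
          (use out in1 out_rev in \<open>(intro rematch_superset)?, auto simp: rematch_def doubleton_eq_iff\<close>)
    next
      case 3
      show ?thesis
        by (rule no_progress[OF 3, of "{a, c}"])
          (use out ac out_rev in \<open>(intro rematch_superset)?, auto simp: rematch_def doubleton_eq_iff\<close>)
    qed
  qed
  moreover have "movable R1 E1 a b c d \<or> \<not> movable R2 E2 b c d a"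
    using square_stuck_movable[OF d in1 in2 out] by auto
  moreover have "movable R2 E2 b c d a \<or> \<not> movable R1 E1 c d a b"
    using S.square_stuck_movable[of b c d a f g] d in1 in2 out fg by auto
  moreover have "movable R1 E1 c d a b = movable R1 E1 a b c d"
    by (rule movable_swap)
  ultimately show "\<not> movable R1 E1 a b c d" "\<not> movable R2 E2 b c d a" by auto
qed

text \<open>After \<open>ae\<close>, \<open>bf\<close> have replaced \<open>ab\<close>,
  \<open>ef\<close>, a switch around \<open>cd\<close> either creates \<open>da\<close> or
  \<open>bc\<close> at once, or creates \<open>de\<close> or \<open>cf\<close>. In the latter cases
  the stuck edges \<open>bc\<close>, \<open>da\<close> of \<open>E2\<close> force \<open>da\<close>
  to switch with \<open>he\<close>, or \<open>bc\<close> with \<open>fg\<close>. Each outcome meets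
  the first or the second switched version of \<open>E1\<close>.\<close>

lemma two_squares_aux:
  assumes d: "distinct [a, b, c, d, e, f, g, h]"
    and in1: "{a, b} \<in> E1" "{c, d} \<in> E1" "{e, f} \<in> E1"
    and in2: "{b, c} \<in> E2" "{d, a} \<in> E2" "{f, g} \<in> E2" "{h, e} \<in> E2"
    and out: "{a, b} \<notin> E2" "{c, d} \<notin> E2" "{e, f} \<notin> E2"
      "{b, c} \<notin> E1" "{d, a} \<notin> E1" "{f, g} \<notin> E1" "{h, e} \<notin> E1"
    and X: "rematch E1 a b e f \<in> R1"
  shows False
proof -
  have out_rev: "{b, a} \<notin> E2" "{d, c} \<notin> E2" "{f, e} \<notin> E2" "{c, b} \<notin> E1" "{a, d} \<notin> E1" "{g, f} \<notin> E1" "{e, h} \<notin> E1"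
    using out by (simp_all add: insert_commute)
  let ?X = "rematch E1 a b e f"
  have stuck: "\<not> movable R2 E2 b c d a"
    using square_not_movable(2)[of a b c d e f g] d in1 in2 out by auto
  have keep: "E1 \<inter> E2 \<subseteq> ?X" using out out_rev by (intro rematch_superset) auto
  have new: "{a, e} \<notin> E1" "{b, f} \<notin> E1" "{d, e} \<notin> E1" "{c, f} \<notin> E1"
    "{e, a} \<notin> E1" "{f, b} \<notin> E1" "{e, d} \<notin> E1" "{f, c} \<notin> E1"
    using pair_matching_other[OF M1.matching[OF E1] in1(1), of e] pair_matching_other[OF M1.matching[OF E1] in1(1), of f]
      pair_matching_other[OF M1.matching[OF E1] in1(2), of e] pair_matching_other[OF M1.matching[OF E1] in1(2), of f] d by auto
  have X3: "{a, e} \<in> ?X" "{b, f} \<in> ?X" "{c, d} \<in> ?X"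
    using in1 d by (auto simp: rematch_def doubleton_eq_iff)
  have st: "\<not> movable R2 E2 d a b c"
    using stuck by (simp add: movable_swap)
  have "movable R1 ?X a e c d \<or> movable R1 ?X c d b f"
    using M1.switch[OF X, of a e b f c d] X3 d by auto
  then consider "rematch ?X a e c d \<in> R1" | "rematch ?X a e d c \<in> R1"
      | "rematch ?X c d b f \<in> R1" | "rematch ?X c d f b \<in> R1" unfolding movable_def by auto
  then show False
  proof cases
    case 1
    have keep1: "E1 \<inter> E2 \<subseteq> rematch ?X a e c d" using keep out out_rev new by (intro rematch_superset) auto
    have "movable R2 E2 d a h e"
      using M2.switch[OF E2, of b c h e d a] in2 d st stuck insert_commute[of h e "{}"] by auto
    then consider "rematch E2 d a h e \<in> R2" | "rematch E2 d a e h \<in> R2" unfolding movable_def by auto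
    then show False
    proof cases
      case y: 1
      show ?thesis by (rule no_progress[OF X y keep, of "{a, e}"])
          (use out new out_rev in \<open>(intro rematch_superset)?, auto simp: rematch_def doubleton_eq_iff\<close>)
    next
      case y: 2
      show ?thesis by (rule no_progress[OF 1 y keep1, of "{d, e}"])
          (use out new out_rev in \<open>(intro rematch_superset)?, auto simp: rematch_def doubleton_eq_iff\<close>)
    qed
  next
    case 2
    show ?thesis
      by (rule no_progress[OF 2 E2, of "{d, a}"])
        (use keep out new in2 out_rev in \<open>(intro rematch_superset)?, auto simp: rematch_def doubleton_eq_iff\<close>)
  next
    case 3
    show ?thesis
      by (rule no_progress[OF 3 E2, of "{b, c}"])
        (use keep out new in2 out_rev in \<open>(intro rematch_superset)?, auto simp: rematch_def doubleton_eq_iff\<close>)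
  next
    case 4
    have keep1: "E1 \<inter> E2 \<subseteq> rematch ?X c d f b"
      by (rule rematch_superset[OF keep]) (use out new in \<open>auto simp: insert_commute\<close>)
    have "movable R2 E2 b c f g"
      using M2.switch[OF E2, of d a f g b c] in2 d st stuck by auto
    then consider "rematch E2 b c f g \<in> R2" | "rematch E2 b c g f \<in> R2" unfolding movable_def by auto
    then show False
    proof cases
      case y: 1
      show ?thesis by (rule no_progress[OF X y keep, of "{b, f}"])
          (use out new out_rev in \<open>(intro rematch_superset)?, auto simp: rematch_def doubleton_eq_iff\<close>)
    next
      case y: 2
      show ?thesis by (rule no_progress[OF 4 y keep1, of "{c, f}"])
          (use out new out_rev in \<open>(intro rematch_superset)?, auto simp: rematch_def doubleton_eq_iff\<close>)
    qed
  qed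
qed

text \<open>The first square is stuck, so around \<open>ab\<close> the matching \<open>E1\<close>
  must switch \<open>ab\<close> with \<open>ef\<close>. Its two outcomes differ by a reflection of
  the second square.\<close>

lemma no_two_squares:
  assumes d: "distinct [a, b, c, d, e, f, g, h]"
    and in1: "{a, b} \<in> E1" "{c, d} \<in> E1" "{e, f} \<in> E1" "{g, h} \<in> E1"
    and in2: "{b, c} \<in> E2" "{d, a} \<in> E2" "{f, g} \<in> E2" "{h, e} \<in> E2"
  shows False
proof -
  have out: "{a, b} \<notin> E2" "{c, d} \<notin> E2" "{e, f} \<notin> E2"
      "{b, c} \<notin> E1" "{d, a} \<notin> E1" "{f, g} \<notin> E1" "{h, e} \<notin> E1"
    using d pair_matching_disjoint[OF M2.matching[OF E2] _ in2(1), of a b]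
      pair_matching_disjoint[OF M2.matching[OF E2] _ in2(1), of d c]
      pair_matching_disjoint[OF M2.matching[OF E2] _ in2(3), of e f]
      pair_matching_disjoint[OF M1.matching[OF E1] _ in1(1), of c b]
      pair_matching_disjoint[OF M1.matching[OF E1] _ in1(1), of d a]
      pair_matching_disjoint[OF M1.matching[OF E1] _ in1(3), of g f]
      pair_matching_disjoint[OF M1.matching[OF E1] _ in1(3), of h e] by (auto simp: insert_commute)
  have "\<not> movable R1 E1 a b c d"
    using square_not_movable(1)[of a b c d e f g] d in1 in2 out by auto
  moreover have "movable R1 E1 c d a b = movable R1 E1 a b c d"
    by (rule movable_swap)
  ultimately have "movable R1 E1 a b e f"
    using M1.switch[OF E1, of c d e f a b] in1 d by auto
  then consider "rematch E1 a b e f \<in> R1" | "rematch E1 a b f e \<in> R1" unfolding movable_def by auto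
  then show False
  proof cases
    case 1
    then show False using two_squares_aux[of a b c d e f g h] d in1 in2 out by auto
  next
    case 2
    then show False using two_squares_aux[of a b c d f e h g] d in1 in2 out
      insert_commute[of f e "{}"] insert_commute[of g h "{}"] insert_commute[of h e "{}"] insert_commute[of f g "{}"]
      by auto
  qed
qed

text \<open>Since the covers agree, each edge of \<open>E1 - E2\<close> continues at both ends in
  \<open>E2\<close>. \<open>no_long_cycle\<close> closes this path to a square, and
  \<open>no_two_squares\<close> admits only one.\<close>

lemma single_square:
  assumes cover: "\<Union>E1 = \<Union>E2" and neq: "E1 \<noteq> E2"
  obtains a b c d where "distinct [a, b, c, d]" "E1 - E2 = {{a, b}, {c, d}}" "E2 - E1 = {{b, c}, {d, a}}"
proof -
  have square: "\<exists>a b. distinct [a, b, c, d] \<and> {a, b} \<in> E1 \<and> {b, c} \<in> E2 \<and> {d, a} \<in> E2"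
    if cd: "{c, d} \<in> E1" "{c, d} \<notin> E2" for c d
  proof -
    have "c \<in> \<Union>E2" "d \<in> \<Union>E2" using cd cover by auto
    then obtain b e where be: "{c, b} \<in> E2" "c \<noteq> b" "{d, e} \<in> E2" "d \<noteq> e"
      using pair_matching_partner[OF M2.matching[OF E2]] by metis
    have "distinct [b, c, d, e]"
      using be cd insert_commute[of c d "{}"]
        pair_matching_neq[OF M1.matching[OF E1] cd(1)] pair_matching_other(3,4)[OF M2.matching[OF E2] be(3), of c]
        pair_matching_disjoint[OF M2.matching[OF E2] be(1) be(3)] by auto
    moreover from this have "{b, e} \<in> E1"
      using no_long_cycle[of b c d e] be cd cover insert_commute[of b c "{}"] by auto
    ultimately have "distinct [e, b, c, d]" "{e, b} \<in> E1" "{b, c} \<in> E2" "{d, e} \<in> E2"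
      using be by (auto simp: insert_commute)
    then show ?thesis by blast
  qed
  have fin: "finite E1" "finite E2" using E1 E2 M1.finite_member M2.finite_member by auto
  have cardeq: "card E1 = card E2" using E1 E2 M1.card_eq M2.card_eq by simp
  then have "E1 - E2 \<noteq> {}" using neq fin card_subset_eq[of E2 E1] by auto
  then obtain X where X: "X \<in> E1" "X \<notin> E2" by auto
  have doub: "\<exists>c d. Y = {c, d}" if "Y \<in> E1" for Y
    using M1.matching[OF E1] that unfolding pair_matching_def card_2_iff by meson
  obtain c d where cd: "X = {c, d}" using doub[OF X(1)] by auto
  obtain a b where sq: "distinct [a, b, c, d]" "{a, b} \<in> E1" "{b, c} \<in> E2" "{d, a} \<in> E2"
    using square X cd by metis
  have ab2: "{a, b} \<notin> E2" using sq pair_matching_other(1)[OF M2.matching[OF E2] sq(4), of b]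
      pair_matching_other(3)[OF M2.matching[OF E2] sq(4), of b] by auto
  have new2: "{b, c} \<notin> E1" "{d, a} \<notin> E1"
    using sq(1) pair_matching_other[OF M1.matching[OF E1] sq(2), of c]
      pair_matching_other[OF M1.matching[OF E1] sq(2), of d] by auto
  have "Y \<in> {{a, b}, {c, d}}" if Y: "Y \<in> E1 - E2" for Y
  proof (rule ccontr)
    assume n: "Y \<notin> {{a, b}, {c, d}}"
    obtain g h where gh: "Y = {g, h}" using doub[of Y] Y by auto
    obtain e f where ef: "distinct [e, f, g, h]" "{e, f} \<in> E1" "{f, g} \<in> E2" "{h, e} \<in> E2"
      using square[of g h] Y gh by auto
    have "Y \<inter> {a, b} = {}" "Y \<inter> {c, d} = {}"
      using pair_matching_eq[OF M1.matching[OF E1], of Y] Y n sq(2) X(1) cd by blast+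
    then have gh': "g \<notin> {a, b, c, d}" "h \<notin> {a, b, c, d}" using gh by auto
    have "f \<notin> {a, b, c, d}" "e \<notin> {a, b, c, d}"
    proof -
      have *: "x \<notin> {a, b, c, d} \<longleftrightarrow> y \<notin> {a, b, c, d}" if "{x, y} \<in> E2" for x y
      proof -
        have "{x, y} = {b, c} \<or> {x, y} \<inter> {b, c} = {}" "{x, y} = {d, a} \<or> {x, y} \<inter> {d, a} = {}"
          using pair_matching_eq[OF M2.matching[OF E2] that] sq(3,4) by blast+
        then show ?thesis by blast
      qed
      show "f \<notin> {a, b, c, d}" "e \<notin> {a, b, c, d}" using *[of f g] *[of h e] ef gh' by auto
    qed
    then have "distinct [a, b, c, d, e, f, g, h]" using gh' sq(1) ef(1) by auto
    then show False using no_two_squares[of a b c d e f g h] sq ef X cd Y gh by auto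
  qed
  then have D1: "E1 - E2 = {{a, b}, {c, d}}" using sq X cd ab2 by auto
  have "card (E1 - E2) = card (E2 - E1)"
    using cardeq fin by (metis Int_commute card_Diff_subset_Int finite_Int)
  moreover have "card {{a, b}, {c, d}} = 2" "card {{b, c}, {d, a}} = 2"
    using sq(1) by (auto simp: doubleton_eq_iff)
  moreover have "{{b, c}, {d, a}} \<subseteq> E2 - E1" using sq new2 by auto
  ultimately have "E2 - E1 = {{b, c}, {d, a}}"
    using D1 fin by (metis card_subset_eq finite_Diff)
  then show thesis using that[OF sq(1)] D1 by auto
qed

end

section \<open>Choosing a closest pair of matchings\<close>

lemma matching_families_close:
  assumes "matching_family D n R1" and "matching_family D n R2"
  obtains E1 E2 where "E1 \<in> R1" "E2 \<in> R2" "E1 = E2 \<or> (\<exists>a b c d. distinct [a, b, c, d] \<and>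
      E1 - E2 = {{a, b}, {c, d}} \<and> E2 - E1 = {{b, c}, {d, a}})"
proof -
  interpret M1: matching_family D n R1 by fact
  interpret M2: matching_family D n R2 by fact
  \<comment> \<open>The second summand is at most \<open>card D\<close>, so the factor
    \<open>card D + 1\<close> makes the comparison lexicographic.\<close>
  define \<mu> where "\<mu> = (\<lambda>(E1, E2). card (E1 \<inter> E2) * (card D + 1) + card (D - \<Union>E1 - \<Union>E2))"
  let ?P = "\<lambda>p. p \<in> R1 \<times> R2"
  obtain p0 where p0: "?P p0" using M1.nonempty M2.nonempty by auto
  have bound: "\<mu> p \<le> n * (card D + 1) + card D" if p: "?P p" for p
  proof -
    obtain X Y where XY: "p = (X, Y)" "X \<in> R1" "Y \<in> R2" using p by auto
    have "card (X \<inter> Y) \<le> n"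
      using XY M1.finite_member[of X] M1.card_eq[of X] card_mono[of X "X \<inter> Y"] by auto
    then have "card (X \<inter> Y) * (card D + 1) \<le> n * (card D + 1)" by (rule mult_le_mono1)
    moreover have "card (D - \<Union>X - \<Union>Y) \<le> card D" by (rule card_mono) (use M1.finite_ground in auto)
    ultimately show ?thesis unfolding \<mu>_def XY prod.case by linarith
  qed
  obtain E1 E2 where E: "E1 \<in> R1" "E2 \<in> R2"
    and best: "\<And>X Y. X \<in> R1 \<Longrightarrow> Y \<in> R2 \<Longrightarrow> \<mu> (X, Y) \<le> \<mu> (E1, E2)"
    using Lattices_Big.ex_has_greatest_nat[of ?P p0 \<mu> "Suc (n * (card D + 1) + card D)"] p0 bound
    by (auto simp: less_Suc_eq_le)
  have fin: "finite (E1 \<inter> E2)" "finite E1" "finite E2" using E M1.finite_member M2.finite_member by auto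
  have max1: "X \<inter> Y = E1 \<inter> E2"
    if XY: "X \<in> R1" "Y \<in> R2" "E1 \<inter> E2 \<subseteq> X \<inter> Y" for X Y
  proof (rule ccontr)
    assume ne: "X \<inter> Y \<noteq> E1 \<inter> E2"
    have "finite (X \<inter> Y)" using XY M1.finite_member by auto
    then have "card (E1 \<inter> E2) < card (X \<inter> Y)" using XY ne by (intro psubset_card_mono) auto
    then have "Suc (card (E1 \<inter> E2)) * (card D + 1) \<le> card (X \<inter> Y) * (card D + 1)"
      by (intro mult_le_mono1) simp
    moreover have "card (D - \<Union>E1 - \<Union>E2) \<le> card D" by (rule card_mono) (use M1.finite_ground in auto)
    ultimately have "\<mu> (E1, E2) < \<mu> (X, Y)" unfolding \<mu>_def by simp
    then show False using best[OF XY(1,2)] by simp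
  qed
  have max2: "\<not> (D - \<Union>E1 - \<Union>E2 \<subset> D - \<Union>X - \<Union>Y)"
    if XY: "X \<in> R1" "Y \<in> R2" "E1 \<inter> E2 \<subseteq> X \<inter> Y" for X Y
  proof
    assume "D - \<Union>E1 - \<Union>E2 \<subset> D - \<Union>X - \<Union>Y"
    then have "card (D - \<Union>E1 - \<Union>E2) < card (D - \<Union>X - \<Union>Y)"
      using M1.finite_ground by (intro psubset_card_mono) auto
    then have "\<mu> (E1, E2) < \<mu> (X, Y)" using max1[OF XY] unfolding \<mu>_def by simp
    then show False using best[OF XY(1,2)] by simp
  qed
  interpret P: matching_family_pair D n R1 R2 E1 E2
  proof unfold_locales
    show "E1 \<in> R1" "E2 \<in> R2" by fact+
    show "X \<inter> Y \<subseteq> E1 \<inter> E2" if "X \<in> R1" "Y \<in> R2" "E1 \<inter> E2 \<subseteq> X" "E1 \<inter> E2 \<subseteq> Y" for X Y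
      using max1[of X Y] that by auto
  qed
  note mat1 = M1.matching[OF E(1)] and mat2 = M2.matching[OF E(2)]
  \<comment> \<open>Equal sizes yield a point \<open>c\<close> covered only by \<open>E2\<close> and
    a point \<open>w\<close> covered only by \<open>E1\<close>. Shifting the edge
    \<open>{w, w'}\<close> to \<open>c\<close> must keep \<open>w\<close>, since otherwise
    \<open>w\<close> would become uncovered in both. Likewise \<open>{c, c'}\<close> shifts to
    \<open>{c, w}\<close>, which gives a new common edge.\<close>
  have cover: "\<Union>E1 = \<Union>E2"
  proof (rule ccontr)
    assume ne: "\<Union>E1 \<noteq> \<Union>E2"
    have finU: "finite (\<Union>E1)" "finite (\<Union>E2)"
      using E M1.ground M2.ground M1.finite_ground by (meson finite_subset)+
    have "card (\<Union>E1) = card (\<Union>E2)"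
      using card_Union_pair_matching[OF mat1] card_Union_pair_matching[OF mat2] fin E M1.card_eq M2.card_eq
      by simp
    then have "\<not> \<Union>E1 \<subseteq> \<Union>E2" "\<not> \<Union>E2 \<subseteq> \<Union>E1" using ne finU card_subset_eq by metis+
    then obtain c w where c: "c \<in> \<Union>E2" "c \<notin> \<Union>E1" and w: "w \<in> \<Union>E1" "w \<notin> \<Union>E2" by blast
    have cD: "c \<in> D" and wD: "w \<in> D" using c w M1.ground[OF E(1)] M2.ground[OF E(2)] by blast+
    obtain c' where c': "{c, c'} \<in> E2" "c \<noteq> c'" using pair_matching_partner[OF mat2 c(1)] by auto
    obtain w' where w': "{w, w'} \<in> E1" "w \<noteq> w'" using pair_matching_partner[OF mat1 w(1)] by auto
    let ?X = "insert {w', c} (E1 - {{w, w'}})" and ?Y = "insert {c', w} (E2 - {{c, c'}})"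
    have "?X \<notin> R1"
    proof
      assume X: "?X \<in> R1"
      have "E1 \<inter> E2 \<subseteq> ?X \<inter> E2" using w by auto
      moreover have "w \<notin> Z" if "Z \<in> E1" "Z \<noteq> {w, w'}" for Z
        using pair_matching_eq[OF mat1 that(1) w'(1), of w] that(2) by blast
      then have "w \<notin> \<Union>?X" using w' c w by blast
      moreover have "D - \<Union>E1 - \<Union>E2 \<subseteq> D - \<Union>?X - \<Union>E2" using c w' by auto
      ultimately show False using max2[OF X E(2)] wD w by blast
    qed
    then have X: "insert {w, c} (E1 - {{w, w'}}) \<in> R1"
      using M1.shift[OF E(1) w'(1), of c] c cD by auto
    have "?Y \<notin> R2"
    proof
      assume Y: "?Y \<in> R2"
      have "E1 \<inter> E2 \<subseteq> E1 \<inter> ?Y" using c by auto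
      moreover have "c \<notin> Z" if "Z \<in> E2" "Z \<noteq> {c, c'}" for Z
        using pair_matching_eq[OF mat2 that(1) c'(1), of c] that(2) by blast
      then have "c \<notin> \<Union>?Y" using c' c w by blast
      moreover have "D - \<Union>E1 - \<Union>E2 \<subseteq> D - \<Union>E1 - \<Union>?Y" using w c' by auto
      ultimately show False using max2[OF E(1) Y] cD c by blast
    qed
    then have Y: "insert {c, w} (E2 - {{c, c'}}) \<in> R2"
      using M2.shift[OF E(2) c'(1), of w] w wD by auto
    show False
      by (rule P.no_progress[OF X Y, of "{c, w}"]) (use c w in \<open>auto simp: insert_commute\<close>)
  qed
  show thesis
  proof (cases "E1 = E2")
    case True
    then show thesis using that E by blast
  next
    case False
    then show thesis using P.single_square[OF cover] that[OF E] by metis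
  qed
qed

section \<open>Matching graphs of sequences of bases\<close>

locale frame_star =
  fixes G :: "('v, 'e) mgraph" and \<C> :: "'e set set" and v :: 'v
  assumes star: "matroid_star (edges G) (frame_indep G \<C>) (incident_edges G v)"

sublocale frame_star \<subseteq> matroid_star "edges G" "frame_indep G \<C>" "incident_edges G v"
  by (rule star)

context frame_star
begin

abbreviation D :: "'e set" where "D \<equiv> incident_edges G v"

abbreviation star_pairs :: "'e set list \<Rightarrow> 'e set set" where
  "star_pairs Bs \<equiv> edges (matching_graph G v Bs)"

lemma basis_eq: "frame_basis G \<C> = basis"
  by (rule ext) (simp add: frame_basis_def basis_def)

lemma star_pairs_iff: "Z \<in> star_pairs Bs \<longleftrightarrow> (\<exists>l<length Bs. Z = Bs ! l \<inter> D \<and> card Z = 2)"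
  by (auto simp: matching_graph_def in_set_conv_nth)

lemma v_reduced_iff: "v_reduced G v Bs \<longleftrightarrow> (\<forall>l<length Bs. card (Bs ! l \<inter> D) \<le> 2)"
  unfolding v_reduced_def by (metis in_set_conv_nth)

section \<open>Sequences of bases and updates of two members\<close>

lemma base_seqD:
  assumes "base_seq G \<C> k Bs"
  shows "length Bs = k" "\<And>i. i < k \<Longrightarrow> basis (Bs ! i)"
    "\<And>i j. i < k \<Longrightarrow> j < k \<Longrightarrow> i \<noteq> j \<Longrightarrow> Bs ! i \<inter> Bs ! j = {}" "(\<Union>i<k. Bs ! i) = edges G"
proof -
  show len: "length Bs = k" using assms by (simp add: base_seq_def)
  show "\<And>i. i < k \<Longrightarrow> basis (Bs ! i)" using assms len by (simp add: base_seq_def basis_eq)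
  show "\<And>i j. i < k \<Longrightarrow> j < k \<Longrightarrow> i \<noteq> j \<Longrightarrow> Bs ! i \<inter> Bs ! j = {}"
    using assms by (simp add: base_seq_def)
  have "\<Union>(set Bs) = (\<Union>i<k. Bs ! i)" using len by (auto simp: set_conv_nth)
  then show "(\<Union>i<k. Bs ! i) = edges G" using assms by (simp add: base_seq_def)
qed

lemma base_seqI:
  assumes "length Bs = k" "\<And>i. i < k \<Longrightarrow> basis (Bs ! i)"
    "\<And>i j. i < k \<Longrightarrow> j < k \<Longrightarrow> i \<noteq> j \<Longrightarrow> Bs ! i \<inter> Bs ! j = {}" "(\<Union>i<k. Bs ! i) = edges G"
  shows "base_seq G \<C> k Bs"
proof -
  have "\<Union>(set Bs) = (\<Union>i<k. Bs ! i)" using assms(1) by (auto simp: set_conv_nth)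
  moreover have "\<forall>B\<in>set Bs. frame_basis G \<C> B"
    using assms(1,2) by (metis basis_eq in_set_conv_nth)
  ultimately show ?thesis using assms by (simp add: base_seq_def)
qed

lemma base_seq_update:
  assumes Bs: "base_seq G \<C> k Bs" and ij: "i < k" "j < k" "i \<noteq> j" and X: "basis X" "basis Y"
    and XY: "X \<inter> Y = {}" "X \<union> Y = Bs ! i \<union> Bs ! j"
  shows "base_seq G \<C> k (Bs[i := X, j := Y])"
proof -
  let ?Cs = "Bs[i := X, j := Y]"
  note b = base_seqD[OF Bs]
  have nth: "?Cs ! l = (if l = j then Y else if l = i then X else Bs ! l)" if "l < k" for l
    using that ij b(1) by auto
  have rest: "Bs ! l \<inter> X = {}" "Bs ! l \<inter> Y = {}" if "l < k" "l \<noteq> i" "l \<noteq> j" for l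
  proof -
    have "Bs ! l \<inter> (X \<union> Y) = {}" using b(3)[of l i] b(3)[of l j] ij that XY(2) by blast
    then show "Bs ! l \<inter> X = {}" "Bs ! l \<inter> Y = {}" by blast+
  qed
  show ?thesis
  proof (rule base_seqI)
    show "length ?Cs = k" using b(1) by simp
    show "basis (?Cs ! l)" if "l < k" for l using b(2) X that by (simp add: nth)
    show "?Cs ! l \<inter> ?Cs ! m = {}" if lm: "l < k" "m < k" "l \<noteq> m" for l m
      using rest[of l] rest[of m] XY(1) b(3)[of l m] lm by (simp add: nth Int_commute)
    have "(\<Union>l<k. ?Cs ! l) = X \<union> Y \<union> (\<Union>l\<in>{..<k} - {i, j}. Bs ! l)"
    proof -
      have "{..<k} = insert i (insert j ({..<k} - {i, j}))" using ij by auto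
      then have "(\<Union>l<k. ?Cs ! l) = ?Cs ! i \<union> (?Cs ! j \<union> (\<Union>l\<in>{..<k} - {i, j}. ?Cs ! l))"
        by (metis UN_insert)
      also have "(\<Union>l\<in>{..<k} - {i, j}. ?Cs ! l) = (\<Union>l\<in>{..<k} - {i, j}. Bs ! l)"
        by (intro SUP_cong) (auto simp: nth)
      also have "?Cs ! i = X" using ij b(1) by simp
      also have "?Cs ! j = Y" using ij b(1) by simp
      finally show ?thesis by (simp only: Un_assoc)
    qed
    also have "\<dots> = (\<Union>l<k. Bs ! l)" using XY(2) ij by blast
    finally show "(\<Union>l<k. ?Cs ! l) = edges G" using b(4) by simp
  qed
qed

lemma star_pairs_update:
  assumes Bs: "base_seq G \<C> k Bs" and ij: "i < k" "j < k" "i \<noteq> j"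
  shows "star_pairs (Bs[i := X, j := Y]) =
    (star_pairs Bs - {Bs ! i \<inter> D, Bs ! j \<inter> D}) \<union> {Z \<in> {X \<inter> D, Y \<inter> D}. card Z = 2}" (is "?L = ?R")
proof -
  let ?Cs = "Bs[i := X, j := Y]"
  note b = base_seqD[OF Bs]
  have len: "length ?Cs = k" using b(1) by simp
  have nth: "?Cs ! l = (if l = j then Y else if l = i then X else Bs ! l)" if "l < k" for l
    using that ij b(1) by auto
  \<comment> \<open>Disjoint bases have different nonempty traces on the star, so deleting the
    traces at \<open>i\<close> and \<open>j\<close> deletes no other pair.\<close>
  have differ: "Bs ! l \<inter> D \<noteq> Bs ! m \<inter> D" if "l < k" "m < k" "l \<noteq> m" "card (Bs ! l \<inter> D) = 2" for l m
  proof
    assume "Bs ! l \<inter> D = Bs ! m \<inter> D"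
    then have "Bs ! l \<inter> D = {}" using b(3)[OF that(1-3)] by blast
    then show False using that(4) by simp
  qed
  show ?thesis
  proof (intro subset_antisym subsetI)
    fix Z assume "Z \<in> ?L"
    then obtain l where l: "l < k" "Z = ?Cs ! l \<inter> D" "card Z = 2" unfolding star_pairs_iff len by auto
    show "Z \<in> ?R"
    proof (cases "l = i \<or> l = j")
      case True
      then show ?thesis using l ij by (auto simp: nth)
    next
      case False
      then have Z: "Z = Bs ! l \<inter> D" using l by (simp add: nth)
      then have "Z \<in> star_pairs Bs" using l b(1) by (auto simp: star_pairs_iff)
      moreover have "Z \<noteq> Bs ! i \<inter> D" "Z \<noteq> Bs ! j \<inter> D"
        using differ[of l i] differ[of l j] l(1,3) Z False ij(1,2) by simp_all
      ultimately show ?thesis by blast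
    qed
  next
    fix Z assume "Z \<in> ?R"
    then consider "Z \<in> star_pairs Bs" "Z \<noteq> Bs ! i \<inter> D" "Z \<noteq> Bs ! j \<inter> D"
      | "Z = X \<inter> D" "card Z = 2" | "Z = Y \<inter> D" "card Z = 2" by blast
    then show "Z \<in> ?L"
    proof cases
      case 1
      then obtain l where l: "l < k" "Z = Bs ! l \<inter> D" "card Z = 2" by (auto simp: star_pairs_iff b(1))
      then have "l \<noteq> i" "l \<noteq> j" using 1 by blast+
      then show ?thesis unfolding star_pairs_iff len using l by (intro exI[of _ l]) (simp add: nth)
    next
      case 2
      then show ?thesis unfolding star_pairs_iff len using ij by (intro exI[of _ i]) (simp add: b(1))
    next
      case 3
      then show ?thesis unfolding star_pairs_iff len using ij by (intro exI[of _ j]) (simp add: b(1))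
    qed
  qed
qed

lemma exchange_step_lift:
  assumes st: "exchange_step\<^sup>*\<^sup>* (Bs ! i, Bs ! j) (X, Y)"
    and Bs: "base_seq G \<C> k Bs" and ij: "i < k" "j < k" "i \<noteq> j"
  shows "base_seq G \<C> k (Bs[i := X, j := Y])" "exchange_equiv G \<C> Bs (Bs[i := X, j := Y])"
proof -
  note b = base_seqD[OF Bs]
  have "basis X \<and> basis Y \<and> X \<inter> Y = {} \<and> X \<union> Y = Bs ! i \<union> Bs ! j \<and>
      (sym_exchange G \<C>)\<^sup>*\<^sup>* Bs (Bs[i := X, j := Y])"
    using st
  proof (induction "(X, Y)" arbitrary: X Y rule: rtranclp_induct)
    case base
    then show ?case using b ij by auto
  next
    case (step p)
    obtain X0 Y0 where p: "p = (X0, Y0)" by (cases p)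
    obtain e f where ef: "e \<in> X0" "f \<in> Y0" "X = insert f (X0 - {e})" "Y = insert e (Y0 - {f})"
      "basis X" "basis Y" using step(2) unfolding p exchange_step_def by auto
    have IH: "basis X0" "basis Y0" "X0 \<inter> Y0 = {}" "X0 \<union> Y0 = Bs ! i \<union> Bs ! j"
      "(sym_exchange G \<C>)\<^sup>*\<^sup>* Bs (Bs[i := X0, j := Y0])" using step(3)[OF p] by auto
    have "sym_exchange G \<C> (Bs[i := X0, j := Y0]) (Bs[i := X, j := Y])"
      unfolding sym_exchange_def basis_eq
    proof (intro exI conjI)
      show "i < length (Bs[i := X0, j := Y0])" "j < length (Bs[i := X0, j := Y0])" "i \<noteq> j"
        using ij b(1) by auto
      show "e \<in> Bs[i := X0, j := Y0] ! i" "f \<in> Bs[i := X0, j := Y0] ! j"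
        "basis (insert f (Bs[i := X0, j := Y0] ! i - {e}))"
        "basis (insert e (Bs[i := X0, j := Y0] ! j - {f}))"
        using ij b(1) ef by auto
      show "Bs[i := X, j := Y] = Bs[i := X0, j := Y0, i := insert f (Bs[i := X0, j := Y0] ! i - {e}),
          j := insert e (Bs[i := X0, j := Y0] ! j - {f})]"
        using ij b(1) ef(3,4) by (simp add: list_update_swap[of j i])
    qed
    then have "(sym_exchange G \<C>)\<^sup>*\<^sup>* Bs (Bs[i := X, j := Y])"
      using IH(5) by (rule rtranclp.rtrancl_into_rtrancl[rotated])
    moreover have "X \<inter> Y = {}" "X \<union> Y = X0 \<union> Y0" using ef(1-4) IH(3) by blast+
    ultimately show ?case using ef(5,6) IH(4) by simp
  qed
  then show "base_seq G \<C> k (Bs[i := X, j := Y])" "exchange_equiv G \<C> Bs (Bs[i := X, j := Y])"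
    using base_seq_update[OF Bs ij] by (simp_all add: exchange_equiv_def)
qed

text \<open>Intermediate sequences need not be reduced: along \<open>swap_pairs\<close> a basis
  holds three star edges.\<close>

definition reachable :: "nat \<Rightarrow> 'e set list \<Rightarrow> 'e set list set" where
  "reachable k Bs0 = {Bs. exchange_equiv G \<C> Bs0 Bs \<and> base_seq G \<C> k Bs \<and> v_reduced G v Bs}"

lemma reachable_update:
  assumes Bs: "Bs \<in> reachable k Bs0" and st: "exchange_step\<^sup>*\<^sup>* (Bs ! i, Bs ! j) (X, Y)"
    and ij: "i < k" "j < k" "i \<noteq> j" and c: "card (X \<inter> D) \<le> 2" "card (Y \<inter> D) \<le> 2"
  shows "Bs[i := X, j := Y] \<in> reachable k Bs0"
proof -
  have b: "base_seq G \<C> k Bs" "v_reduced G v Bs" "exchange_equiv G \<C> Bs0 Bs"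
    using Bs by (auto simp: reachable_def)
  have "length Bs = k" using base_seqD(1)[OF b(1)] .
  then have "v_reduced G v (Bs[i := X, j := Y])"
    using b(2) c ij by (auto simp: v_reduced_iff nth_list_update)
  moreover have "exchange_equiv G \<C> Bs0 (Bs[i := X, j := Y])"
    using exchange_step_lift(2)[OF st b(1) ij] b(3) unfolding exchange_equiv_def by auto
  ultimately show ?thesis using exchange_step_lift(1)[OF st b(1) ij] by (simp add: reachable_def)
qed

lemma switch_one:
  assumes Bs: "Bs \<in> reachable k Bs0" and ij: "i < k" "j < k" "i \<noteq> j"
    and B: "Bs ! i = insert x (insert x' F)" "Bs ! j = insert y (insert y' H)"
    and F: "F \<inter> D = {}" "H \<inter> D = {}" and D: "{x, x', y, y'} \<subseteq> D" "distinct [x, x', y, y']"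
    and s: "sep F x' y" "sep H y' x"
  shows "movable (star_pairs ` reachable k Bs0) (star_pairs Bs) x' x y y'"
proof -
  let ?X = "insert y (insert x' F)" and ?Y = "insert x (insert y' H)"
  have b: "base_seq G \<C> k Bs" using Bs by (simp add: reachable_def)
  have out: "z \<notin> F" "z \<notin> H" if "z \<in> {x, x', y, y'}" for z using that D F by auto
  have star: "?X \<inter> D = {x', y}" "?Y \<inter> D = {x, y'}" "Bs ! i \<inter> D = {x', x}" "Bs ! j \<inter> D = {y, y'}"
    using F D B by auto
  have "exchange_step (Bs ! i, Bs ! j) (?X, ?Y)"
  proof (rule exchange_stepI[of x _ y])
    show "x \<in> Bs ! i" "y \<in> Bs ! j" using B by auto
    show "?X = insert y (Bs ! i - {x})" "?Y = insert x (Bs ! j - {y})" using B D out by auto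
    show "basis ?X" "basis ?Y" using s by (simp_all add: sep_def insert_commute[of x' y] insert_commute[of y' x])
  qed
  then have st: "exchange_step\<^sup>*\<^sup>* (Bs ! i, Bs ! j) (?X, ?Y)" by auto
  have two: "card {x', y} = 2" "card {x, y'} = 2" using D by auto
  have "Bs[i := ?X, j := ?Y] \<in> reachable k Bs0"
    by (rule reachable_update[OF Bs st ij]) (simp_all only: star two)
  moreover have "star_pairs (Bs[i := ?X, j := ?Y]) = rematch (star_pairs Bs) x' x y y'"
  proof -
    have "{Z \<in> {{x', y}, {x, y'}}. card Z = 2} = {{x', y}, {x, y'}}" using two by blast
    then show ?thesis unfolding star_pairs_update[OF b ij] rematch_def star by simp
  qed
  ultimately show ?thesis unfolding movable_def by (metis image_eqI)
qed

text \<open>The matching graph does not record which basis carries which pair. Stuck pairs can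
  therefore trade places unnoticed, which makes it possible to compare the partitions given by
  several bases on the same four points.\<close>

lemma stuck_swap:
  assumes Bs: "Bs \<in> reachable k Bs0" and ij: "i < k" "j < k" "i \<noteq> j"
    and B: "Bs ! i = insert a (insert b F)" "Bs ! j = insert c (insert d H)"
    and F: "F \<inter> D = {}" "H \<inter> D = {}" and D: "{a, b, c, d} \<subseteq> D" "distinct [a, b, c, d]"
    and stuck: "\<not> movable (star_pairs ` reachable k Bs0) (star_pairs Bs) a b c d"
  shows "sep F a c \<noteq> sep H a c"
    and "Bs[i := insert c (insert d F), j := insert a (insert b H)] \<in> reachable k Bs0"
    and "star_pairs (Bs[i := insert c (insert d F), j := insert a (insert b H)]) = star_pairs Bs"
proof -
  have b: "base_seq G \<C> k Bs" using Bs by (simp add: reachable_def)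
  note sw = switch_one[OF Bs ij _ _ F]
  have Bf: "Bs ! i = insert b (insert a F)" "Bs ! j = insert d (insert c H)"
    using B by (simp_all add: insert_commute)
  \<comment> \<open>These are the four exchanges of one of \<open>a\<close>, \<open>b\<close>
    against one of \<open>c\<close>, \<open>d\<close>.\<close>
  have n: "\<not> (sep F b c \<and> sep H d a)" "\<not> (sep F b d \<and> sep H c a)"
      "\<not> (sep F a c \<and> sep H d b)" "\<not> (sep F a d \<and> sep H c b)"
    using sw[of a b c d] sw[of a b d c] sw[of b a c d] sw[of b a d c] B Bf D stuck
    by (auto simp: movable_flip)
  have bas: "basis (Bs ! i)" "basis (Bs ! j)" using base_seqD(2)[OF b] ij by auto
  then have s: "sep F a b" "sep H c d" using B by (simp_all add: sep_def)
  have ne: "a \<noteq> b" "c \<noteq> d" using D by auto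
  note p = stuck_pairing[OF F D(1) ne s n]
  show "sep F a c \<noteq> sep H a c" by (rule p(3))
  have "F \<inter> H = {}" using base_seqD(3)[OF b ij] B by auto
  from swap_pairs[OF F this D s p(1,2) n(1,2)]
  have st: "exchange_step\<^sup>*\<^sup>* (Bs ! i, Bs ! j) (insert c (insert d F), insert a (insert b H))"
    using B by simp
  have star: "insert c (insert d F) \<inter> D = {c, d}" "insert a (insert b H) \<inter> D = {a, b}"
    "Bs ! i \<inter> D = {a, b}" "Bs ! j \<inter> D = {c, d}"
    using F D B by auto
  have two: "card {a, b} = 2" "card {c, d} = 2" using ne by auto
  show "Bs[i := insert c (insert d F), j := insert a (insert b H)] \<in> reachable k Bs0"
    by (rule reachable_update[OF Bs st ij]) (simp_all only: star two)
  have "length Bs = k" using base_seqD(1)[OF b] .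
  then have "{a, b} \<in> star_pairs Bs" "{c, d} \<in> star_pairs Bs"
    unfolding star_pairs_iff using ij star two by metis+
  moreover have "{Z \<in> {{c, d}, {a, b}}. card Z = 2} = {{c, d}, {a, b}}" using two by blast
  ultimately show "star_pairs (Bs[i := insert c (insert d F), j := insert a (insert b H)]) = star_pairs Bs"
    unfolding star_pairs_update[OF b ij] star by auto
qed

text \<open>If both pairs were stuck, permuting the three pairs over the three bases would give three
  pairwise distinct truth values \<open>sep F e c\<close>.\<close>

lemma switch_two_of_three:
  assumes Bs: "Bs \<in> reachable k Bs0" and E: "{a, b} \<in> star_pairs Bs" "{c, d} \<in> star_pairs Bs" "{e, f} \<in> star_pairs Bs"
    and dist: "distinct [a, b, c, d, e, f]"
  shows "movable (star_pairs ` reachable k Bs0) (star_pairs Bs) a b e f \<or>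
    movable (star_pairs ` reachable k Bs0) (star_pairs Bs) e f c d"
proof (rule ccontr)
  assume "\<not> ?thesis"
  then have n1: "\<not> movable (star_pairs ` reachable k Bs0) (star_pairs Bs) a b e f"
    and n2: "\<not> movable (star_pairs ` reachable k Bs0) (star_pairs Bs) e f c d" by auto
  have b: "base_seq G \<C> k Bs" using Bs by (simp add: reachable_def)
  have len: "length Bs = k" using base_seqD(1)[OF b] .
  obtain i where i: "i < k" "{a, b} = Bs ! i \<inter> D" using E(1) unfolding star_pairs_iff len by auto
  obtain l where l: "l < k" "{c, d} = Bs ! l \<inter> D" using E(2) unfolding star_pairs_iff len by auto
  obtain j where j: "j < k" "{e, f} = Bs ! j \<inter> D" using E(3) unfolding star_pairs_iff len by auto
  have ne: "i \<noteq> j" "i \<noteq> l" "j \<noteq> l" using i j l dist by (auto simp: doubleton_eq_iff)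
  define Fi Fj Fl where "Fi = Bs ! i - D" and "Fj = Bs ! j - D" and "Fl = Bs ! l - D"
  have F: "Fi \<inter> D = {}" "Fj \<inter> D = {}" "Fl \<inter> D = {}" by (auto simp: Fi_def Fj_def Fl_def)
  have B0: "Bs ! i = insert a (insert b Fi)" "Bs ! j = insert e (insert f Fj)" "Bs ! l = insert c (insert d Fl)"
    using i(2) j(2) l(2) unfolding Fi_def Fj_def Fl_def by blast+
  have inD: "{a, b} \<subseteq> D" "{c, d} \<subseteq> D" "{e, f} \<subseteq> D" using i(2) j(2) l(2) by auto
  have D: "{a, b, e, f} \<subseteq> D" "{e, f, c, d} \<subseteq> D" using inD by auto
  have d: "distinct [a, b, e, f]" "distinct [e, f, c, d]" using dist by auto
  \<comment> \<open>The bases at \<open>i\<close>, \<open>j\<close>, \<open>l\<close> carry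
    \<open>ab\<close>, \<open>ef\<close>, \<open>cd\<close> in \<open>Bs\<close>, then
    \<open>ef\<close>, \<open>ab\<close>, \<open>cd\<close>, then \<open>cd\<close>,
    \<open>ab\<close>, \<open>ef\<close>, and finally \<open>cd\<close>, \<open>ef\<close>,
    \<open>ab\<close>. Thus each two of the three bases carry \<open>ef\<close> and
    \<open>cd\<close> at some stage.\<close>
  define Bs1 where "Bs1 = Bs[i := insert e (insert f Fi), j := insert a (insert b Fj)]"
  define Bs2 where "Bs2 = Bs1[i := insert c (insert d Fi), l := insert e (insert f Fl)]"
  define Bs3 where "Bs3 = Bs2[j := insert e (insert f Fj), l := insert a (insert b Fl)]"
  have t1: "sep Fj e c \<noteq> sep Fl e c"
    by (rule stuck_swap(1)[OF Bs j(1) l(1) ne(3) B0(2,3) F(2,3) D(2) d(2) n2])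
  have R1: "Bs1 \<in> reachable k Bs0" "star_pairs Bs1 = star_pairs Bs"
    unfolding Bs1_def by (rule stuck_swap(2,3)[OF Bs i(1) j(1) ne(1) B0(1,2) F(1,2) D(1) d(1) n1])+
  have B1: "Bs1 ! i = insert e (insert f Fi)" "Bs1 ! j = insert a (insert b Fj)" "Bs1 ! l = insert c (insert d Fl)"
    "length Bs1 = k"
    using len i(1) j(1) l(1) ne B0 by (simp_all add: Bs1_def)
  note n2' = n2[folded R1(2)]
  have t2: "sep Fi e c \<noteq> sep Fl e c"
    by (rule stuck_swap(1)[OF R1(1) i(1) l(1) ne(2) B1(1,3) F(1,3) D(2) d(2) n2'])
  have R2: "Bs2 \<in> reachable k Bs0" "star_pairs Bs2 = star_pairs Bs"
    unfolding Bs2_def R1(2)[symmetric]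
    by (rule stuck_swap(2,3)[OF R1(1) i(1) l(1) ne(2) B1(1,3) F(1,3) D(2) d(2) n2'])+
  have B2: "Bs2 ! i = insert c (insert d Fi)" "Bs2 ! j = insert a (insert b Fj)" "Bs2 ! l = insert e (insert f Fl)"
    "length Bs2 = k"
    using i(1) j(1) l(1) ne B1 by (simp_all add: Bs2_def)
  note n1' = n1[folded R2(2)]
  have R3: "Bs3 \<in> reachable k Bs0" "star_pairs Bs3 = star_pairs Bs"
    unfolding Bs3_def R2(2)[symmetric]
    by (rule stuck_swap(2,3)[OF R2(1) j(1) l(1) ne(3) B2(2,3) F(2,3) D(1) d(1) n1'])+
  have B3: "Bs3 ! i = insert c (insert d Fi)" "Bs3 ! j = insert e (insert f Fj)"
    using i(1) j(1) l(1) ne B2 by (simp_all add: Bs3_def)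
  have "sep Fj e c \<noteq> sep Fi e c"
    by (rule stuck_swap(1)[OF R3(1) j(1) i(1) ne(1)[symmetric] B3(2,1) F(2,1) D(2) d(2) n2[folded R3(2)]])
  then show False using t1 t2 by blast
qed

text \<open>\<open>c\<close> is the only star edge of its basis. Once it is given up, that basis
  must still meet the star, so the edge received by symmetric exchange is \<open>a\<close> or
  \<open>b\<close>.\<close>

lemma shift_single:
  assumes Bs: "Bs \<in> reachable k Bs0" and E: "{a, b} \<in> star_pairs Bs" and c: "c \<in> D - \<Union>(star_pairs Bs)"
  shows "insert {a, c} (star_pairs Bs - {{a, b}}) \<in> star_pairs ` reachable k Bs0 \<or>
    insert {b, c} (star_pairs Bs - {{a, b}}) \<in> star_pairs ` reachable k Bs0"
proof -
  have b: "base_seq G \<C> k Bs" "v_reduced G v Bs" using Bs by (auto simp: reachable_def)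
  note bs = base_seqD[OF b(1)]
  obtain i where i: "i < k" "{a, b} = Bs ! i \<inter> D" "card {a, b} = 2"
    using E unfolding star_pairs_iff bs(1) by auto
  have "c \<in> edges G" using c by (simp add: incident_edges_def)
  then obtain j where j: "j < k" "c \<in> Bs ! j" using bs(4) by blast
  have cj: "c \<in> Bs ! j \<inter> D" using j c by auto
  have "card (Bs ! j \<inter> D) \<noteq> 2"
  proof
    assume "card (Bs ! j \<inter> D) = 2"
    then have "Bs ! j \<inter> D \<in> star_pairs Bs" using j bs(1) by (auto simp: star_pairs_iff)
    then show False using cj c by blast
  qed
  moreover have "card (Bs ! j \<inter> D) \<le> 2" using b(2) j bs(1) by (simp add: v_reduced_iff)
  moreover have "finite (Bs ! j \<inter> D)" using basis_finite[OF bs(2)[OF j(1)]] by auto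
  then have "card (Bs ! j \<inter> D) \<noteq> 0" using cj by auto
  ultimately have "card (Bs ! j \<inter> D) = 1" by linarith
  then have jD: "Bs ! j \<inter> D = {c}" using cj by (metis card_1_singletonE singletonD)
  have ab: "a \<noteq> b" using i(3) by auto
  have ij: "j \<noteq> i" using jD i(2) ab by auto
  have ci: "c \<notin> Bs ! i" using bs(3)[OF j(1) i(1) ij] j(2) by auto
  obtain f where f: "f \<in> Bs ! i" "f \<notin> Bs ! j" "basis (insert f (Bs ! j - {c}))" "basis (insert c (Bs ! i - {f}))"
    using symmetric_exchange[OF bs(2)[OF j(1)] bs(2)[OF i(1)] j(2) ci] by auto
  have "insert f (Bs ! j - {c}) \<inter> D \<noteq> {}" using basis_meets_star[OF f(3)] c by auto
  then have fD: "f \<in> D" using jD by auto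
  then have fab: "f \<in> {a, b}" using f i(2) by auto
  then obtain g where g: "{f, g} = {a, b}" "f \<noteq> g" "g \<in> {a, b}" using ab by (auto simp: doubleton_eq_iff)
  let ?X = "insert f (Bs ! j - {c})" and ?Y = "insert c (Bs ! i - {f})"
  have star: "?X \<inter> D = {f}" "?Y \<inter> D = {g, c}"
    using jD i(2) g fD cj by auto
  have st: "exchange_step\<^sup>*\<^sup>* (Bs ! j, Bs ! i) (?X, ?Y)"
    using exchange_stepI[of c _ f, OF j(2) f(1) refl refl f(3,4)] by auto
  have gc: "g \<noteq> c" using ci g(3) i(2) by auto
  then have "Bs[j := ?X, i := ?Y] \<in> reachable k Bs0"
    by (intro reachable_update[OF Bs st j(1) i(1) ij]) (simp_all add: star)
  moreover have "star_pairs (Bs[j := ?X, i := ?Y]) = insert {g, c} (star_pairs Bs - {{a, b}})"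
  proof -
    have "{c} \<notin> star_pairs Bs" by (auto simp: star_pairs_iff)
    then have "star_pairs Bs - {{c}, {a, b}} = star_pairs Bs - {{a, b}}" by blast
    moreover have "{Z \<in> {{f}, {g, c}}. card Z = 2} = {{g, c}}" using gc by auto
    ultimately show ?thesis unfolding star_pairs_update[OF b(1) j(1) i(1) ij] star jD i(2)[symmetric]
      by simp
  qed
  ultimately have "insert {g, c} (star_pairs Bs - {{a, b}}) \<in> star_pairs ` reachable k Bs0"
    by (metis image_eqI)
  then show ?thesis using g(3) by blast
qed

text \<open>Every basis meets a nonempty star once or twice: each of the \<open>k\<close> bases
  accounts for one star edge, and each pair for one more.\<close>

lemma card_star_pairs:
  assumes Bs: "base_seq G \<C> k Bs" "v_reduced G v Bs"
  shows "card (star_pairs Bs) = card D - k"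
\<comment> \<open>For an empty star the bases meet it in nothing, and the truncated difference is
  0.\<close>
proof (cases "D = {}")
  case True
  then show ?thesis by (simp add: matching_graph_def)
next
  case False
  note bs = base_seqD[OF Bs(1)]
  let ?I = "{l. l < k \<and> card (Bs ! l \<inter> D) = 2}"
  have fin: "finite (Bs ! l)" if "l < k" for l using basis_finite[OF bs(2)[OF that]] .
  have one: "card (Bs ! l \<inter> D) = 1 + (if card (Bs ! l \<inter> D) = 2 then 1 else 0)" if l: "l < k" for l
  proof -
    have "card (Bs ! l \<inter> D) \<noteq> 0" using basis_meets_star[OF bs(2)[OF l] False] fin[OF l] by simp
    moreover have "card (Bs ! l \<inter> D) \<le> 2" using Bs(2) l bs(1) by (simp add: v_reduced_iff)
    ultimately show ?thesis by auto
  qed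
  have "D = (\<Union>l<k. Bs ! l \<inter> D)" using bs(4) by (auto simp: incident_edges_def)
  then have "card D = card (\<Union>l<k. Bs ! l \<inter> D)" by simp
  also have "\<dots> = (\<Sum>l<k. card (Bs ! l \<inter> D))"
    using fin bs(3) by (intro card_UN_disjoint) blast+
  also have "\<dots> = (\<Sum>l<k. 1 + (if card (Bs ! l \<inter> D) = 2 then 1 else 0))"
    using one by (intro sum.cong) simp_all
  also have "\<dots> = k + card ?I"
  proof -
    have "(\<Sum>l<k. if card (Bs ! l \<inter> D) = 2 then 1 else 0) = (\<Sum>l\<in>{..<k} \<inter> {l. card (Bs ! l \<inter> D) = 2}. 1)"
      by (subst sum.inter_restrict) auto
    also have "\<dots> = card ?I" by (simp add: Collect_conj_eq lessThan_def)
    finally show ?thesis by (subst sum.distrib) simp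
  qed
  finally have "card D = k + card ?I" .
  moreover have "star_pairs Bs = (\<lambda>l. Bs ! l \<inter> D) ` ?I" by (auto simp: star_pairs_iff bs(1))
  moreover have "inj_on (\<lambda>l. Bs ! l \<inter> D) ?I"
  proof (rule inj_onI)
    fix l m assume l: "l \<in> ?I" and m: "m \<in> ?I" and eq: "Bs ! l \<inter> D = Bs ! m \<inter> D"
    have "Bs ! l \<inter> D \<noteq> {}" using l by auto
    then show "l = m" using bs(3)[of l m] l m eq by auto
  qed
  ultimately show ?thesis by (simp add: card_image)
qed

text \<open>The size \<open>card D - k\<close> depends only on the star and on \<open>k\<close>, so
  two sequences give families with the same parameters, ready to be compared.\<close>

lemma matching_family_reachable:
  assumes Bs0: "base_seq G \<C> k Bs0" "v_reduced G v Bs0"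
  shows "matching_family D (card D - k) (star_pairs ` reachable k Bs0)"
proof
  show "finite D" using finite_carrier by (auto simp: incident_edges_def)
  have "Bs0 \<in> reachable k Bs0" using Bs0 by (simp add: reachable_def exchange_equiv_def)
  then show "star_pairs ` reachable k Bs0 \<noteq> {}" by auto
next
  fix E assume "E \<in> star_pairs ` reachable k Bs0"
  then obtain Bs where Bs: "Bs \<in> reachable k Bs0" and E: "E = star_pairs Bs" by auto
  have b: "base_seq G \<C> k Bs" "v_reduced G v Bs" using Bs by (auto simp: reachable_def)
  note bs = base_seqD[OF b(1)]
  show "pair_matching E"
    unfolding pair_matching_def
  proof (intro conjI ballI impI)
    show "card X = 2" if "X \<in> E" for X using that by (auto simp: E star_pairs_iff)
    show "X \<inter> Y = {}" if XY: "X \<in> E" "Y \<in> E" "X \<noteq> Y" for X Y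
    proof -
      obtain l m where lm: "l < k" "m < k" "X = Bs ! l \<inter> D" "Y = Bs ! m \<inter> D"
        using XY(1,2) unfolding E star_pairs_iff bs(1) by blast
      then have "l \<noteq> m" using XY(3) by auto
      then show ?thesis using bs(3)[OF lm(1,2)] lm by blast
    qed
  qed
  show "\<Union>E \<subseteq> D" by (auto simp: E star_pairs_iff)
  show "card E = card D - k" unfolding E by (rule card_star_pairs[OF b])
  show "insert {a, c} (E - {{a, b}}) \<in> star_pairs ` reachable k Bs0 \<or>
      insert {b, c} (E - {{a, b}}) \<in> star_pairs ` reachable k Bs0"
    if "{a, b} \<in> E" "c \<in> D - \<Union>E" for a b c
    using shift_single[OF Bs] that E by blast
  show "movable (star_pairs ` reachable k Bs0) E a b e f \<or> movable (star_pairs ` reachable k Bs0) E e f c d"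
    if "{a, b} \<in> E" "{c, d} \<in> E" "{e, f} \<in> E" "distinct [a, b, c, d, e, f]" for a b c d e f
    using switch_two_of_three[OF Bs] that E by blast
qed

end

section \<open>The replicated graph\<close>

text \<open>A sequence of bases covers all edges, so no edge at \<open>v\<close> is a balanced loop.
  This supplies the premise \<open>ind {e}\<close> of \<open>ind_insert_incident\<close>.\<close>

lemma (in linear_bias_space) frame_star_bias:
  assumes Bs: "base_seq G bias k Bs"
  shows "frame_star G bias v"
proof -
  interpret matroid "edges G" ind by (rule matroid_ind)
  have "matroid_star (edges G) ind (incident_edges G v)"
  proof
    fix X e assume X: "ind X" "X \<inter> incident_edges G v = {}" and e: "e \<in> incident_edges G v"
    then have "e \<in> \<Union>(set Bs)" using Bs by (auto simp: base_seq_def incident_edges_def)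
    then obtain B where B: "B \<in> set Bs" "e \<in> B" by auto
    then have "frame_basis G bias B" using Bs by (simp add: base_seq_def)
    then have "ind B" by (simp only: frame_basis_def frame_indep_iff_ind)
    then have "ind {e}" using ind_subset B by blast
    then show "ind (insert e X)" using ind_insert_incident X e by blast
  qed
  then show ?thesis by (simp only: frame_star_def frame_indep_iff_ind)
qed

lemma sdiff_Sdiff:
  assumes "finite F" "finite F'" shows "sdiff (Sdiff F) (Sdiff F') = Sdiff (sdiff F F')"
proof (rule set_eqI)
  fix x
  have "{X \<in> sdiff F F'. x \<in> X} = sdiff {X \<in> F. x \<in> X} {X \<in> F'. x \<in> X}" by (auto simp: sdiff_def)
  then have "card {X \<in> sdiff F F'. x \<in> X} + 2 * card ({X \<in> F. x \<in> X} \<inter> {X \<in> F'. x \<in> X}) =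
      card {X \<in> F. x \<in> X} + card {X \<in> F'. x \<in> X}"
    using sdiff_card[of "{X \<in> F. x \<in> X}" "{X \<in> F'. x \<in> X}"] assms by simp
  then have "odd (card {X \<in> sdiff F F'. x \<in> X}) \<longleftrightarrow>
      odd (card {X \<in> F. x \<in> X}) \<noteq> odd (card {X \<in> F'. x \<in> X})" by presburger
  then show "x \<in> sdiff (Sdiff F) (Sdiff F') \<longleftrightarrow> x \<in> Sdiff (sdiff F F')"
    unfolding Sdiff_def sdiff_def[of "{x. _ x}"] by auto
qed

lemma multigraph_replicate: assumes "multigraph G" shows "multigraph (replicate_graph G w)"
proof -
  have "{(e, i). e \<in> edges G \<and> i < w e} = Sigma (edges G) (\<lambda>e. {..<w e})" by auto
  then show ?thesis using assms by (auto simp: multigraph_def replicate_graph_def)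
qed

text \<open>The space is the span, over the two-element field, of the lifted balanced cycles and the
  digons; its elements need not be cycles.\<close>

lemma linear_bias_space_replicate:
  assumes "multigraph G"
  obtains \<D> where "linear_bias_space (replicate_graph G w) \<D>"
    "replicate_bias G \<C> w = {C. is_cycle (replicate_graph G w) C \<and> C \<in> \<D>}"
proof -
  let ?H = "replicate_graph G w"
  define L where "L = {X. X \<subseteq> edges ?H \<and> inj_on fst X \<and> fst ` X \<in> \<C>} \<union>
    {{(e, i), (e, j)} | e i j. i \<noteq> j \<and> is_cycle ?H {(e, i), (e, j)}}"
  let ?D = "{Sdiff F | F. finite F \<and> F \<subseteq> L}"
  have "linear_bias_space ?H ?D"
  proof
    show "multigraph ?H" by (rule multigraph_replicate[OF assms])
    show "{} \<in> ?D" by (intro CollectI exI[of _ "{}"]) (simp add: Sdiff_def)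
    fix X Y assume "X \<in> ?D" "Y \<in> ?D"
    then obtain F F' where F: "X = Sdiff F" "finite F" "F \<subseteq> L" "Y = Sdiff F'" "finite F'" "F' \<subseteq> L" by auto
    have "finite (sdiff F F')" "sdiff F F' \<subseteq> L" using F by (auto simp: sdiff_def)
    moreover have "sdiff X Y = Sdiff (sdiff F F')" using sdiff_Sdiff F by simp
    ultimately show "sdiff X Y \<in> ?D" by (intro CollectI exI[of _ "sdiff F F'"]) simp
  qed
  moreover have "replicate_bias G \<C> w = {C. is_cycle ?H C \<and> C \<in> ?D}"
    unfolding replicate_bias_def Let_def L_def by blast
  ultimately show thesis by (rule that)
qed

section \<open>A square as the only nontrivial component\<close>

lemma nontrivial_components_square:
  fixes V :: "'a set"
  assumes d: "distinct [a, b, c, d]" and V: "{a, b, c, d} \<subseteq> V"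
  defines "M \<equiv> \<lparr>verts = V, edges = {{a, b}, {b, c}, {c, d}, {d, a}}, ends = (\<lambda>X. X)\<rparr>"
  obtains K where "nontrivial_components M = {K}" "cycle_graph K" "card (edges K) = 4"
proof -
  let ?S = "{a, b, c, d}" and ?E = "{{a, b}, {b, c}, {c, d}, {d, a}}"
  define K where "K = \<lparr>verts = ?S, edges = ?E, ends = (\<lambda>X::'a set. X)\<rparr>"
  have adjM: "adj M = {(x, y). {x, y} \<in> ?E}" by (auto simp: adj_def M_def)
  have adjK: "adj K = adj M" by (simp add: adj_def M_def K_def)
  have inS: "x \<in> ?S \<and> y \<in> ?S" if "(x, y) \<in> adj M" for x y
    using that unfolding adjM by (auto simp: doubleton_eq_iff)
  have closed: "x = y \<or> x \<in> ?S \<and> y \<in> ?S" if "(x, y) \<in> (adj M)\<^sup>*" for x y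
    using that
  proof (induction rule: rtrancl_induct)
    case base
    then show ?case by simp
  next
    case (step y z)
    then show ?case using inS[OF step(2)] by metis
  qed
  have symM: "sym ((adj M)\<^sup>*)"
  proof (rule sym_rtrancl, rule symI)
    show "(y, x) \<in> adj M" if "(x, y) \<in> adj M" for x y using that by (simp add: adjM insert_commute)
  qed
  have steps: "(a, b) \<in> adj M" "(b, c) \<in> adj M" "(c, d) \<in> adj M" by (simp_all add: adjM)
  have ab: "(a, b) \<in> (adj M)\<^sup>*" using steps by auto
  have ac: "(a, c) \<in> (adj M)\<^sup>*" using rtrancl_into_rtrancl[OF ab steps(2)] .
  have ad: "(a, d) \<in> (adj M)\<^sup>*" using rtrancl_into_rtrancl[OF ac steps(3)] .
  have froma: "(a, x) \<in> (adj M)\<^sup>*" if "x \<in> ?S" for x using that ab ac ad by auto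
  have all: "(x, y) \<in> (adj M)\<^sup>*" if "x \<in> ?S" "y \<in> ?S" for x y
    using symD[OF symM froma[OF that(1)]] froma[OF that(2)] by (rule rtrancl_trans)
  have compS: "component_of M x = K" if x: "x \<in> ?S" for x
  proof -
    have "{y \<in> verts M. (x, y) \<in> (adj M)\<^sup>*} = ?S"
    proof (intro subset_antisym subsetI)
      show "y \<in> ?S" if "y \<in> {y \<in> verts M. (x, y) \<in> (adj M)\<^sup>*}" for y using that closed[of x y] x by auto
      show "y \<in> {y \<in> verts M. (x, y) \<in> (adj M)\<^sup>*}" if "y \<in> ?S" for y
        using all[OF x that] V that by (auto simp: M_def)
    qed
    moreover have "{e \<in> edges M. ends M e \<subseteq> ?S} = ?E" by (auto simp: M_def)
    ultimately show ?thesis by (simp add: component_of_def K_def M_def)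
  qed
  have compO: "edges (component_of M x) = {}" if x: "x \<notin> ?S" for x
  proof -
    have W: "{y \<in> verts M. (x, y) \<in> (adj M)\<^sup>*} \<subseteq> {x}" using closed[of x] x by blast
    have none: "\<not> e \<subseteq> {y \<in> verts M. (x, y) \<in> (adj M)\<^sup>*}" if "e \<in> ?E" for e
    proof -
      \<comment> \<open>The opposite corners \<open>a\<close> and \<open>c\<close> meet all four
        edges, and neither is reachable from a vertex outside the square.\<close>
      have "a \<in> e \<or> c \<in> e" using that by auto
      then show ?thesis using W x by blast
    qed
    have eq: "edges (component_of M x) = {e \<in> ?E. e \<subseteq> {y \<in> verts M. (x, y) \<in> (adj M)\<^sup>*}}"
      by (simp add: component_of_def M_def Let_def)
    show ?thesis unfolding eq
      by (rule equals0I) (erule CollectE, erule conjE, drule none, erule notE)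
  qed
  have "nontrivial_components M = {K}"
  proof (intro subset_antisym subsetI)
    fix L assume "L \<in> nontrivial_components M"
    then obtain x where "L = component_of M x" "edges L \<noteq> {}"
      by (auto simp: nontrivial_components_def components_def)
    then show "L \<in> {K}" using compS[of x] compO[of x] by (cases "x \<in> ?S") simp_all
  next
    fix L assume "L \<in> {K}"
    moreover have "K = component_of M a" using compS[of a] by simp
    moreover have "a \<in> verts M" using V by (simp add: M_def)
    moreover have "edges K \<noteq> {}" by (simp add: K_def)
    ultimately show "L \<in> nontrivial_components M"
      by (auto simp: nontrivial_components_def components_def)
  qed
  moreover have "cycle_graph K"
    unfolding cycle_graph_def
  proof (intro conjI ballI)
    show "finite (edges K)" "edges K \<noteq> {}" by (simp_all add: K_def)
    show "connected_graph K"
      unfolding connected_graph_def adjK using all by (simp add: K_def)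
    fix x assume x: "x \<in> verts K"
    have "{e \<in> edges K. ends K e = {x}} = {}" using d by (auto simp: K_def doubleton_eq_iff)
    then have "card {e \<in> edges K. ends K e = {x}} = 0" by (simp only: card.empty)
    moreover have "card (incident_edges K x) = 2"
    proof -
      have "incident_edges K a = {{a, b}, {d, a}}" "incident_edges K b = {{a, b}, {b, c}}"
        "incident_edges K c = {{b, c}, {c, d}}" "incident_edges K d = {{c, d}, {d, a}}"
        using d by (auto simp: incident_edges_def K_def)
      moreover have "{a, b} \<noteq> {d, a}" "{a, b} \<noteq> {b, c}" "{b, c} \<noteq> {c, d}" "{c, d} \<noteq> {d, a}"
        using d by (auto simp: doubleton_eq_iff)
      ultimately have "card (incident_edges K a) = 2" "card (incident_edges K b) = 2"
        "card (incident_edges K c) = 2" "card (incident_edges K d) = 2"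
        by (simp_all only: card_2_iff) blast+
      moreover have "x = a \<or> x = b \<or> x = c \<or> x = d" using x by (simp add: K_def)
      ultimately show ?thesis by metis
    qed
    ultimately show "degree K x = 2" by (simp add: degree_def)
  qed
  moreover have "card (edges K) = 4" using d by (auto simp: K_def doubleton_eq_iff)
  ultimately show thesis by (rule that)
qed

theorem theorem8p1:
  fixes G :: "('v, 'e) mgraph" and \<C> :: "'e set set" and \<kappa> :: nat
    and Ds Ds' :: "'e set list"
    and G\<^sub>\<kappa> :: "('v, 'e \<times> nat) mgraph" and \<C>\<^sub>\<kappa> :: "('e \<times> nat) set set"
    and v :: 'v and Bs1 Bs2 :: "('e \<times> nat) set list"
  assumes "biased_graph G \<C>" and "linear_bias G \<C>" and "connected_graph G"
    and "\<kappa> \<ge> 2"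
    and "length Ds = \<kappa>" and "\<forall>D\<in>set Ds. frame_basis G \<C> D"
    and "length Ds' = \<kappa>" and "\<forall>D\<in>set Ds'. frame_basis G \<C> D"
    and "compatible Ds Ds'"
    and "G\<^sub>\<kappa> = replicate_graph G (omega Ds)"
    and "\<C>\<^sub>\<kappa> = replicate_bias G \<C> (omega Ds)"
    and "v \<in> verts G\<^sub>\<kappa>" and "card (incident_edges G\<^sub>\<kappa> v) \<le> 2 * \<kappa>"
    and "base_seq G\<^sub>\<kappa> \<C>\<^sub>\<kappa> \<kappa> Bs1" and "v_reduced G\<^sub>\<kappa> v Bs1"
    and "base_seq G\<^sub>\<kappa> \<C>\<^sub>\<kappa> \<kappa> Bs2" and "v_reduced G\<^sub>\<kappa> v Bs2"
  shows "\<exists>Bs1' Bs2'.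
      base_seq G\<^sub>\<kappa> \<C>\<^sub>\<kappa> \<kappa> Bs1' \<and> v_reduced G\<^sub>\<kappa> v Bs1' \<and>
      base_seq G\<^sub>\<kappa> \<C>\<^sub>\<kappa> \<kappa> Bs2' \<and> v_reduced G\<^sub>\<kappa> v Bs2' \<and>
      exchange_equiv G\<^sub>\<kappa> \<C>\<^sub>\<kappa> Bs1 Bs1' \<and> exchange_equiv G\<^sub>\<kappa> \<C>\<^sub>\<kappa> Bs2 Bs2' \<and>
      (matching_graph G\<^sub>\<kappa> v Bs1' = matching_graph G\<^sub>\<kappa> v Bs2' \<or>
       (matching_graph G\<^sub>\<kappa> v Bs1' \<noteq> matching_graph G\<^sub>\<kappa> v Bs2' \<and>
        (\<exists>K. nontrivial_components
               (graph_sdiff (matching_graph G\<^sub>\<kappa> v Bs1') (matching_graph G\<^sub>\<kappa> v Bs2')) = {K} \<and>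
             cycle_graph K \<and> card (edges K) = 4)))"
proof -
  have "multigraph G" using assms(1) by (simp add: biased_graph_def)
  then obtain \<D> where space: "linear_bias_space G\<^sub>\<kappa> \<D>" and bias: "\<C>\<^sub>\<kappa> = {C. is_cycle G\<^sub>\<kappa> C \<and> C \<in> \<D>}"
    using linear_bias_space_replicate[of G "omega Ds" \<C>] assms(10,11) by metis
  interpret frame_star G\<^sub>\<kappa> \<C>\<^sub>\<kappa> v
    using linear_bias_space.frame_star_bias[OF space] assms(14) unfolding bias .
  obtain E1 E2 where E: "E1 \<in> star_pairs ` reachable \<kappa> Bs1" "E2 \<in> star_pairs ` reachable \<kappa> Bs2"
    and close: "E1 = E2 \<or> (\<exists>a b c d. distinct [a, b, c, d] \<and>
      E1 - E2 = {{a, b}, {c, d}} \<and> E2 - E1 = {{b, c}, {d, a}})"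
    by (rule matching_families_close[OF matching_family_reachable[OF assms(14,15)]
          matching_family_reachable[OF assms(16,17)]])
  obtain Bs1' Bs2' where Bs: "Bs1' \<in> reachable \<kappa> Bs1" "Bs2' \<in> reachable \<kappa> Bs2"
    and E12: "E1 = star_pairs Bs1'" "E2 = star_pairs Bs2'" using E by auto
  let ?M1 = "matching_graph G\<^sub>\<kappa> v Bs1'" and ?M2 = "matching_graph G\<^sub>\<kappa> v Bs2'"
  have "?M1 = ?M2 \<or> ?M1 \<noteq> ?M2 \<and>
      (\<exists>K. nontrivial_components (graph_sdiff ?M1 ?M2) = {K} \<and> cycle_graph K \<and> card (edges K) = 4)"
    using close
  proof
    assume "E1 = E2"
    \<comment> \<open>The vertex set and \<open>ends\<close> are the same for both sequences, so
      only the edge sets have to agree.\<close>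
    then have "?M1 = ?M2" unfolding E12 by (simp add: matching_graph_def)
    then show ?thesis by simp
  next
    assume "\<exists>a b c d. distinct [a, b, c, d] \<and> E1 - E2 = {{a, b}, {c, d}} \<and> E2 - E1 = {{b, c}, {d, a}}"
    then obtain a b c d where d: "distinct [a, b, c, d]"
      and diff: "E1 - E2 = {{a, b}, {c, d}}" "E2 - E1 = {{b, c}, {d, a}}" by (elim exE conjE)
    have neq: "?M1 \<noteq> ?M2"
    proof
      assume "?M1 = ?M2"
      then have "E1 - E2 = {}" unfolding E12 by simp
      then show False unfolding diff by simp
    qed
    have "{a, b} \<in> E1" "{c, d} \<in> E1" using diff by blast+
    then have V: "{a, b, c, d} \<subseteq> D" unfolding E12 star_pairs_iff by blast
    have "sdiff E1 E2 = {{a, b}, {b, c}, {c, d}, {d, a}}" unfolding sdiff_def diff by auto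
    then have "graph_sdiff ?M1 ?M2 =
        \<lparr>verts = D, edges = {{a, b}, {b, c}, {c, d}, {d, a}}, ends = (\<lambda>X. X)\<rparr>"
      unfolding E12 graph_sdiff_def by (simp add: matching_graph_def)
    then show ?thesis using nontrivial_components_square[OF d V] neq by metis
  qed
  then show ?thesis using Bs unfolding reachable_def by blast
qed

end
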